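(* Let $u_L^*=(v_L^*,w_L^* )\in\mathcal H_1$, $u_R^*=(v_R^*,w_R^* )\in\mathcal H_3$ be such that the Riemann problem with data $u_L^*$ (left), $u_R^*$ (right) is solved by a single phase boundary of speed $V^*$ and no contact discontinuity; if $V^*=c_3$, assume $w_L^*=0$ and $w_R^*=\sqrt{\phi'(c_3)/c_3}$. Let $u_L^0\in BV_{loc}(\mathbb R_-,\mathcal H_1)$, $u_R^0\in BV_{loc}(\mathbb R_+,\mathcal H_3)$ with $\|u_L^0-u_L^*\|_{BV(\mathbb R_-)}+\|u_R^0-u_R^*\|_{BV(\mathbb R_+)}$ sufficiently small, and let $u^h$ be given by Glimm's scheme with initial data $u_0=u_L^0$ for $x<0$, $u_0=u_R^0$ for $x>0$. Let $\chi^h$ be the approximate phase boundary in $u^h$ and $\dot\chi^h(t)=\frac{d\chi^h}{dt}$ (constant on each interval $[n\tau,(n+1)\tau[$). Then, along a subsequence $h\to0$, the functions $\chi^h$ and $\dot\chi^h$ converge to a function $\chi\in W^{1,\infty}_{loc}([0,\infty[,\mathbb R)$ and to $\frac{d\chi}{dt}$ respectively, in the following sense: $$\|\chi-\chi^h\|_{L^\infty(]0,T[)}\to0\quad\text{when }h\to0,\ \text{for all }T>0,$$ and $$\dot\chi^h(t)\to\frac{d\chi(t)}{dt}\quad\text{for all times }t\in\mathbb R_+\setminus E,$$ where $E\subset\mathbb R_+$ is an at most countable set.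
   Context: Notation: $]a,b[$ is the open interval; $\|f\|_{BV(\Omega)}=\|f\|_{L^1(\Omega)}+TV_\Omega(f)$. System $\partial_tw-\partial_xv=0$, $\partial_tv-\partial_x\sigma(w)=0$, $u=(v,w)$. Let $k_1>k_3>0$, $w_m>w_M>0$, $c_1=\sqrt{k_1}$, $c_3=\sqrt{k_3}$. $\sigma:]-1,\infty[\to\mathbb R$ is $\sigma(w)=k_1w$ for $-1<w\le w_M$, $\sigma(w)=k_3w$ for $w\ge w_m$, and affine on $[w_M,w_m]$ joining these values continuously. $\mathcal H_1=\{(v,w):v\in\mathbb R,-1<w\le w_M\}$, $\mathcal H_3=\{(v,w):v\in\mathbb R,w\ge w_m\}$, $\mathcal H=\mathcal H_1\cup\mathcal H_3$. Entropy dissipation function. $\phi:]-c_3,c_3]\to\mathbb R$ is given with: $\phi\in C^2(]-c_3,0[\cup]0,c_3])$ and $\phi(0\pm),\phi'(0\pm)$ exist; $\lim_{V\to c_3^-}\phi=\overline\psi(c_3)$ and $\phi'''(c_3-)$ exists; $\lim_{V\to-c_3^+}\phi=-\infty$; $\phi$ is increasing; $\underline\psi(V)\le\phi(V)\le0$ for $V\in]-c_3,0]$ and $0\le\phi(V)\le\overline\psi(V)$ for $V\in[0,c_3]$, where $\underline\psi(V)=\frac{k_1-k_3}2w_M\big(w_m-\frac{k_1-V^2}{k_3-V^2}w_M\big)$ and $\overline\psi(V)=\frac{k_1-k_3}2w_m\big(w_M-\frac{k_3-V^2}{k_1-V^2}w_m\big)$. If $\phi$ jumps at $0$, then at $V=0$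 "$=\phi(0)$" is understood as membership in $[\phi(0-),\phi(0+)]$. Riemann solver $R(u_\ell,u_r)$ (self-similar in $x/t$) for states near $u_L^*$ or $u_R^*$. (i) $u_\ell,u_r$ both in $\mathcal H_i$ ($i=1$ or $3$): with $h=\frac{w_\ell+w_r}2+\frac{v_r-v_\ell}{2c_i}$, the states $u_\ell$, $(v_\ell+c_i(h-w_\ell),h)$, $u_r$ separated by contacts of speeds $-c_i,c_i$ (the paper takes for granted that $(\cdot,h)\in\mathcal H_i$ for the states considered, so that no new phase is created). (ii) $u_\ell\in\mathcal H_1$, $u_r\in\mathcal H_3$: let $h=\frac{c_1w_\ell+c_3w_r+v_r-v_\ell}{c_1+c_3}$. If $h>0$: states $u_\ell,u_-\in\mathcal H_1$, $u_+\in\mathcal H_3$, $u_r$ separated by discontinuities of speeds $-c_1<V<c_3$, $V\in]-c_3,c_3[$, where $w_-=\frac{c_3+V}{c_1+V}h$, $v_-=v_\ell+c_1(w_--w_\ell)$, $w_+=\frac{c_1-V}{c_3-V}h$, $v_+=v_r+c_3(w_r-w_+)$, and $V$ solves $\frac{k_1-k_3}2\{w_Mw_m-w_-w_+\}=\phi(V)$. If $h\le0$: states $u_\ell,u_-\in\mathcal H_1,u_r$ separated by a contact of speed $-c_1$ and a phase boundary of speed $V\in[c_3,c_1[$, determined by the Rankine–Hugoniot relations. Glimm's scheme. Mesh sizes $\tau,h>0$ with $h/\tau$ constant and $\tau c_1<h$; $\{a_n\}_{n\ge1}\subset]-1,1[$ is an equidistributed sequence. $u^h(0,x)=\frac1{2h}\int_{mh}^{(m+2)h}u_0(y)dy$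 for $x\in[mh,(m+2)h[$, $m$ even; $u^h(n\tau+0,x)=u^h(n\tau-0,(m+1+a_n)h-0)$ for $x\in[mh,(m+2)h[$, $m+n$ even; for $n\tau\le t<(n+1)\tau$, $u^h$ is obtained by solving the Riemann problems centered at $x=mh$, $m+n$ even, with the solver $R$. At each time $u^h(t,\cdot)$ has exactly one jump from $\mathcal H_1$ to $\mathcal H_3$; its position $\chi^h(t)$ is the approximate phase boundary ($\chi^h$ is affine on each $[n\tau,(n+1)\tau[$ and may jump at $t=n\tau$). *)

theory Defs
  imports "HOL-Analysis.Analysis" "HOL-Probability.Essential_Supremum"
begin

section \<open>The material\<close>

text \<open>A state is a pair \<open>(v, w)\<close>: velocity first, deformation gradient second.\<close>

type_synonym state = "real \<times> real"

record material =
  k1 :: real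
  k3 :: real
  wM :: real
  wm :: real
  phi :: "real \<Rightarrow> real"

definition c1 :: "material \<Rightarrow> real" where "c1 M = sqrt (k1 M)"
definition c3 :: "material \<Rightarrow> real" where "c3 M = sqrt (k3 M)"

definition trilinear :: "material \<Rightarrow> bool" where
  "trilinear M \<longleftrightarrow> k1 M > k3 M \<and> k3 M > 0 \<and> wm M > wM M \<and> wM M > 0"

text \<open>Only the values for \<open>w > -1\<close> are meaningful.\<close>

definition sigma :: "material \<Rightarrow> real \<Rightarrow> real" where
  "sigma M w =
     (if w \<le> wM M then k1 M * w
      else if w \<ge> wm M then k3 M * w
      else k1 M * wM M + (k3 M * wm M - k1 M * wM M) / (wm M - wM M) * (w - wM M))"

definition H1 :: "material \<Rightarrow> state set" where
  "H1 M = {(v, w). - 1 < w \<and> w \<le> wM M}"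

definition H3 :: "material \<Rightarrow> state set" where
  "H3 M = {(v, w). w \<ge> wm M}"

section \<open>The entropy dissipation function\<close>

text \<open>Derivative relative to \<open>S\<close>; one-sided at an endpoint belonging to \<open>S\<close>.\<close>

definition deriv_in :: "real set \<Rightarrow> (real \<Rightarrow> real) \<Rightarrow> real \<Rightarrow> real" where
  "deriv_in S f x = vector_derivative f (at x within S)"

definition C2_on :: "real set \<Rightarrow> (real \<Rightarrow> real) \<Rightarrow> bool" where
  "C2_on S f \<longleftrightarrow>
     (\<forall>x\<in>S. f differentiable (at x within S)) \<and>
     (\<forall>x\<in>S. deriv_in S f differentiable (at x within S)) \<and>
     continuous_on S (deriv_in S (deriv_in S f))"

definition psi_low :: "material \<Rightarrow> real \<Rightarrow> real" where
  "psi_low M V =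
     (k1 M - k3 M) / 2 * wM M * (wm M - (k1 M - V\<^sup>2) / (k3 M - V\<^sup>2) * wM M)"

definition psi_up :: "material \<Rightarrow> real \<Rightarrow> real" where
  "psi_up M V =
     (k1 M - k3 M) / 2 * wm M * (wM M - (k3 M - V\<^sup>2) / (k1 M - V\<^sup>2) * wm M)"

definition phi_dom :: "material \<Rightarrow> real set" where
  "phi_dom M = {- c3 M<..<0} \<union> {0<..c3 M}"

text \<open>\<open>phi\<close> is only relevant on \<open>]-c3, c3]\<close>. The two-sided bounds below force \<open>phi 0 = 0\<close>, also
  if \<open>phi\<close> jumps at \<open>0\<close>; this is no restriction, since \<open>kinetic\<close> never uses the value \<open>phi 0\<close>.\<close>

definition admissible_phi :: "material \<Rightarrow> bool" where
  "admissible_phi M \<longleftrightarrow>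
     (let c = c3 M; S = phi_dom M; f = phi M;
          f' = deriv_in S f; f'' = deriv_in S f' in
      C2_on S f \<and>
      (\<exists>l. (f \<longlongrightarrow> l) (at_left 0)) \<and> (\<exists>l. (f \<longlongrightarrow> l) (at_right 0)) \<and>
      (\<exists>l. (f' \<longlongrightarrow> l) (at_left 0)) \<and> (\<exists>l. (f' \<longlongrightarrow> l) (at_right 0)) \<and>
      (f \<longlongrightarrow> psi_up M c) (at_left c) \<and>
      (\<forall>\<^sub>F V in at_left c. f'' differentiable (at V)) \<and>
      (\<exists>l. (deriv_in S f'' \<longlongrightarrow> l) (at_left c)) \<and>
      filterlim f at_bot (at_right (- c)) \<and>
      mono_on {- c<..c} f \<and>
      (\<forall>V\<in>{- c<..0}. psi_low M V \<le> f V \<and> f V \<le> 0) \<and>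
      (\<forall>V\<in>{0..c}. 0 \<le> f V \<and> f V \<le> psi_up M V))"

text \<open>The relation \<open>d = phi(V)\<close>, where a jump of \<open>phi\<close> at \<open>0\<close> is filled in. Without a jump, the
  interval at \<open>V = 0\<close> reduces to \<open>{phi 0}\<close>.\<close>

definition kinetic :: "material \<Rightarrow> real \<Rightarrow> real \<Rightarrow> bool" where
  "kinetic M V d \<longleftrightarrow>
     (if V = 0 then Lim (at_left 0) (phi M) \<le> d \<and> d \<le> Lim (at_right 0) (phi M)
      else d = phi M V)"

section \<open>The Riemann solver\<close>

definition rankine_hugoniot :: "material \<Rightarrow> real \<Rightarrow> state \<Rightarrow> state \<Rightarrow> bool" where
  "rankine_hugoniot M V ul ur \<longleftrightarrow>
     - V * (snd ur - snd ul) - (fst ur - fst ul) = 0 \<and>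
     - V * (fst ur - fst ul) - (sigma M (snd ur) - sigma M (snd ul)) = 0"

text \<open>A self-similar piecewise constant function of \<open>\<xi> = x/t\<close> is given by its leftmost state and
  the list of its discontinuities from left to right, each as (speed, state on its right).
  \<open>fan_value\<close> evaluates it, taking the left limit at each discontinuity.\<close>

fun fan_value :: "state \<Rightarrow> (real \<times> state) list \<Rightarrow> real \<Rightarrow> state" where
  "fan_value u [] \<xi> = u"
| "fan_value u ((s, u') # ws) \<xi> = (if \<xi> \<le> s then u else fan_value u' ws \<xi>)"

definition middle_state :: "real \<Rightarrow> state \<Rightarrow> state \<Rightarrow> state" where
  "middle_state c ul ur =
     (let h = (snd ul + snd ur) / 2 + (fst ur - fst ul) / (2 * c)
      in (fst ul + c * (h - snd ul), h))"

definition h_two_phase :: "material \<Rightarrow> state \<Rightarrow> state \<Rightarrow> real" where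
  "h_two_phase M ul ur =
     (c1 M * snd ul + c3 M * snd ur + fst ur - fst ul) / (c1 M + c3 M)"

inductive riemann_fan :: "material \<Rightarrow> state \<Rightarrow> state \<Rightarrow> (real \<times> state) list \<Rightarrow> bool"
  for M where
  phase1: "ul \<in> H1 M \<Longrightarrow> ur \<in> H1 M \<Longrightarrow>
     riemann_fan M ul ur [(- c1 M, middle_state (c1 M) ul ur), (c1 M, ur)]"
| phase3: "ul \<in> H3 M \<Longrightarrow> ur \<in> H3 M \<Longrightarrow>
     riemann_fan M ul ur [(- c3 M, middle_state (c3 M) ul ur), (c3 M, ur)]"
| two_phase_pos:
    "\<lbrakk>(vl, wl) \<in> H1 M; (vr, wr) \<in> H3 M;
      h = h_two_phase M (vl, wl) (vr, wr); h > 0;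
      - c3 M < V; V < c3 M;
      w1 = (c3 M + V) / (c1 M + V) * h; v1 = vl + c1 M * (w1 - wl);
      w3 = (c1 M - V) / (c3 M - V) * h; v3 = vr + c3 M * (wr - w3);
      (v1, w1) \<in> H1 M; (v3, w3) \<in> H3 M;
      kinetic M V ((k1 M - k3 M) / 2 * (wM M * wm M - w1 * w3))\<rbrakk> \<Longrightarrow>
     riemann_fan M (vl, wl) (vr, wr) [(- c1 M, (v1, w1)), (V, (v3, w3)), (c3 M, (vr, wr))]"
| two_phase_nonpos:
    "\<lbrakk>(vl, wl) \<in> H1 M; ur \<in> H3 M;
      h_two_phase M (vl, wl) ur \<le> 0;
      c3 M \<le> V; V < c1 M;
      v1 = vl + c1 M * (w1 - wl); (v1, w1) \<in> H1 M;
      rankine_hugoniot M V (v1, w1) ur\<rbrakk> \<Longrightarrow>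
     riemann_fan M (vl, wl) ur [(- c1 M, (v1, w1)), (V, ur)]"

definition riemann :: "material \<Rightarrow> state \<Rightarrow> state \<Rightarrow> real \<Rightarrow> state" where
  "riemann M ul ur \<xi> = fan_value ul (THE F. riemann_fan M ul ur F) \<xi>"

definition single_phase_boundary :: "material \<Rightarrow> state \<Rightarrow> state \<Rightarrow> real \<Rightarrow> bool" where
  "single_phase_boundary M ul ur V \<longleftrightarrow>
     ul \<in> H1 M \<and> ur \<in> H3 M \<and>
     (\<exists>F. riemann_fan M ul ur F \<and>
       (\<forall>\<xi><V. fan_value ul F \<xi> = ul) \<and> (\<forall>\<xi>>V. fan_value ul F \<xi> = ur))"

section \<open>Glimm's scheme\<close>

definition equidistributed :: "(nat \<Rightarrow> real) \<Rightarrow> bool" where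
  "equidistributed a \<longleftrightarrow>
     (\<forall>n\<ge>1. a n \<in> {- 1<..<1}) \<and>
     (\<forall>\<alpha> \<beta>. - 1 \<le> \<alpha> \<and> \<alpha> \<le> \<beta> \<and> \<beta> \<le> 1 \<longrightarrow>
       (\<lambda>N. real (card {n \<in> {1..N}. a n \<in> {\<alpha><..<\<beta>}}) / real N) \<longlonglongrightarrow> (\<beta> - \<alpha>) / 2)"

text \<open>\<open>glimm_state M \<tau> h a u0 n m\<close>, meaningful for \<open>m + n\<close> even, is the constant value of
  \<open>u\<^sup>h(n\<tau>+0, \<cdot>)\<close> on \<open>[mh, (m+2)h[\<close>. The wave fan centered at \<open>((m+1)h, n\<tau>)\<close> is sampled at
  \<open>((m+1+a\<^sub>n\<^sub>+\<^sub>1)h - 0, (n+1)\<tau> - 0)\<close>, that is, at \<open>\<xi> = a\<^sub>n\<^sub>+\<^sub>1 h/\<tau> - 0\<close>: taking first \<open>t\<close> and then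
  \<open>x\<close> to its limit from below yields the left limit in \<open>\<xi>\<close>, which is the value of \<open>fan_value\<close>.\<close>

primrec glimm_state ::
  "material \<Rightarrow> real \<Rightarrow> real \<Rightarrow> (nat \<Rightarrow> real) \<Rightarrow> (real \<Rightarrow> state) \<Rightarrow> nat \<Rightarrow> int \<Rightarrow> state" where
  "glimm_state M \<tau> h a u0 0 m =
     (1 / (2 * h)) *\<^sub>R (LINT y:{of_int m * h..<of_int (m + 2) * h}|lebesgue. u0 y)"
| "glimm_state M \<tau> h a u0 (Suc n) m =
     riemann M (glimm_state M \<tau> h a u0 n (m - 1)) (glimm_state M \<tau> h a u0 n (m + 1))
       (a (Suc n) * h / \<tau>)"

text \<open>The function \<open>u\<^sup>h(t, x)\<close>. Here \<open>m\<close> is the integer with \<open>m + n\<close> even and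
  \<open>(m-1)h \<le> x < (m+1)h\<close>, so that \<open>x\<close> lies in the wave fan centered at \<open>mh\<close>.\<close>

definition glimm ::
  "material \<Rightarrow> real \<Rightarrow> real \<Rightarrow> (nat \<Rightarrow> real) \<Rightarrow> (real \<Rightarrow> state) \<Rightarrow> real \<Rightarrow> real \<Rightarrow> state" where
  "glimm M \<tau> h a u0 t x =
     (let n = nat \<lfloor>t / \<tau>\<rfloor>;
          m = 2 * \<lfloor>(x / h + 1 - real n) / 2\<rfloor> + int n;
          ul = glimm_state M \<tau> h a u0 n (m - 2);
          ur = glimm_state M \<tau> h a u0 n m;
          s = t - real n * \<tau>
      in if s = 0 then (if x < of_int m * h then ul else ur)
         else riemann M ul ur ((x - of_int m * h) / s))"

definition phase_boundary :: "material \<Rightarrow> (real \<Rightarrow> real \<Rightarrow> state) \<Rightarrow> real \<Rightarrow> real" where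
  "phase_boundary M u t = (THE x. (\<forall>y<x. u t y \<in> H1 M) \<and> (\<forall>y>x. u t y \<in> H3 M))"

text \<open>The right derivative, since \<open>\<chi>\<^sup>h\<close> is affine on each interval \<open>[n\<tau>, (n+1)\<tau>[\<close> and may jump at
  its left endpoint.\<close>

definition right_deriv :: "(real \<Rightarrow> real) \<Rightarrow> real \<Rightarrow> real" where
  "right_deriv f t = vector_derivative f (at_right t)"

text \<open>The Riemann problems between states of the same phase do not create a new phase:
  this is automatic near states interior to the phase, but has to be required if the reference state
  lies on the boundary \<open>w = wM\<close> or \<open>w = wm\<close>.\<close>

definition no_new_phase :: "state set \<Rightarrow> real \<Rightarrow> (nat \<Rightarrow> int \<Rightarrow> state) \<Rightarrow> bool" where
  "no_new_phase H c U \<longleftrightarrow>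
     (\<forall>n m. even (m + int n) \<longrightarrow> U n m \<in> H \<longrightarrow> U n (m + 2) \<in> H \<longrightarrow>
       middle_state c (U n m) (U n (m + 2)) \<in> H)"

section \<open>Function spaces\<close>

definition pointwise_variation :: "real set \<Rightarrow> (real \<Rightarrow> 'a::metric_space) \<Rightarrow> ennreal" where
  "pointwise_variation S f =
     (SUP xs\<in>{xs. sorted xs \<and> set xs \<subseteq> S}.
        \<Sum>i<length xs - 1. ennreal (dist (f (xs ! i)) (f (xs ! Suc i))))"

text \<open>The total variation of an almost everywhere equivalence class.\<close>

definition TV :: "real set \<Rightarrow> (real \<Rightarrow> 'a::metric_space) \<Rightarrow> ennreal" where
  "TV S f = (INF g\<in>{g. AE x in lebesgue. x \<in> S \<longrightarrow> g x = f x}. pointwise_variation S g)"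

definition BV_norm :: "real set \<Rightarrow> (real \<Rightarrow> 'a::real_normed_vector) \<Rightarrow> ennreal" where
  "BV_norm S f = (\<integral>\<^sup>+x\<in>S. ennreal (norm (f x)) \<partial>lebesgue) + TV S f"

definition BV_loc :: "real set \<Rightarrow> state set \<Rightarrow> (real \<Rightarrow> state) set" where
  "BV_loc S H =
     {f. f \<in> borel_measurable (lebesgue_on S) \<and>
         (AE x in lebesgue. x \<in> S \<longrightarrow> f x \<in> H) \<and>
         (\<forall>a b. {a..b} \<subseteq> S \<longrightarrow> BV_norm {a..b} f < \<infinity>)}"

definition Linf_norm :: "real set \<Rightarrow> (real \<Rightarrow> real) \<Rightarrow> ennreal" where
  "Linf_norm S f = esssup (lebesgue_on S) (\<lambda>x. ennreal \<bar>f x\<bar>)"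

definition Linf :: "real set \<Rightarrow> (real \<Rightarrow> real) set" where
  "Linf S = {f. f \<in> borel_measurable (lebesgue_on S) \<and> Linf_norm S f < \<infinity>}"

definition weak_derivative :: "real set \<Rightarrow> (real \<Rightarrow> real) \<Rightarrow> (real \<Rightarrow> real) \<Rightarrow> bool" where
  "weak_derivative S f g \<longleftrightarrow>
     (\<forall>\<theta> \<theta>'. (\<forall>x. (\<theta> has_real_derivative \<theta>' x) (at x)) \<longrightarrow> continuous_on UNIV \<theta>' \<longrightarrow>
        (\<exists>a b. {a..b} \<subseteq> S \<and> (\<forall>x. x \<notin> {a..b} \<longrightarrow> \<theta> x = 0)) \<longrightarrow>
        (LINT x:S|lebesgue. f x * \<theta>' x) = - (LINT x:S|lebesgue. g x * \<theta> x))"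

text \<open>\<open>W\<^sup>1\<^sup>,\<^sup>\<infinity>\<^sub>l\<^sub>o\<^sub>c([0,\<infinity>[)\<close>, whose elements are identified with their continuous representatives on
  \<open>[0,\<infinity>[\<close>.\<close>

definition W1inf_loc :: "(real \<Rightarrow> real) set" where
  "W1inf_loc =
     {f. continuous_on {0..} f \<and>
         (\<forall>T>0. f \<in> Linf {0<..<T} \<and> (\<exists>g\<in>Linf {0<..<T}. weak_derivative {0<..<T} f g))}"

end

theory Submission
  imports Defs "HOL-Probability.Helly_Selection"
begin

text \<open>Inside each phase the system is linear and Glimm's scheme merely shifts the Riemann invariants
  \<open>v - c w\<close> and \<open>v + c w\<close>. The Riemann problem at the phase boundary is governed by
  \<open>H = h_two_phase\<close>, the difference of the two incoming invariants divided by \<open>c1 + c3\<close>. These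
  come from the initial data in monotone order, so \<open>H\<close> has bounded variation in time. For \<open>H > 0\<close>
  the speed of the boundary is a locally Lipschitz function of \<open>H\<close>. For \<open>H \<le> 0\<close> it is
  \<open>(c3 w - c1 H) / (w - H)\<close> and depends on the right state too, but only with a Lipschitz constant
  proportional to \<open>|H|\<close>; this pays for the waves that the boundary emits while \<open>H > 0\<close> and catches up
  again while \<open>H \<le> 0\<close>. Hence the approximate speeds have uniformly bounded variation. Helly's theorem
  gives a limit speed outside a countable set, and equidistribution of the sampling sequence makes the
  approximate boundary follow the integral of its speed.\<close>

section \<open>The Riemann solver at the phase boundary\<close>

text \<open>Estimates do not accumulate over time, because there is no feedback: \<open>H\<close>
  and the wave emitted to the right depend only on the two incoming invariants, which are initial
  values. The delicate point is the passage through \<open>H = 0\<close>, where the two regimes of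
  the solver meet. As \<open>H\<close> decreases to 0 the speed tends to the sonic value
  \<open>c3\<close> and the coefficient of the kinetic relation blows up, so the Lipschitz bound
  available for \<open>H \<ge> e > 0\<close> degenerates. Regularity of \<phi> up to
  \<open>c3\<close> restores it, and the prescribed strain \<open>sqrt (phi'(c3) / c3)\<close> is
  the limit of the strain emitted as \<open>H\<close> decreases to 0; with any other reference value
  the emitted waves would not be small with the perturbation. The waves that return are summed with
  the weight \<open>max 0 (- H)\<close>. It vanishes while waves are emitted, so stored variation is
  charged only when \<open>H\<close> changes. The sampling estimate has to be uniform over all speed
  sequences of a given total variation, since the speeds change with the mesh.\<close>

definition qinv :: "real \<Rightarrow> state \<Rightarrow> real" where "qinv c u = fst u - c * snd u"
definition pinv :: "real \<Rightarrow> state \<Rightarrow> real" where "pinv c u = fst u + c * snd u"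

lemma eventually_at_left_interval:
  fixes a b :: real
  assumes "a < b" "\<And>x. a < x \<Longrightarrow> x < b \<Longrightarrow> P x"
  shows "eventually P (at_left b)"
  using assms eventually_at_left_field by blast

lemma eventually_at_right_interval:
  fixes a b :: real
  assumes "a < b" "\<And>x. a < x \<Longrightarrow> x < b \<Longrightarrow> P x"
  shows "eventually P (at_right a)"
  using assms eventually_at_right_field by blast

section \<open>Elementary properties of the material and of the dissipation function\<close>

locale admissible_material =
  fixes M :: material
  assumes trilinear: "trilinear M" and admissible: "admissible_phi M"
begin

abbreviation "a \<equiv> c1 M"
abbreviation "b \<equiv> c3 M"

lemma speeds: "0 < b" "b < a" "0 < a" "k1 M = a\<^sup>2" "k3 M = b\<^sup>2"
  using trilinear by (auto simp: trilinear_def c1_def c3_def)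

lemma widths: "0 < wM M" "wM M < wm M" "0 < wm M"
  using trilinear by (auto simp: trilinear_def)

lemma H1_H3_disjoint: "u \<in> H1 M \<Longrightarrow> u \<in> H3 M \<Longrightarrow> False"
  using widths by (auto simp: H1_def H3_def)

lemma phi_mono: "- b < x \<Longrightarrow> x \<le> y \<Longrightarrow> y < b \<Longrightarrow> phi M x \<le> phi M y"
  using admissible by (auto simp: admissible_phi_def Let_def mono_on_def)

lemma phi_lower: "- b < V \<Longrightarrow> V \<le> 0 \<Longrightarrow> psi_low M V \<le> phi M V \<and> phi M V \<le> 0"
  and phi_upper: "0 \<le> V \<Longrightarrow> V \<le> b \<Longrightarrow> 0 \<le> phi M V \<and> phi M V \<le> psi_up M V"
  using admissible by (auto simp: admissible_phi_def Let_def)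

lemma phi_Lim_left: "(phi M \<longlongrightarrow> Lim (at_left 0) (phi M)) (at_left 0)"
  and phi_Lim_right: "(phi M \<longlongrightarrow> Lim (at_right 0) (phi M)) (at_right 0)"
  using admissible tendsto_Lim[of "at_left (0::real)" "phi M"] tendsto_Lim[of "at_right (0::real)" "phi M"]
  by (auto simp: admissible_phi_def Let_def)

lemma phi_differentiable: "V \<in> phi_dom M \<Longrightarrow> phi M differentiable (at V within phi_dom M)"
  using admissible by (auto simp: admissible_phi_def Let_def C2_on_def)

lemma phi_isCont:
  assumes "- b < V" "V < b" "V \<noteq> 0"
  shows "isCont (phi M) V"
proof -
  have V: "V \<in> {-b<..<0} \<union> {0<..<b}" using assms by auto
  then have "V \<in> interior (phi_dom M)"
    by (intro interiorI[of "{-b<..<0} \<union> {0<..<b}"]) (auto simp: phi_dom_def)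
  moreover have "V \<in> phi_dom M" using V by (auto simp: phi_dom_def)
  ultimately show ?thesis
    using phi_differentiable[of V] differentiable_imp_continuous_within at_within_interior by metis
qed

text \<open>Differentiability relative to \<open>phi_dom M\<close> makes \<phi> left-continuous at
  \<open>b\<close>, so its value there is the prescribed one-sided limit. The closed form is the
  dissipation belonging to a vanishing product of strains; \<open>rstrain_squared\<close> depends on
  the resulting cancellation.\<close>

lemma phi_at_b: "phi M b = psi_up M b" "psi_up M b = (k1 M - k3 M) / 2 * wm M * wM M"
proof -
  show 2: "psi_up M b = (k1 M - k3 M) / 2 * wm M * wM M"
    unfolding psi_up_def speeds(5) by simp
  have b: "b \<in> phi_dom M" using speeds by (auto simp: phi_dom_def)
  have "continuous (at b within phi_dom M) (phi M)"
    using phi_differentiable[OF b] differentiable_imp_continuous_within by blast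
  then have "(phi M \<longlongrightarrow> phi M b) (at b within phi_dom M)"
    by (simp add: continuous_within)
  then have "(phi M \<longlongrightarrow> phi M b) (at b within {b/2..b})"
    by (rule tendsto_within_subset) (use speeds in \<open>auto simp: phi_dom_def\<close>)
  then have 1: "(phi M \<longlongrightarrow> phi M b) (at_left b)"
    using speeds at_within_Icc_at_left[of "b/2" b] by simp
  have "(phi M \<longlongrightarrow> psi_up M b) (at_left b)"
    using admissible by (auto simp: admissible_phi_def Let_def)
  then show "phi M b = psi_up M b"
    using 1 tendsto_unique trivial_limit_at_left_real by blast
qed

section \<open>The kinetic relation as a scalar equation for the speed\<close>

definition gcoef :: "real \<Rightarrow> real" where
  "gcoef V = ((b + V) * (a - V)) / ((a + V) * (b - V))"

text \<open>The strains on the two sides of the boundary are both multiples of \<open>H\<close>, and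
  their product is \<open>gcoef V * H^2\<close> (see \<open>gcoef_factor\<close>). Away from
  \<open>V = 0\<close> the kinetic relation thus reads
  \<open>phi M V = dissipation H V\<close>.\<close>

definition dissipation :: "real \<Rightarrow> real \<Rightarrow> real" where
  "dissipation H V = (k1 M - k3 M) / 2 * (wM M * wm M - gcoef V * H\<^sup>2)"

lemma gcoef_pos: "- b < V \<Longrightarrow> V < b \<Longrightarrow> 0 < gcoef V"
  using speeds by (auto simp: gcoef_def)

text \<open>The value at \<open>V = 0\<close> of the derivative of \<open>ln (gcoef V)\<close>,
  which is its minimum on \<open>]-b, b[\<close>.\<close>

definition lnrate :: real where "lnrate = 2 * (a - b) / (a * b)"

lemma lnrate_pos: "0 < lnrate"
  using speeds by (auto simp: lnrate_def)

text \<open>Logarithms fit the product \<open>gcoef V * H^2\<close>: a comparison of two such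
  products becomes a bound of a difference of speeds by a difference of \<open>ln H\<close>.\<close>

lemma ln_gcoef_diff:
  assumes "- b < x" "x \<le> y" "y < b"
  shows "lnrate * (y - x) \<le> ln (gcoef y) - ln (gcoef x)"
proof -
  define F where "F V = ln (b + V) + ln (a - V) - ln (a + V) - ln (b - V) - lnrate * V" for V
  have F: "F V = ln (gcoef V) - lnrate * V" if "- b < V" "V < b" for V
    using that speeds unfolding F_def gcoef_def by (subst ln_div) (auto simp: ln_mult)
  have "F x \<le> F y"
  proof (rule DERIV_nonneg_imp_nondecreasing[OF assms(2)])
    fix t assume t: "x \<le> t" "t \<le> y"
    then have pos: "0 < b + t" "0 < a - t" "0 < a + t" "0 < b - t" using assms speeds by auto
    let ?D = "1 / (b + t) - 1 / (a - t) - 1 / (a + t) + 1 / (b - t) - lnrate"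
    have "(F has_real_derivative ?D) (at t)"
      unfolding F_def using pos by (auto intro!: derivative_eq_intros)
    moreover have "0 \<le> ?D"
    proof -
      have A: "1 / (b + t) + 1 / (b - t) = 2 * b / (b\<^sup>2 - t\<^sup>2)"
        using pos by (simp add: field_simps power2_eq_square)
      have B: "1 / (a + t) + 1 / (a - t) = 2 * a / (a\<^sup>2 - t\<^sup>2)"
        using pos by (simp add: field_simps power2_eq_square)
      have p1: "0 < b\<^sup>2 - t\<^sup>2" using mult_pos_pos[OF pos(1) pos(4)] by (simp add: algebra_simps power2_eq_square)
      have p2: "0 < a\<^sup>2 - t\<^sup>2" using mult_pos_pos[OF pos(3) pos(2)] by (simp add: algebra_simps power2_eq_square)
      have "2 * b / (b\<^sup>2 - t\<^sup>2) - 2 * a / (a\<^sup>2 - t\<^sup>2)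
          = 2 * (a - b) * (a * b + t\<^sup>2) / ((b\<^sup>2 - t\<^sup>2) * (a\<^sup>2 - t\<^sup>2))"
        using p1 p2 by (simp add: field_simps power2_eq_square)
      \<comment> \<open>With growing \<open>t^2\<close> the numerator increases and both factors of
        the denominator decrease, so the quotient is smallest at \<open>t = 0\<close>.\<close>
      also have "\<dots> \<ge> 2 * (a - b) * (a * b) / (b\<^sup>2 * a\<^sup>2)"
        using p1 p2 speeds by (intro frac_le mult_mono) auto
      also have "2 * (a - b) * (a * b) / (b\<^sup>2 * a\<^sup>2) = lnrate"
        using speeds by (simp add: lnrate_def field_simps power2_eq_square)
      finally show ?thesis using A B by simp
    qed
    ultimately show "\<exists>D. (F has_real_derivative D) (at t) \<and> 0 \<le> D" by blast
  qed
  then show ?thesis using F[of x] F[of y] assms by (simp add: algebra_simps)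
qed

lemma gcoef_strict_mono:
  assumes "- b < x" "x < y" "y < b"
  shows "gcoef x < gcoef y"
proof -
  have "0 < lnrate * (y - x)" using lnrate_pos assms by simp
  then have "ln (gcoef x) < ln (gcoef y)" using ln_gcoef_diff[of x y] assms by linarith
  then show ?thesis using gcoef_pos assms by simp
qed

lemma half_jump_pos: "0 < (k1 M - k3 M) / 2"
  using trilinear by (auto simp: trilinear_def)

lemma dissipation_strict_antimono:
  assumes "- b < x" "x < y" "y < b" "0 < H"
  shows "dissipation H y < dissipation H x"
proof -
  have "gcoef x * H\<^sup>2 < gcoef y * H\<^sup>2" using gcoef_strict_mono assms by simp
  then show ?thesis unfolding dissipation_def using half_jump_pos by simp
qed

text \<open>One-sided comparison takes the place of the equation \<open>d = phi M V\<close>, so that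
  later arguments need not single out \<open>V = 0\<close>, where \<open>d\<close> is only known to
  lie between two limits.\<close>

lemma kinetic_bounds:
  assumes "kinetic M V d" "- b < V" "V < b"
  shows "\<And>x. - b < x \<Longrightarrow> x < V \<Longrightarrow> phi M x \<le> d" "\<And>x. V < x \<Longrightarrow> x < b \<Longrightarrow> d \<le> phi M x"
proof -
  show "phi M x \<le> d" if "- b < x" "x < V" for x
  proof (cases "V = 0")
    case True
    have "\<forall>\<^sub>F y in at_left 0. phi M x \<le> phi M y"
      by (rule eventually_at_left_interval[of x]) (use that True phi_mono speeds in auto)
    then have "phi M x \<le> Lim (at_left 0) (phi M)"
      using phi_Lim_left tendsto_lowerbound trivial_limit_at_left_real by blast
    then show ?thesis using assms True by (auto simp: kinetic_def)
  qed (use assms that phi_mono in \<open>auto simp: kinetic_def\<close>)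
  show "d \<le> phi M x" if "V < x" "x < b" for x
  proof (cases "V = 0")
    case True
    have "\<forall>\<^sub>F y in at_right 0. phi M y \<le> phi M x"
      by (rule eventually_at_right_interval[of _ x]) (use that True phi_mono speeds in auto)
    then have "Lim (at_right 0) (phi M) \<le> phi M x"
      using phi_Lim_right tendsto_upperbound trivial_limit_at_right_real by blast
    then show ?thesis using assms True by (auto simp: kinetic_def)
  qed (use assms that phi_mono in \<open>auto simp: kinetic_def\<close>)
qed

lemma kinetic_monotone:
  assumes "kinetic M V d" "- b < V" "V < b" "kinetic M V' d'" "V' < b" "V < V'"
  shows "d \<le> d'"
proof -
  obtain x where "V < x" "x < V'" using assms dense by blast
  then show ?thesis
    using kinetic_bounds(2)[OF assms(1-3), of x] kinetic_bounds(1)[OF assms(4), of x] assms by linarith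
qed

text \<open>At \<open>V = 0\<close> the hypotheses bound the value of \<phi>, not the filled-in
  jump. There the bounds for \<open>d\<close> follow from the one-sided limits of \<phi> and the
  continuity of the two bounding functions.\<close>

lemma kinetic_sign:
  assumes "kinetic M V d" "- b < V" "V < b"
  shows "V \<le> 0 \<and> psi_low M V \<le> d \<and> d \<le> 0 \<or> 0 \<le> V \<and> 0 \<le> d \<and> d \<le> psi_up M V"
proof (cases "V = 0")
  case True
  have psis: "isCont (psi_low M) 0" "isCont (psi_up M) 0"
    unfolding psi_low_def psi_up_def using speeds by (auto intro!: continuous_intros)
  have tl: "(psi_low M \<longlongrightarrow> psi_low M 0) (at_left 0)"
    using psis(1) by (simp add: isCont_def filterlim_at_split)
  have tr: "(psi_up M \<longlongrightarrow> psi_up M 0) (at_right 0)"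
    using psis(2) by (simp add: isCont_def filterlim_at_split)
  have "\<forall>\<^sub>F y in at_left 0. psi_low M y \<le> phi M y"
    by (rule eventually_at_left_interval[of "-b"]) (use phi_lower speeds in auto)
  then have 1: "psi_low M 0 \<le> Lim (at_left 0) (phi M)"
    using tendsto_le[OF _ phi_Lim_left tl] by simp
  have "\<forall>\<^sub>F y in at_right 0. phi M y \<le> psi_up M y"
    by (rule eventually_at_right_interval[of _ b]) (use phi_upper speeds in auto)
  then have 2: "Lim (at_right 0) (phi M) \<le> psi_up M 0"
    using tendsto_le[OF _ tr phi_Lim_right] by simp
  show ?thesis using 1 2 assms True by (auto simp: kinetic_def)
next
  case False
  then have "d = phi M V" using assms by (simp add: kinetic_def)
  then show ?thesis using assms phi_lower[of V] phi_upper[of V] by linarith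
qed

lemma gcoef_factor:
  assumes "- b < V" "V < b"
  shows "gcoef V * H\<^sup>2 = ((b + V) / (a + V) * H) * ((a - V) / (b - V) * H)"
    "(a - V) / (b - V) * H = (a\<^sup>2 - V\<^sup>2) / (b\<^sup>2 - V\<^sup>2) * ((b + V) / (a + V) * H)"
    "(b + V) / (a + V) * H = (b\<^sup>2 - V\<^sup>2) / (a\<^sup>2 - V\<^sup>2) * ((a - V) / (b - V) * H)"
proof -
  have p: "b + V \<noteq> 0" "a + V \<noteq> 0" "b - V \<noteq> 0" "a - V \<noteq> 0" using assms speeds by auto
  have s: "b\<^sup>2 - V\<^sup>2 = (b + V) * (b - V)" "a\<^sup>2 - V\<^sup>2 = (a + V) * (a - V)"
    by (auto simp: power2_eq_square algebra_simps)
  show "gcoef V * H\<^sup>2 = ((b + V) / (a + V) * H) * ((a - V) / (b - V) * H)"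
    by (simp add: gcoef_def power2_eq_square)
  show "(a - V) / (b - V) * H = (a\<^sup>2 - V\<^sup>2) / (b\<^sup>2 - V\<^sup>2) * ((b + V) / (a + V) * H)"
    unfolding s using p by (simp add: divide_simps)
  show "(b + V) / (a + V) * H = (b\<^sup>2 - V\<^sup>2) / (a\<^sup>2 - V\<^sup>2) * ((a - V) / (b - V) * H)"
    unfolding s using p by (simp add: divide_simps)
qed

text \<open>The bounds on \<phi> keep both strains in their phases. For \<open>V \<le> 0\<close> the
  lower bound \<open>psi_low\<close> gives \<open>x \<le> wM M\<close>, and nonpositive dissipation
  then forces \<open>y \<ge> wm M\<close>; for \<open>V \<ge> 0\<close> the roles are exchanged,
  with \<open>psi_up\<close> and nonnegative dissipation.\<close>

lemma kinetic_states:
  assumes kin: "kinetic M V (dissipation H V)" and V: "- b < V" "V < b" and H: "0 < H"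
  shows "0 < (b + V) / (a + V) * H" "(b + V) / (a + V) * H \<le> wM M" "wm M \<le> (a - V) / (b - V) * H"
proof -
  define x where "x = (b + V) / (a + V) * H"
  define y where "y = (a - V) / (b - V) * H"
  define K where "K = (k1 M - k3 M) / 2"
  \<comment> \<open>The ratio \<open>y / x\<close> of the strains does not depend on
    \<open>H\<close>; this turns a bound on \<open>x * y\<close> into one on \<open>x^2\<close> or
    \<open>y^2\<close>.\<close>
  define r where "r = (a\<^sup>2 - V\<^sup>2) / (b\<^sup>2 - V\<^sup>2)"
  have K: "0 < K" using half_jump_pos K_def by simp
  have p: "0 < b + V" "0 < a + V" "0 < b - V" "0 < a - V" using V speeds by auto
  have x: "0 < x" and y: "0 < y" unfolding x_def y_def using p H by auto
  have d: "dissipation H V = K * (wM M * wm M - x * y)"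
    unfolding dissipation_def gcoef_factor(1)[OF V] x_def y_def K_def by simp
  have p1: "0 < b\<^sup>2 - V\<^sup>2" using mult_pos_pos[OF p(1) p(3)] by (simp add: algebra_simps power2_eq_square)
  have p2: "0 < a\<^sup>2 - V\<^sup>2" using mult_pos_pos[OF p(2) p(4)] by (simp add: algebra_simps power2_eq_square)
  have r: "0 < r" using p1 p2 by (simp add: r_def)
  have rinv: "(b\<^sup>2 - V\<^sup>2) / (a\<^sup>2 - V\<^sup>2) = 1 / r" by (simp add: r_def)
  have yr: "y = r * x" unfolding x_def y_def r_def by (rule gcoef_factor(2)[OF V])
  have xr: "x = (1 / r) * y" using yr r by simp
  have "x \<le> wM M \<and> wm M \<le> y"
    using kinetic_sign[OF kin V]
  proof
    assume "V \<le> 0 \<and> psi_low M V \<le> dissipation H V \<and> dissipation H V \<le> 0"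
    then have l: "psi_low M V \<le> dissipation H V" and u: "dissipation H V \<le> 0" by auto
    have "psi_low M V = K * (wM M * wm M - r * (wM M)\<^sup>2)"
      unfolding psi_low_def K_def[symmetric] unfolding speeds unfolding r_def[symmetric] by (simp add: power2_eq_square algebra_simps)
    then have "x * y \<le> r * (wM M)\<^sup>2" using l d K by simp
    then have "x\<^sup>2 \<le> (wM M)\<^sup>2" using yr r by (simp add: power2_eq_square mult.left_commute)
    then have xw: "x \<le> wM M" using widths power2_le_imp_le by fastforce
    have "wM M * wm M \<le> x * y" using u d K by (simp add: mult_le_0_iff)
    also have "\<dots> \<le> wM M * y" using xw y by simp
    finally show ?thesis using xw widths by simp
  next
    assume "0 \<le> V \<and> 0 \<le> dissipation H V \<and> dissipation H V \<le> psi_up M V"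
    then have l: "0 \<le> dissipation H V" and u: "dissipation H V \<le> psi_up M V" by auto
    have "psi_up M V = K * (wM M * wm M - (1/r) * (wm M)\<^sup>2)"
      unfolding psi_up_def K_def[symmetric] unfolding speeds unfolding rinv by (simp add: power2_eq_square algebra_simps)
    then have "(1/r) * (wm M)\<^sup>2 \<le> x * y" using u d K by simp
    also have "\<dots> = (1/r) * y\<^sup>2" using xr by (simp add: power2_eq_square)
    finally have "(wm M)\<^sup>2 \<le> y\<^sup>2" using r by (simp add: divide_simps)
    then have yw: "wm M \<le> y" using y power2_le_imp_le by fastforce
    have "x * wm M \<le> x * y" using yw x by simp
    also have "\<dots> \<le> wM M * wm M" using l d K by (simp add: zero_le_mult_iff)
    finally show ?thesis using yw widths by simp
  qed
  then show "(b + V) / (a + V) * H \<le> wM M" "wm M \<le> (a - V) / (b - V) * H" by (auto simp: x_def y_def)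
  show "0 < (b + V) / (a + V) * H" using x x_def by simp
qed

lemma isCont_dissipation: "- b < V \<Longrightarrow> V < b \<Longrightarrow> isCont (dissipation H) V"
  unfolding dissipation_def gcoef_def using speeds by (auto intro!: continuous_intros)

lemma gcoef_at_b: "filterlim gcoef at_top (at_left b)"
proof -
  have *: "filterlim (\<lambda>V. inverse (b - V)) at_top (at_left b)"
    by (intro filterlim_inverse_at_top tendsto_eq_intros)
       (auto intro!: eventually_at_left_interval[of 0] simp: speeds)
  have "filterlim (\<lambda>V. ((b + V) * (a - V) / (a + V)) * inverse (b - V)) at_top (at_left b)"
    by (rule filterlim_tendsto_pos_mult_at_top[OF _ _ *, where c = "(b + b) * (a - b) / (a + b)"])
       (use speeds in \<open>auto intro!: tendsto_eq_intros\<close>)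
  then show ?thesis by (simp add: gcoef_def[abs_def] divide_inverse mult.assoc)
qed

text \<open>Since \<phi> may jump at 0, the intermediate value theorem is replaced by a supremum:
  \<phi> lies below the dissipation near \<open>-b\<close>, where it tends to
  \<open>-\<infinity>\<close>, and above it near \<open>b\<close>, where \<open>gcoef\<close> tends
  to \<open>\<infinity>\<close> while \<phi> is nonnegative.\<close>

lemma kinetic_exists:
  assumes H: "0 < H"
  shows "\<exists>V. - b < V \<and> V < b \<and> kinetic M V (dissipation H V)"
proof -
  define A where "A = {V. - b < V \<and> V < b \<and> phi M V \<le> dissipation H V}"
  have "filterlim (phi M) at_bot (at_right (- b))"
    using admissible by (auto simp: admissible_phi_def Let_def)
  then have "\<forall>\<^sub>F V in at_right (- b). phi M V \<le> dissipation H 0"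
    by (simp add: filterlim_at_bot)
  moreover have "\<forall>\<^sub>F V in at_right (- b). - b < V \<and> V < 0"
    by (rule eventually_at_right_interval[of _ 0]) (use speeds in auto)
  ultimately have "\<forall>\<^sub>F V in at_right (- b). phi M V \<le> dissipation H 0 \<and> - b < V \<and> V < 0"
    by (rule eventually_conj)
  then obtain V1 where V1: "phi M V1 \<le> dissipation H 0" "- b < V1" "V1 < 0"
    using eventually_happens'[of "at_right (- b)"] by auto
  have V1A: "V1 \<in> A"
    using V1 dissipation_strict_antimono[of V1 0 H] H speeds by (auto simp: A_def)
  have "\<forall>\<^sub>F V in at_left b. (wM M * wm M + 1) / H\<^sup>2 \<le> gcoef V"
    using gcoef_at_b by (simp add: filterlim_at_top)
  moreover have "\<forall>\<^sub>F V in at_left b. 0 < V \<and> V < b"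
    by (rule eventually_at_left_interval[of 0]) (use speeds in auto)
  ultimately have "\<forall>\<^sub>F V in at_left b. (wM M * wm M + 1) / H\<^sup>2 \<le> gcoef V \<and> 0 < V \<and> V < b"
    by (rule eventually_conj)
  then obtain V2 where V2: "(wM M * wm M + 1) / H\<^sup>2 \<le> gcoef V2" "0 < V2" "V2 < b"
    using eventually_happens'[of "at_left b"] by auto
  have below: "V < V2" if "V \<in> A" for V
  proof (rule ccontr)
    assume "\<not> V < V2"
    then have V: "V2 \<le> V" "V < b" "phi M V \<le> dissipation H V" using that by (auto simp: A_def)
    have "gcoef V2 \<le> gcoef V" using gcoef_strict_mono[of V2 V] V V2 speeds by (cases "V = V2") auto
    then have "(wM M * wm M + 1) \<le> gcoef V * H\<^sup>2" using V2(1) H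
      by (simp add: pos_divide_le_eq) (smt (verit) mult_right_mono zero_le_power2)
    then have "(wM M * wm M - gcoef V * H\<^sup>2) < 0" by simp
    then have "dissipation H V < 0" unfolding dissipation_def using half_jump_pos mult_pos_neg by blast
    moreover have "0 \<le> phi M V" using phi_upper[of V] V V2 by auto
    ultimately show False using V by simp
  qed
  define V0 where "V0 = Sup A"
  have bdd: "bdd_above A" using below by (meson bdd_aboveI less_imp_le)
  have V0: "V1 \<le> V0" "V0 \<le> V2"
    unfolding V0_def using V1A bdd below cSup_upper[of V1 A] cSup_least[of A V2] by force+
  have V0b: "- b < V0" "V0 < b" using V0 V1 V2 by auto
  have lo: "phi M V \<le> dissipation H V" if V: "- b < V" "V < V0" for V
  proof -
    obtain V' where V': "V' \<in> A" "V < V'" using V(2) V1A less_cSupD[of A V] unfolding V0_def by blast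
    then show ?thesis
      using phi_mono[of V V'] dissipation_strict_antimono[of V V' H] V H by (auto simp: A_def)
  qed
  have hi: "dissipation H V \<le> phi M V" if V: "V0 < V" "V < b" for V
  proof -
    have "V \<notin> A" using cSup_upper[OF _ bdd, of V] V unfolding V0_def[symmetric] by auto
    then show ?thesis using V V0b by (auto simp: A_def)
  qed
  \<comment> \<open>One-sided limits at the supremum squeeze the dissipation between those of
    \<phi>: this is equality where \<phi> is continuous and membership in the filled-in jump at
    0.\<close>
  have dl: "(dissipation H \<longlongrightarrow> dissipation H V0) (at_left V0)"
    and dr: "(dissipation H \<longlongrightarrow> dissipation H V0) (at_right V0)"
    using isCont_dissipation[OF V0b, of H] by (auto simp: isCont_def filterlim_at_split)
  have el: "\<forall>\<^sub>F V in at_left V0. phi M V \<le> dissipation H V"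
    by (rule eventually_at_left_interval[OF V0b(1)]) (use lo in auto)
  have er: "\<forall>\<^sub>F V in at_right V0. dissipation H V \<le> phi M V"
    by (rule eventually_at_right_interval[OF V0b(2)]) (use hi in auto)
  have "kinetic M V0 (dissipation H V0)"
  proof (cases "V0 = 0")
    case True
    then show ?thesis
      using tendsto_le[OF _ dl[unfolded True] phi_Lim_left] tendsto_le[OF _ phi_Lim_right dr[unfolded True]] el er
      by (auto simp: kinetic_def)
  next
    case False
    then have pl: "(phi M \<longlongrightarrow> phi M V0) (at_left V0)" and pr: "(phi M \<longlongrightarrow> phi M V0) (at_right V0)"
      using phi_isCont[OF V0b] by (auto simp: isCont_def filterlim_at_split)
    have "phi M V0 \<le> dissipation H V0" using tendsto_le[OF _ dl pl el] by simp
    moreover have "dissipation H V0 \<le> phi M V0" using tendsto_le[OF _ pr dr er] by simp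
    ultimately show ?thesis using False by (simp add: kinetic_def)
  qed
  then show ?thesis using V0b by blast
qed

lemma kinetic_unique:
  assumes "0 < H" "- b < V" "V < b" "kinetic M V (dissipation H V)"
    "- b < V'" "V' < b" "kinetic M V' (dissipation H V')"
  shows "V = V'"
proof (rule ccontr)
  assume "V \<noteq> V'"
  then consider "V < V'" | "V' < V" by linarith
  then show False
    by cases (use assms kinetic_monotone dissipation_strict_antimono in \<open>smt (verit)\<close>)+
qed

section \<open>Speed and strains at the boundary as functions of \<open>H\<close>\<close>

definition Vpos :: "real \<Rightarrow> real" where
  "Vpos H = (THE V. - b < V \<and> V < b \<and> kinetic M V (dissipation H V))"

lemma Vpos:
  assumes "0 < H"
  shows "- b < Vpos H" "Vpos H < b" "kinetic M (Vpos H) (dissipation H (Vpos H))"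
proof -
  have "\<exists>!V. - b < V \<and> V < b \<and> kinetic M V (dissipation H V)"
    using kinetic_exists[OF assms] kinetic_unique[OF assms] by blast
  from theI'[OF this] show "- b < Vpos H" "Vpos H < b" "kinetic M (Vpos H) (dissipation H (Vpos H))"
    by (auto simp: Vpos_def)
qed

lemma Vpos_eqI:
  assumes "0 < H" "- b < V" "V < b" "kinetic M V (dissipation H V)"
  shows "V = Vpos H"
  using kinetic_unique[OF assms Vpos[OF assms(1)]] .

text \<open>As \<phi> increases, a faster boundary has at least the dissipation of a slower one,
  hence at most its product \<open>gcoef V * H^2\<close>. Since \<open>gcoef\<close> increases too,
  \<open>H\<close> must drop, and the logarithm measures by how much.\<close>

lemma Vpos_ln:
  assumes "0 < H" "0 < H'" "Vpos H < Vpos H'"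
  shows "H' < H" "lnrate * (Vpos H' - Vpos H) \<le> 2 * (ln H - ln H')"
proof -
  have "dissipation H (Vpos H) \<le> dissipation H' (Vpos H')"
    using kinetic_monotone Vpos assms by blast
  then have le: "gcoef (Vpos H') * H'\<^sup>2 \<le> gcoef (Vpos H) * H\<^sup>2"
    unfolding dissipation_def using half_jump_pos by simp
  have g: "0 < gcoef (Vpos H)" "0 < gcoef (Vpos H')" using gcoef_pos Vpos assms by auto
  have "ln (gcoef (Vpos H') * H'\<^sup>2) \<le> ln (gcoef (Vpos H) * H\<^sup>2)"
    using le g assms by simp
  then have "ln (gcoef (Vpos H')) + 2 * ln H' \<le> ln (gcoef (Vpos H)) + 2 * ln H"
    using g assms by (simp add: ln_mult ln_realpow)
  then show A: "lnrate * (Vpos H' - Vpos H) \<le> 2 * (ln H - ln H')"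
    using ln_gcoef_diff[of "Vpos H" "Vpos H'"] Vpos assms by (simp add: algebra_simps)
  have "0 < lnrate * (Vpos H' - Vpos H)" using lnrate_pos assms by simp
  then have "0 < 2 * (ln H - ln H')" using A by (rule less_le_trans)
  then have "ln H' < ln H" by simp
  then show "H' < H" using assms by simp
qed

text \<open>The first branch solves the kinetic relation, the second the Rankine-Hugoniot relations
  with a right state of strain \<open>w\<close>. For \<open>w > 0\<close> the second branch takes
  the sonic value \<open>b\<close> at \<open>H = 0\<close>.\<close>

definition bspeed :: "real \<Rightarrow> real \<Rightarrow> real" where
  "bspeed H w = (if 0 < H then Vpos H else (b * w - a * H) / (w - H))"

text \<open>One formula serves both regimes; for \<open>H \<le> 0\<close> it is the solution found
  in \<open>rankine_hugoniot_iff\<close>.\<close>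

definition lstrain :: "real \<Rightarrow> real \<Rightarrow> real" where
  "lstrain H w = (b + bspeed H w) / (a + bspeed H w) * H"

definition rstrain :: "real \<Rightarrow> real" where
  "rstrain H = (a - Vpos H) / (b - Vpos H) * H"

lemma bspeed_pos: "0 < H \<Longrightarrow> - b < bspeed H w \<and> bspeed H w < b"
  using Vpos by (simp add: bspeed_def)

lemma bspeed_nonpos:
  assumes "H \<le> 0" "0 < w"
  shows "bspeed H w = b + (a - b) * (- H) / (w - H)" "b \<le> bspeed H w" "bspeed H w < a"
proof -
  have p: "0 < w - H" using assms by simp
  show 1: "bspeed H w = b + (a - b) * (- H) / (w - H)"
    using assms p by (simp add: bspeed_def field_simps)
  have "0 \<le> (a - b) * (- H) / (w - H)"
    using assms p speeds by (intro divide_nonneg_nonneg mult_nonneg_nonneg) auto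
  then show "b \<le> bspeed H w" unfolding 1 by simp
  have "(a - b) * (- H) < (a - b) * (w - H)"
    using assms speeds by (intro mult_strict_left_mono) auto
  then have "(a - b) * (- H) / (w - H) < a - b" by (simp only: pos_divide_less_eq[OF p])
  then show "bspeed H w < a" unfolding 1 by simp
qed

lemma bspeed_bounds: "0 < w \<Longrightarrow> - b < bspeed H w \<and> bspeed H w < a"
  using bspeed_pos[of H w] bspeed_nonpos[of H w] speeds by (cases "0 < H") auto

lemma rstrain_pos: "0 < H \<Longrightarrow> wm M \<le> rstrain H"
  using kinetic_states Vpos by (simp add: rstrain_def)

lemma lstrain_pos: "0 < H \<Longrightarrow> 0 < lstrain H w \<and> lstrain H w \<le> wM M"
  using kinetic_states Vpos by (simp add: lstrain_def bspeed_def)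

lemma lstrain_le:
  assumes "0 < w"
  shows "lstrain H w \<le> wM M"
proof (cases "0 < H")
  case False
  have "0 < (b + bspeed H w) / (a + bspeed H w)" using bspeed_bounds[OF assms, of H] speeds by auto
  then have "lstrain H w \<le> 0" unfolding lstrain_def using False by (intro mult_nonneg_nonpos) auto
  then show ?thesis using widths by simp
qed (use lstrain_pos in auto)

section \<open>Closed formulas for the wave fans\<close>

lemma h_two_phase_eq: "(a + b) * h_two_phase M ul ur = pinv b ur - qinv a ul"
  using speeds by (simp add: h_two_phase_def pinv_def qinv_def)

lemma rankine_hugoniot_iff:
  assumes "(v1, w1) \<in> H1 M" "(vr, wr) \<in> H3 M" "b \<le> V" "H \<le> 0"
    and pq: "(vr + b * wr) - (v1 - a * w1) = (a + b) * H"
  shows "rankine_hugoniot M V (v1, w1) (vr, wr) \<longleftrightarrow> V = bspeed H wr \<and> w1 = lstrain H wr"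
proof -
  have wr: "0 < wr" "wr - H > 0" using assms widths by (auto simp: H3_def)
  have s: "sigma M w1 = a\<^sup>2 * w1" "sigma M wr = b\<^sup>2 * wr"
    using assms(1,2) widths speeds by (auto simp: sigma_def H1_def H3_def)
  \<comment> \<open>In the unknowns \<open>A\<close> and \<open>B\<close> the two relations are
    linear, \<open>A + B = (a + b) * H\<close> and \<open>(a - V) * A = (b + V) * B\<close>. Their
    solution separates into an equation for \<open>V\<close> alone and one that then yields
    \<open>w1\<close>.\<close>
  define A where "A = (a + V) * w1"
  define B where "B = (b - V) * wr"
  have aV: "a + V > 0" using assms speeds by simp
  have e1: "- V * (wr - w1) - (vr - v1) = A + B - (a + b) * H"
    using pq by (simp add: A_def B_def algebra_simps)
  have e2: "rankine_hugoniot M V (v1, w1) (vr, wr) \<longleftrightarrow>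
     A + B = (a + b) * H \<and> (a - V) * A = (b + V) * B"
  proof -
    have "- V * (vr - v1) - (sigma M wr - sigma M w1)
       = V * (- V * (wr - w1) - (vr - v1)) + ((a - V) * A - (b + V) * B)"
      unfolding s A_def B_def by (simp add: algebra_simps power2_eq_square)
    then show ?thesis unfolding rankine_hugoniot_def fst_conv snd_conv e1 by auto
  qed
  also have "\<dots> \<longleftrightarrow> A = (b + V) * H \<and> B = (a - V) * H"
  proof
    assume h: "A + B = (a + b) * H \<and> (a - V) * A = (b + V) * B"
    have "(a + b) * A = (a - V) * A + (b + V) * A" by (simp add: algebra_simps)
    also have "\<dots> = (b + V) * (A + B)" unfolding conjunct2[OF h] by (simp add: algebra_simps)
    also have "\<dots> = (a + b) * ((b + V) * H)" using h by simp
    finally have "A = (b + V) * H" using speeds by simp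
    then show "A = (b + V) * H \<and> B = (a - V) * H" using h by (simp add: algebra_simps)
  next
    assume "A = (b + V) * H \<and> B = (a - V) * H"
    then have "A = (b + V) * H" "B = (a - V) * H" by auto
    then show "A + B = (a + b) * H \<and> (a - V) * A = (b + V) * B"
      by (simp only:) (simp add: algebra_simps)
  qed
  also have "B = (a - V) * H \<longleftrightarrow> V = bspeed H wr"
    using wr assms(4) by (simp add: bspeed_def B_def eq_divide_eq) (auto simp: algebra_simps)
  also have "A = (b + V) * H \<and> V = bspeed H wr \<longleftrightarrow> V = bspeed H wr \<and> w1 = lstrain H wr"
    using aV by (auto simp: A_def lstrain_def eq_divide_eq mult.commute)
  finally show ?thesis .
qed

definition two_phase_fan :: "state \<Rightarrow> state \<Rightarrow> (real \<times> state) list" where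
  "two_phase_fan ul ur =
    (let H = h_two_phase M ul ur; V = bspeed H (snd ur); w1 = lstrain H (snd ur);
         u1 = (fst ul + a * (w1 - snd ul), w1); u3 = (fst ur + b * (snd ur - rstrain H), rstrain H)
     in if 0 < H then [(- a, u1), (V, u3), (b, ur)] else [(- a, u1), (V, ur)])"

text \<open>Together with the converse below, this identifies the fan chosen by \<open>THE\<close>
  in \<open>riemann\<close>. The bound on \<open>lstrain\<close> is what membership of the left
  trace in \<open>H1 M\<close> still requires, the upper bound being supplied by
  \<open>lstrain_le\<close>.\<close>

lemma riemann_fan_two_phaseD:
  assumes "riemann_fan M ul ur F" "ul \<in> H1 M" "ur \<in> H3 M"
  shows "F = two_phase_fan ul ur \<and> - 1 < lstrain (h_two_phase M ul ur) (snd ur)"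
  using assms(1)
proof cases
  case phase1
  then show ?thesis using H1_H3_disjoint assms by blast
next
  case phase3
  then show ?thesis using H1_H3_disjoint assms by blast
next
  case (two_phase_pos vl wl vr wr h V w1 v1 w3 v3)
  have V: "V = Vpos h"
    using two_phase_pos gcoef_factor(1)[of V h] by (intro Vpos_eqI) (auto simp: dissipation_def)
  show ?thesis
    using two_phase_pos V lstrain_pos[of h wr] by (simp add: two_phase_fan_def Let_def bspeed_def lstrain_def rstrain_def)
next
  case (two_phase_nonpos vl wl V v1 w1)
  obtain vr wr where ur: "ur = (vr, wr)" by (cases ur)
  define H where "H = h_two_phase M (vl, wl) ur"
  have "(vr + b * wr) - (v1 - a * w1) = (a + b) * H"
    unfolding H_def h_two_phase_eq using two_phase_nonpos ur by (simp add: pinv_def qinv_def algebra_simps)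
  then have "V = bspeed H wr \<and> w1 = lstrain H wr"
    using rankine_hugoniot_iff[of v1 w1 vr wr V H] two_phase_nonpos ur H_def by auto
  then show ?thesis
    using two_phase_nonpos ur H_def by (auto simp: two_phase_fan_def Let_def H1_def)
qed

lemma riemann_fan_two_phaseI:
  assumes "ul \<in> H1 M" "ur \<in> H3 M" "- 1 < lstrain (h_two_phase M ul ur) (snd ur)"
  shows "riemann_fan M ul ur (two_phase_fan ul ur)"
proof -
  obtain vr wr where ur: "ur = (vr, wr)" by (cases ur)
  obtain vl wl where ul: "ul = (vl, wl)" by (cases ul)
  define H where "H = h_two_phase M ul ur"
  have Hp: "h_two_phase M (vl, wl) (vr, wr) = H" by (simp add: H_def ul ur)
  have wr: "0 < wr" using assms ur widths by (auto simp: H3_def)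
  define w1 where "w1 = lstrain H wr"
  define v1 where "v1 = vl + a * (w1 - wl)"
  define V where "V = bspeed H wr"
  have 1: "(v1, w1) \<in> H1 M" using assms lstrain_le[OF wr, of H] ur by (auto simp: H1_def w1_def H_def)
  show ?thesis
  proof (cases "0 < H")
    case True
    have V: "- b < V" "V < b" "V = Vpos H" using bspeed_pos[OF True] True by (auto simp: V_def bspeed_def)
    have "riemann_fan M (vl, wl) (vr, wr)
      [(- a, (v1, w1)), (V, (vr + b * (wr - rstrain H), rstrain H)), (b, (vr, wr))]"
    proof (rule two_phase_pos)
      show "(vr + b * (wr - rstrain H), rstrain H) \<in> H3 M" using rstrain_pos[OF True] by (auto simp: H3_def)
      have "w1 * rstrain H = gcoef V * H\<^sup>2"
        using gcoef_factor(1)[of V H] V by (simp add: w1_def rstrain_def lstrain_def V_def)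
      then show "kinetic M V ((k1 M - k3 M) / 2 * (wM M * wm M - w1 * rstrain H))"
        using Vpos[OF True] V by (simp add: dissipation_def)
    qed (use assms ul ur 1 True V H_def in \<open>auto simp: v1_def w1_def rstrain_def lstrain_def V_def\<close>)
    then show ?thesis using True ul ur
      by (simp add: two_phase_fan_def Let_def Hp v1_def w1_def V_def)
  next
    case False
    have "(vr + b * wr) - (v1 - a * w1) = (a + b) * H"
      unfolding H_def h_two_phase_eq using ul ur by (simp add: pinv_def qinv_def v1_def algebra_simps)
    then have "rankine_hugoniot M V (v1, w1) (vr, wr)"
      using rankine_hugoniot_iff[of v1 w1 vr wr V H] 1 assms(2) bspeed_nonpos[of H wr] wr False ur
      by (auto simp: V_def w1_def)
    then have "riemann_fan M (vl, wl) ur [(- a, (v1, w1)), (V, ur)]"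
      using assms ul ur 1 False bspeed_nonpos[of H wr] wr H_def
      by (intro two_phase_nonpos[OF _ _ _ _ _ v1_def]) (auto simp: V_def)
    then show ?thesis using False ul ur
      by (simp add: two_phase_fan_def Let_def Hp v1_def w1_def V_def)
  qed
qed

lemma riemann_two_phase:
  fixes ul ur
  defines "H \<equiv> h_two_phase M ul ur"
  assumes "ul \<in> H1 M" "ur \<in> H3 M" "- 1 < lstrain H (snd ur)"
  shows "riemann M ul ur \<xi> =
    (if \<xi> \<le> - a then ul
     else if \<xi> \<le> bspeed H (snd ur) then (fst ul + a * (lstrain H (snd ur) - snd ul), lstrain H (snd ur))
     else if 0 < H \<and> \<xi> \<le> b then (fst ur + b * (snd ur - rstrain H), rstrain H) else ur)"
proof -
  have "(THE F. riemann_fan M ul ur F) = two_phase_fan ul ur"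
    using riemann_fan_two_phaseD riemann_fan_two_phaseI assms by (intro the_equality) auto
  then show ?thesis by (simp add: riemann_def two_phase_fan_def Let_def H_def)
qed

lemma riemann_phase1:
  assumes "ul \<in> H1 M" "ur \<in> H1 M"
  shows "riemann M ul ur \<xi> = (if \<xi> \<le> - a then ul else if \<xi> \<le> a then middle_state a ul ur else ur)"
proof -
  have "(THE F. riemann_fan M ul ur F) = [(- a, middle_state a ul ur), (a, ur)]"
  proof (rule the_equality)
    show "riemann_fan M ul ur [(- a, middle_state a ul ur), (a, ur)]" using assms by (rule phase1)
    fix F assume "riemann_fan M ul ur F"
    then show "F = [(- a, middle_state a ul ur), (a, ur)]"
      by cases (use assms H1_H3_disjoint in blast)+
  qed
  then show ?thesis by (simp add: riemann_def)
qed

lemma riemann_phase3: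
  assumes "ul \<in> H3 M" "ur \<in> H3 M"
  shows "riemann M ul ur \<xi> = (if \<xi> \<le> - b then ul else if \<xi> \<le> b then middle_state b ul ur else ur)"
proof -
  have "(THE F. riemann_fan M ul ur F) = [(- b, middle_state b ul ur), (b, ur)]"
  proof (rule the_equality)
    show "riemann_fan M ul ur [(- b, middle_state b ul ur), (b, ur)]" using assms by (rule phase3)
    fix F assume "riemann_fan M ul ur F"
    then show "F = [(- b, middle_state b ul ur), (b, ur)]"
      by cases (use assms H1_H3_disjoint in blast)+
  qed
  then show ?thesis by (simp add: riemann_def)
qed

text \<open>\<open>qinv\<close> travels to the right and is inherited from the left state,
  \<open>pinv\<close> travels to the left and is inherited from the right state. Every later shift
  of a sequence of invariants rests on this.\<close>

lemma middle_state_invariants: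
  assumes "0 < c"
  shows "qinv c (middle_state c ul ur) = qinv c ul" "pinv c (middle_state c ul ur) = pinv c ur"
  using assms by (auto simp: middle_state_def Let_def qinv_def pinv_def field_simps)

text \<open>Values of the fan reveal the phase: at a point strictly between \<open>Vs\<close> and
  the speed \<open>V\<close> of the boundary, one value would have to lie in both phases. Once the
  speeds agree, samples next to the boundary show that no contact is present.\<close>

lemma single_phase_boundaryD:
  assumes "single_phase_boundary M ul ur Vs"
  defines "H \<equiv> h_two_phase M ul ur"
  shows "ul \<in> H1 M" "ur \<in> H3 M" "Vs = bspeed H (snd ur)" "lstrain H (snd ur) = snd ul"
    "0 < H \<Longrightarrow> rstrain H = snd ur"
proof -
  show u: "ul \<in> H1 M" "ur \<in> H3 M" using assms by (auto simp: single_phase_boundary_def)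
  obtain F where F: "riemann_fan M ul ur F" "\<And>\<xi>. \<xi> < Vs \<Longrightarrow> fan_value ul F \<xi> = ul"
      "\<And>\<xi>. \<xi> > Vs \<Longrightarrow> fan_value ul F \<xi> = ur"
    using assms by (auto simp: single_phase_boundary_def)
  define V where "V = bspeed H (snd ur)"
  have w: "0 < snd ur" using u widths by (auto simp: H3_def)
  have 1: "F = two_phase_fan ul ur" "- 1 < lstrain H (snd ur)"
    using riemann_fan_two_phaseD[OF F(1) u] by (auto simp: H_def)
  have val: "fan_value ul F \<xi> = (if \<xi> \<le> - a then ul
     else if \<xi> \<le> V then (fst ul + a * (lstrain H (snd ur) - snd ul), lstrain H (snd ur))
     else if 0 < H \<and> \<xi> \<le> b then (fst ur + b * (snd ur - rstrain H), rstrain H) else ur)" for \<xi>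
    unfolding 1 by (simp add: two_phase_fan_def Let_def H_def V_def)
  have V: "- b < V" "V < a" using bspeed_bounds[OF w] by (auto simp: V_def)
  have in1: "(x, lstrain H (snd ur)) \<in> H1 M" for x using 1 lstrain_le[OF w, of H] by (auto simp: H1_def)
  have in3: "0 < H \<Longrightarrow> (x, rstrain H) \<in> H3 M" for x using rstrain_pos[of H] by (auto simp: H3_def)
  have "\<not> Vs < V"
  proof
    assume "Vs < V"
    then obtain \<xi> where "Vs < \<xi>" "\<xi> < V" using dense by blast
    then have "ur = ul \<or> ur = (fst ul + a * (lstrain H (snd ur) - snd ul), lstrain H (snd ur))"
      using F(3)[of \<xi>] val[of \<xi>] by (auto split: if_splits)
    then have "ur \<in> H1 M" using in1 u by metis
    then show False using u H1_H3_disjoint by blast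
  qed
  moreover have "\<not> V < Vs"
  proof
    assume "V < Vs"
    then obtain \<xi> where "V < \<xi>" "\<xi> < Vs" using dense by blast
    then have "ul \<in> H3 M" using F(2)[of \<xi>] val[of \<xi>] in3 u V speeds by (auto split: if_splits)
    then show False using u H1_H3_disjoint by blast
  qed
  ultimately have VV: "Vs = V" by simp
  then show "Vs = bspeed H (snd ur)" by (simp add: V_def)
  obtain \<xi> where "- a < \<xi>" "\<xi> < V" using dense[of "- a" V] V speeds by auto
  then have "ul = (fst ul + a * (lstrain H (snd ur) - snd ul), lstrain H (snd ur))"
    using F(2)[of \<xi>] val[of \<xi>] VV by auto
  then show "lstrain H (snd ur) = snd ul" by (metis snd_conv)
  assume H: "0 < H"
  then have "V < b" using bspeed_pos by (simp add: V_def)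
  then obtain \<xi> where "V < \<xi>" "\<xi> < b" using dense by blast
  then have "ur = (fst ur + b * (snd ur - rstrain H), rstrain H)"
    using F(3)[of \<xi>] val[of \<xi>] VV V H speeds by auto
  then show "rstrain H = snd ur" by (metis snd_conv)
qed

section \<open>Lipschitz dependence of speed and strain on \<open>H\<close>\<close>

lemma bspeed_lipschitz_nonpos:
  assumes "H \<le> 0" "H' \<le> 0" "wm M \<le> w" "wm M \<le> w'"
  shows "\<bar>bspeed H w - bspeed H' w'\<bar> \<le> (a - b) / wm M * \<bar>H - H'\<bar> + (a - b) / (wm M)\<^sup>2 * (- H * \<bar>w - w'\<bar>)"
proof -
  have w: "0 < w" "0 < w'" "0 < wm M" using assms widths by auto
  define x x' where "x = - H" and "x' = - H'"
  have x: "0 \<le> x" "0 \<le> x'" using assms by (auto simp: x_def x'_def)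
  define N where "N = (w + x) * (w' + x')"
  have N: "0 < N" unfolding N_def using w x by (intro mult_pos_pos) auto
  have e1: "bspeed H w = b + (a - b) * (x / (w + x))" "bspeed H' w' = b + (a - b) * (x' / (w' + x'))"
    using bspeed_nonpos(1)[of H w] bspeed_nonpos(1)[of H' w'] assms w by (simp_all add: x_def x'_def)
  have "bspeed H w - bspeed H' w' = (a - b) * (x / (w + x) - x' / (w' + x'))"
    unfolding e1 right_diff_distrib by simp
  \<comment> \<open>The change of \<open>w\<close> enters multiplied by \<open>x = - H\<close>; this
    factor is the weight that later controls the absorbed waves.\<close>
  also have "x / (w + x) - x' / (w' + x') = (x * (w' - w) + w * (x - x')) / N"
    using w x by (simp add: N_def diff_frac_eq algebra_simps)
  finally have eq: "bspeed H w - bspeed H' w' = (a - b) * ((x * (w' - w) + w * (x - x')) / N)" .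
  have "\<bar>(x * (w' - w) + w * (x - x')) / N\<bar> \<le> (x * \<bar>w - w'\<bar>) / N + (w * \<bar>x - x'\<bar>) / N"
  proof -
    have "\<bar>x * (w' - w) + w * (x - x')\<bar> \<le> \<bar>x * (w' - w)\<bar> + \<bar>w * (x - x')\<bar>" by (rule abs_triangle_ineq)
    also have "\<dots> = x * \<bar>w - w'\<bar> + w * \<bar>x - x'\<bar>" using x w by (simp add: abs_mult abs_minus_commute)
    finally show ?thesis using N by (simp add: abs_divide add_divide_distrib[symmetric] divide_right_mono)
  qed
  also have "(x * \<bar>w - w'\<bar>) / N \<le> (x * \<bar>w - w'\<bar>) / (wm M)\<^sup>2"
  proof -
    have "wm M * wm M \<le> N" unfolding N_def using assms w x by (intro mult_mono) auto
    then show ?thesis using w x N by (intro divide_left_mono) (auto simp: power2_eq_square)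
  qed
  also have "(w * \<bar>x - x'\<bar>) / N \<le> \<bar>x - x'\<bar> / wm M"
  proof -
    have "w * wm M \<le> N" unfolding N_def using assms w x by (intro mult_mono) auto
    then have "\<bar>x - x'\<bar> * (w * wm M) \<le> \<bar>x - x'\<bar> * N" by (intro mult_left_mono) auto
    then show ?thesis using N w by (simp add: divide_simps algebra_simps)
  qed
  finally have "\<bar>(x * (w' - w) + w * (x - x')) / N\<bar>
      \<le> (x * \<bar>w - w'\<bar>) / (wm M)\<^sup>2 + \<bar>x - x'\<bar> / wm M" by simp
  then have "(a - b) * \<bar>(x * (w' - w) + w * (x - x')) / N\<bar>
      \<le> (a - b) * ((x * \<bar>w - w'\<bar>) / (wm M)\<^sup>2 + \<bar>x - x'\<bar> / wm M)"
    using speeds by (intro mult_left_mono) auto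
  moreover have "\<bar>bspeed H w - bspeed H' w'\<bar> = (a - b) * \<bar>(x * (w' - w) + w * (x - x')) / N\<bar>"
    unfolding eq abs_mult using speeds by simp
  moreover have "\<bar>x - x'\<bar> = \<bar>H - H'\<bar>" by (simp add: x_def x'_def)
  ultimately have "\<bar>bspeed H w - bspeed H' w'\<bar> \<le> (a - b) * (x * \<bar>w - w'\<bar> / (wm M)\<^sup>2 + \<bar>H - H'\<bar> / wm M)"
    by (simp only:)
  also have "\<dots> = (a - b) / wm M * \<bar>H - H'\<bar> + (a - b) / (wm M)\<^sup>2 * (- H * \<bar>w - w'\<bar>)"
    by (simp add: x_def right_diff_distrib distrib_left)
  finally show ?thesis .
qed

lemma Vpos_antimono: "0 < H' \<Longrightarrow> H' \<le> H \<Longrightarrow> Vpos H \<le> Vpos H'"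
  using Vpos_ln(1)[of H' H] by force

text \<open>On \<open>[e, \<infinity>[\<close> the logarithm is Lipschitz with constant
  \<open>1 / e\<close>, so \<open>Vpos_ln\<close> applies. The constant blows up as \<open>e\<close>
  tends to 0, which is why the sonic case needs its own argument.\<close>

lemma Vpos_lipschitz:
  assumes "0 < e" "e \<le> H" "e \<le> H'"
  shows "\<bar>Vpos H - Vpos H'\<bar> \<le> 2 / (lnrate * e) * \<bar>H - H'\<bar>"
proof -
  have main: "\<bar>Vpos x - Vpos y\<bar> \<le> 2 / (lnrate * e) * \<bar>x - y\<bar>" if "Vpos x < Vpos y" "e \<le> x" "e \<le> y" for x y
  proof -
    have p: "0 < x" "0 < y" using that assms by auto
    have yx: "y < x" and le: "lnrate * (Vpos y - Vpos x) \<le> 2 * (ln x - ln y)"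
      using Vpos_ln[OF p that(1)] by auto
    have "ln x - ln y \<le> (x - y) / y" using ln_diff_le p by blast
    also have "\<dots> \<le> (x - y) / e" using yx that assms by (intro divide_left_mono) auto
    finally have "2 * (ln x - ln y) \<le> 2 * ((x - y) / e)" by (rule mult_left_mono) simp
    with le have "lnrate * (Vpos y - Vpos x) \<le> 2 * ((x - y) / e)" by (rule order_trans)
    then have "Vpos y - Vpos x \<le> 2 * ((x - y) / e) / lnrate"
      unfolding pos_le_divide_eq[OF lnrate_pos] by (metis mult.commute)
    also have "\<dots> = 2 / (lnrate * e) * \<bar>x - y\<bar>" using yx by simp
    finally show ?thesis using that by simp
  qed
  consider "Vpos H < Vpos H'" | "Vpos H' < Vpos H" | "Vpos H = Vpos H'" by linarith
  then show ?thesis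
  proof cases
    case 1 then show ?thesis using main assms by blast
  next
    case 2 then show ?thesis using main[of H' H] assms by (simp add: abs_minus_commute)
  next
    case 3 then show ?thesis using lnrate_pos assms by simp
  qed
qed

text \<open>Writing \<open>rstrain H = H + (a - b) * (H / (b - Vpos H))\<close> isolates the only
  critical denominator, which is at least \<open>b - Vpos e\<close> because the speed decreases in
  \<open>H\<close>.\<close>

lemma rstrain_lipschitz:
  assumes "0 < e" "e \<le> H" "e \<le> H'" "H' \<le> B"
  shows "\<bar>rstrain H - rstrain H'\<bar> \<le> (1 + (a - b) * (1 / (b - Vpos e) + B * (2 / (lnrate * e)) / (b - Vpos e)\<^sup>2)) * \<bar>H - H'\<bar>"
proof -
  define \<kappa> where "\<kappa> = b - Vpos e"
  define L where "L = 2 / (lnrate * e)"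
  define x y where "x = b - Vpos H" and "y = b - Vpos H'"
  have p: "0 < H" "0 < H'" using assms by auto
  have k: "0 < \<kappa>" using Vpos[OF assms(1)] by (simp add: \<kappa>_def)
  have xy: "\<kappa> \<le> x" "\<kappa> \<le> y" using Vpos_antimono assms by (auto simp: \<kappa>_def x_def y_def)
  have L: "0 \<le> L" using lnrate_pos assms by (simp add: L_def)
  have Weq: "rstrain h = h + (a - b) * (h / (b - Vpos h))" if "0 < h" for h
    using Vpos[OF that] by (simp add: rstrain_def field_simps)
  have Wd: "rstrain H - rstrain H' = (H - H') + (a - b) * (H / x - H' / y)"
    using Weq p by (simp add: x_def y_def algebra_simps)
  have "\<bar>H / x - H' / y\<bar> \<le> (1 / \<kappa> + B * L / \<kappa>\<^sup>2) * \<bar>H - H'\<bar>"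
  proof -
    have "H / x - H' / y = (H - H') / x + H' * (y - x) / (x * y)"
      using xy k by (simp add: field_simps)
    moreover have "\<bar>(H - H') / x\<bar> \<le> \<bar>H - H'\<bar> / \<kappa>"
      using xy k by (simp add: abs_divide frac_le)
    moreover have "\<bar>H' * (y - x) / (x * y)\<bar> \<le> B * (L * \<bar>H - H'\<bar>) / \<kappa>\<^sup>2"
    proof -
      have "\<bar>y - x\<bar> \<le> L * \<bar>H - H'\<bar>"
        using Vpos_lipschitz[OF assms(1-3)] by (simp add: x_def y_def L_def)
      moreover have "\<bar>H' * (y - x) / (x * y)\<bar> = H' * \<bar>y - x\<bar> / (x * y)"
        using p xy k by (simp add: abs_divide abs_mult)
      moreover have "\<kappa>\<^sup>2 \<le> x * y" unfolding power2_eq_square using xy k by (intro mult_mono) auto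
      ultimately show ?thesis
        using p assms k xy L by (auto intro!: frac_le mult_mono mult_nonneg_nonneg)
    qed
    ultimately have "\<bar>H / x - H' / y\<bar> \<le> \<bar>H - H'\<bar> / \<kappa> + B * (L * \<bar>H - H'\<bar>) / \<kappa>\<^sup>2" by linarith
    then show ?thesis by (simp add: algebra_simps)
  qed
  then have "(a - b) * \<bar>H / x - H' / y\<bar> \<le> (a - b) * ((1 / \<kappa> + B * L / \<kappa>\<^sup>2) * \<bar>H - H'\<bar>)"
    using speeds by (intro mult_left_mono) auto
  moreover have "\<bar>rstrain H - rstrain H'\<bar> \<le> \<bar>H - H'\<bar> + (a - b) * \<bar>H / x - H' / y\<bar>"
    using speeds abs_triangle_ineq[of "H - H'" "(a - b) * (H / x - H' / y)"] unfolding Wd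
    by (simp only: abs_mult) simp
  ultimately have "\<bar>rstrain H - rstrain H'\<bar> \<le> \<bar>H - H'\<bar> + (a - b) * ((1 / \<kappa> + B * L / \<kappa>\<^sup>2) * \<bar>H - H'\<bar>)"
    by (meson add_left_mono order_trans)
  then show ?thesis by (simp add: \<kappa>_def L_def algebra_simps)
qed

section \<open>The sonic case: behaviour as \<open>H\<close> decreases to 0\<close>

lemma Vpos_close_to_b:
  assumes "0 < e" "e < b"
  shows "\<exists>\<eta>>0. \<forall>H. 0 < H \<longrightarrow> H \<le> \<eta> \<longrightarrow> b - e < Vpos H"
proof -
  \<comment> \<open>A test point between \<open>b - e\<close> and \<open>b\<close>, where \<phi> is
    at most \<open>psi_up M x\<close> and hence strictly below \<open>phi M b\<close>. A speed of at
    most \<open>b - e\<close> would give a dissipation that tends to \<open>phi M b\<close> for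
    small \<open>H\<close> and yet is at most \<open>phi M x\<close>.\<close>
  define x where "x = b - e / 2"
  define K where "K = (k1 M - k3 M) / 2"
  define r where "r = (b\<^sup>2 - x\<^sup>2) / (a\<^sup>2 - x\<^sup>2)"
  have x: "0 < x" "x < b" "x < a" using assms speeds by (auto simp: x_def)
  have r: "0 < r" unfolding r_def using x speeds by (intro divide_pos_pos) (auto simp: power_strict_mono)
  have g: "0 < gcoef (b - e)" using gcoef_pos assms by simp
  have K: "0 < K" using half_jump_pos K_def by simp
  define \<eta> where "\<eta> = sqrt (r * (wm M)\<^sup>2 / gcoef (b - e)) / 2"
  have \<eta>: "0 < \<eta>" using r g widths by (simp add: \<eta>_def)
  have "b - e < Vpos H" if H: "0 < H" "H \<le> \<eta>" for H
  proof (rule ccontr)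
    assume "\<not> b - e < Vpos H"
    then have V: "Vpos H \<le> b - e" by simp
    have "dissipation H (b - e) \<le> dissipation H (Vpos H)"
      using dissipation_strict_antimono[of "Vpos H" "b - e" H] Vpos[OF H(1)] V assms H
      by (cases "Vpos H = b - e") auto
    also have "\<dots> \<le> phi M x"
      using kinetic_bounds(2)[OF Vpos(3,1,2)[OF H(1)], of x] x V assms by (auto simp: x_def)
    also have "\<dots> \<le> psi_up M x" using phi_upper x by simp
    finally have "K * (wM M * wm M - gcoef (b - e) * H\<^sup>2) \<le> K * wm M * (wM M - r * wm M)"
      by (simp add: dissipation_def psi_up_def K_def r_def speeds)
    then have "K * (r * (wm M)\<^sup>2) \<le> K * (gcoef (b - e) * H\<^sup>2)"
      by (simp add: algebra_simps power2_eq_square)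
    then have "r * (wm M)\<^sup>2 \<le> gcoef (b - e) * H\<^sup>2" using K by simp
    then have "r * (wm M)\<^sup>2 / gcoef (b - e) \<le> H\<^sup>2" using g by (simp add: divide_simps mult.commute)
    then have "sqrt (r * (wm M)\<^sup>2 / gcoef (b - e)) \<le> H" using H by (simp add: real_le_lsqrt real_sqrt_le_iff)
    then show False using H \<eta> by (simp add: \<eta>_def)
  qed
  then show ?thesis using \<eta> by blast
qed

text \<open>The difference quotient at \<open>b\<close> of a function that is \<open>C^2\<close> up
  to \<open>b\<close> extends to \<open>b\<close> as a Lipschitz function: by the mean value theorem
  its derivative is a difference of two values of \<open>f'\<close> divided by the distance to
  \<open>b\<close>, hence bounded by a bound for \<open>f''\<close>.\<close>

lemma phi_quotient_lipschitz:
  fixes D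
  defines "f' \<equiv> deriv_in (phi_dom M) (phi M)"
  defines "D \<equiv> \<lambda>V. if V = b then f' b else (phi M b - phi M V) / (b - V)"
  shows "\<exists>B\<ge>0. \<forall>x\<in>{b/2..b}. \<forall>y\<in>{b/2..b}. \<bar>D x - D y\<bar> \<le> B * \<bar>x - y\<bar>"
proof -
  let ?S = "phi_dom M" and ?f = "phi M"
  define f'' where "f'' = deriv_in ?S f'"
  have C2: "\<forall>x\<in>?S. ?f differentiable (at x within ?S)" "\<forall>x\<in>?S. f' differentiable (at x within ?S)"
      "continuous_on ?S f''"
    using admissible by (auto simp: admissible_phi_def Let_def C2_on_def f''_def f'_def)
  have sub: "{b/2..b} \<subseteq> ?S" using speeds by (auto simp: phi_dom_def)
  have cf: "continuous_on {b/2..b} ?f" "continuous_on {b/2..b} f'"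
    by (intro continuous_on_subset[OF _ sub] differentiable_imp_continuous_on;
        use C2 in \<open>auto simp: differentiable_on_def\<close>)+
  have der: "(?f has_real_derivative f' x) (at x)" "(f' has_real_derivative f'' x) (at x)"
    if "b/2 < x" "x < b" for x
  proof -
    have "x \<in> {b/2<..<b}" using that by simp
    then have int: "x \<in> interior ?S" using sub by (intro interiorI[of "{b/2<..<b}"]) (auto intro: order_trans)
    then have xS: "x \<in> ?S" using interior_subset by blast
    have at: "at x within ?S = at x" using int by (rule at_within_interior)
    show "(?f has_real_derivative f' x) (at x)" "(f' has_real_derivative f'' x) (at x)"
      using C2(1,2) xS vector_derivative_works[of ?f "at x"] vector_derivative_works[of f' "at x"]
      by (auto simp: f''_def f'_def deriv_in_def at has_real_derivative_iff_has_vector_derivative)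
  qed
  obtain B where B: "\<And>x. x \<in> {b/2..b} \<Longrightarrow> \<bar>f'' x\<bar> \<le> B"
  proof -
    have "compact (f'' ` {b/2..b})"
      by (rule compact_continuous_image[OF continuous_on_subset[OF C2(3) sub]]) simp
    then have "bounded (f'' ` {b/2..b})" by (rule compact_imp_bounded)
    then obtain B where "\<forall>y\<in>f'' ` {b/2..b}. norm y \<le> B" unfolding bounded_iff by blast
    then show ?thesis by (intro that[of B]) (metis imageI real_norm_def)
  qed
  have B0: "0 \<le> B" using B[of b] speeds by force
  have f'_lip: "\<bar>f' x - f' y\<bar> \<le> B * \<bar>x - y\<bar>" if "x \<in> {b/2..b}" "y \<in> {b/2..b}" for x y
  proof -
    have main: "\<bar>f' u - f' v\<bar> \<le> B * \<bar>u - v\<bar>" if uv: "b/2 \<le> u" "u < v" "v \<le> b" for u v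
    proof -
      have "f' differentiable (at x)" if "u < x" "x < v" for x
        using der(2)[of x] that uv by (auto simp: real_differentiable_def)
      moreover have "continuous_on {u..v} f'" by (rule continuous_on_subset[OF cf(2)]) (use uv in auto)
      ultimately have "\<exists>l z. u < z \<and> z < v \<and> DERIV f' z :> l \<and> f' v - f' u = (v - u) * l"
        using uv by (intro MVT)
      then obtain l z where z: "u < z" "z < v" "DERIV f' z :> l" "f' v - f' u = (v - u) * l" by blast
      have "l = f'' z" using der(2)[of z] z uv DERIV_unique by force
      then have "\<bar>l\<bar> \<le> B" using B[of z] z uv by auto
      then have "\<bar>f' v - f' u\<bar> \<le> \<bar>v - u\<bar> * B" unfolding z(4) abs_mult by (intro mult_left_mono) auto
      then show ?thesis by (simp add: abs_minus_commute mult.commute)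
    qed
    consider "x < y" | "y < x" | "x = y" by linarith
    then show ?thesis
      by cases (use main[of x y] main[of y x] that in \<open>auto simp: abs_minus_commute\<close>)
  qed
  have mvt: "\<exists>z. x < z \<and> z < b \<and> ?f b - ?f x = (b - x) * f' z" if x: "b/2 \<le> x" "x < b" for x
  proof -
    have "?f differentiable (at y)" if "x < y" "y < b" for y
      using der(1)[of y] that x by (auto simp: real_differentiable_def)
    moreover have "continuous_on {x..b} ?f" by (rule continuous_on_subset[OF cf(1)]) (use x in auto)
    ultimately have "\<exists>l z. x < z \<and> z < b \<and> DERIV ?f z :> l \<and> ?f b - ?f x = (b - x) * l"
      using x by (intro MVT)
    then obtain l z where z: "x < z" "z < b" "DERIV ?f z :> l" "?f b - ?f x = (b - x) * l" by blast
    have "l = f' z" using der(1)[of z] z x DERIV_unique by force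
    then show ?thesis using z by auto
  qed
  have D_b: "\<bar>D x - D b\<bar> \<le> B * \<bar>x - b\<bar>" if x: "x \<in> {b/2..b}" for x
  proof (cases "x = b")
    case False
    then obtain z where z: "x < z" "z < b" "?f b - ?f x = (b - x) * f' z" using mvt[of x] x by auto
    then have "D x - D b = f' z - f' b" using False by (simp add: D_def)
    also have "\<bar>\<dots>\<bar> \<le> B * \<bar>z - b\<bar>" using f'_lip[of z b] z x by auto
    also have "\<dots> \<le> B * \<bar>x - b\<bar>" using z B0 by (intro mult_left_mono) auto
    finally show ?thesis .
  qed (use B0 in auto)
  have D_lt: "\<bar>D u - D v\<bar> \<le> B * \<bar>u - v\<bar>" if uv: "b/2 \<le> u" "u < v" "v < b" for u v
  proof -
    define D0 where "D0 x = (?f b - ?f x) / (b - x)" for x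
    have dD: "(D0 has_real_derivative ((?f b - ?f x) - f' x * (b - x)) / (b - x)\<^sup>2) (at x)"
      if "b/2 < x" "x < b" for x
      unfolding D0_def using that der(1)[OF that]
      by (auto intro!: derivative_eq_intros simp: power2_eq_square)
    have cD: "continuous_on {u..v} D0"
      unfolding D0_def using uv
      by (intro continuous_intros continuous_on_subset[OF cf(1)]) auto
    have "\<exists>l z. u < z \<and> z < v \<and> DERIV D0 z :> l \<and> D0 v - D0 u = (v - u) * l"
    proof (intro MVT cD uv)
      show "D0 differentiable (at x)" if "u < x" "x < v" for x
        using dD[of x] that uv by (auto simp: real_differentiable_def)
    qed
    then obtain l z where z: "u < z" "z < v" "DERIV D0 z :> l" "D0 v - D0 u = (v - u) * l" by blast
    have zb: "b/2 < z" "z < b" using z uv by auto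
    have l: "l = ((?f b - ?f z) - f' z * (b - z)) / (b - z)\<^sup>2" using dD[OF zb] z(3) DERIV_unique by blast
    obtain y where y: "z < y" "y < b" "?f b - ?f z = (b - z) * f' y" using mvt[of z] zb by auto
    have "(b - z) * f' y - f' z * (b - z) = (f' y - f' z) * (b - z)" by (simp add: algebra_simps)
    then have "l = (f' y - f' z) / (b - z)"
      unfolding l y(3) using zb by (simp add: power2_eq_square)
    moreover have "\<bar>f' y - f' z\<bar> \<le> B * (b - z)"
    proof -
      have "\<bar>f' y - f' z\<bar> \<le> B * \<bar>y - z\<bar>" using f'_lip[of y z] y zb by auto
      also have "\<dots> \<le> B * (b - z)" using y B0 by (intro mult_left_mono) auto
      finally show ?thesis .
    qed
    ultimately have "\<bar>l\<bar> \<le> B" using zb by (simp add: abs_divide divide_le_eq)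
    then have "\<bar>D0 v - D0 u\<bar> \<le> \<bar>v - u\<bar> * B" unfolding z(4) abs_mult by (intro mult_left_mono) auto
    then show ?thesis using uv by (simp add: D_def D0_def abs_minus_commute mult.commute)
  qed
  have "\<bar>D x - D y\<bar> \<le> B * \<bar>x - y\<bar>" if xy: "x \<in> {b/2..b}" "y \<in> {b/2..b}" for x y
  proof -
    consider "x = b" | "y = b" | "x < y" "y < b" | "y < x" "x < b" | "x = y" using xy by fastforce
    then show ?thesis
    proof cases
      case 1 then show ?thesis using D_b[of y] xy by (simp add: abs_minus_commute)
    next
      case 2 then show ?thesis using D_b[of x] xy by simp
    next
      case 3 then show ?thesis using D_lt[of x y] xy by simp
    next
      case 4 then show ?thesis using D_lt[of y x] xy by (simp add: abs_minus_commute)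
    qed simp
  qed
  then show ?thesis using B0 by blast
qed

text \<open>The quotient \<open>(b - V) / (a - V)\<close> is \<open>H / rstrain H\<close>. Its lower
  Lipschitz bound allows differences of speeds to be recovered from differences of
  \<open>H\<close>.\<close>

lemma b_minus_ratio:
  assumes "0 \<le> x" "x \<le> b" "0 \<le> y" "y \<le> b"
  shows "(a - b) / a\<^sup>2 * \<bar>x - y\<bar> \<le> \<bar>(b - x) / (a - x) - (b - y) / (a - y)\<bar>"
proof -
  have p: "0 < a - x" "0 < a - y" using assms speeds by auto
  have "(b - x) / (a - x) - (b - y) / (a - y) = (a - b) * (y - x) / ((a - x) * (a - y))"
    using p by (simp add: diff_frac_eq algebra_simps)
  then have "\<bar>(b - x) / (a - x) - (b - y) / (a - y)\<bar> = (a - b) * \<bar>x - y\<bar> / ((a - x) * (a - y))"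
    using p speeds by (simp add: abs_mult abs_divide abs_minus_commute)
  moreover have "(a - b) * \<bar>x - y\<bar> / a\<^sup>2 \<le> (a - b) * \<bar>x - y\<bar> / ((a - x) * (a - y))"
  proof (rule divide_left_mono)
    show "(a - x) * (a - y) \<le> a\<^sup>2"
      unfolding power2_eq_square using assms p by (intro mult_mono) auto
  qed (use p speeds in auto)
  ultimately show ?thesis by simp
qed

text \<open>The kinetic relation solved for the square of the right strain. The zero of
  \<open>b - V\<close> cancels against that of \<open>phi M b - phi M V\<close>, which leaves an
  expression regular at \<open>V = b\<close>; its limit there is \<open>phi'(b) / b\<close>, the
  square of the strain prescribed in the sonic case.\<close>

lemma rstrain_squared:
  assumes "0 < H" "0 < Vpos H"
  shows "(rstrain H)\<^sup>2 = ((a\<^sup>2 - b\<^sup>2) / (b + Vpos H) + (b - Vpos H))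
    * ((phi M b - phi M (Vpos H)) / (b - Vpos H)) / ((a\<^sup>2 - b\<^sup>2) / 2)"
proof -
  define V where "V = Vpos H"
  define K where "K = (a\<^sup>2 - b\<^sup>2) / 2"
  have V: "0 < V" "V < b" "- b < V" using Vpos[OF assms(1)] assms by (auto simp: V_def)
  have K: "0 < K" using half_jump_pos by (simp add: K_def speeds)
  have "phi M V = dissipation H V" using Vpos(3)[OF assms(1)] V by (simp add: V_def kinetic_def)
  moreover have "dissipation H V = K * (wM M * wm M - gcoef V * H\<^sup>2)" "phi M b = K * (wm M * wM M)"
    unfolding phi_at_b dissipation_def by (simp_all add: K_def speeds)
  ultimately have "K * (gcoef V * H\<^sup>2) = phi M b - phi M V" by (simp add: algebra_simps)
  moreover have "gcoef V * H\<^sup>2 = (b\<^sup>2 - V\<^sup>2) / (a\<^sup>2 - V\<^sup>2) * (rstrain H)\<^sup>2"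
  proof -
    have "gcoef V * H\<^sup>2 = (b + V) / (a + V) * H * rstrain H"
      using gcoef_factor(1)[OF V(3,2), of H] unfolding rstrain_def V_def .
    moreover have "(b + V) / (a + V) * H = (b\<^sup>2 - V\<^sup>2) / (a\<^sup>2 - V\<^sup>2) * rstrain H"
      using gcoef_factor(3)[OF V(3,2), of H] unfolding rstrain_def V_def .
    ultimately show ?thesis by (simp only: power2_eq_square[of "rstrain H"] mult.assoc)
  qed
  ultimately have eq: "K * ((b\<^sup>2 - V\<^sup>2) / (a\<^sup>2 - V\<^sup>2) * (rstrain H)\<^sup>2) = phi M b - phi M V" by simp
  have p: "0 < b - V" "0 < b + V" "a\<^sup>2 - V\<^sup>2 > 0"
    using V speeds by (auto simp: power_strict_mono)
  have s: "b\<^sup>2 - V\<^sup>2 = (b + V) * (b - V)" "(a\<^sup>2 - b\<^sup>2) / (b + V) + (b - V) = (a\<^sup>2 - V\<^sup>2) / (b + V)"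
    using p by (auto simp: power2_eq_square field_simps)
  have "(a\<^sup>2 - V\<^sup>2) / (b + V) * ((phi M b - phi M V) / (b - V)) / K = (rstrain H)\<^sup>2"
    unfolding eq[symmetric] s(1) using p K by simp
  then show ?thesis using s(2) by (simp add: V_def K_def)
qed

text \<open>Near \<open>V = b\<close> the strain is a Lipschitz function of the speed, as the square
  root of a Lipschitz function bounded away from 0. Inserted into
  \<open>H = rstrain H * r (Vpos H)\<close>, this makes the relation between \<open>H\<close> and
  the speed invertible: \<open>r\<close> has slope bounded below and is itself small near
  \<open>b\<close>.\<close>

lemma boundary_lipschitz_at_zero:
  assumes ws: "ws = sqrt (deriv_in (phi_dom M) (phi M) b / b)" "wm M \<le> ws"
  shows "\<exists>\<eta>>0. \<exists>C\<ge>0.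
    (\<forall>H. 0 < H \<and> H \<le> \<eta> \<longrightarrow> \<bar>Vpos H - b\<bar> \<le> C * H \<and> \<bar>rstrain H - ws\<bar> \<le> C * H) \<and>
    (\<forall>H H'. 0 < H \<and> H \<le> \<eta> \<and> 0 < H' \<and> H' \<le> \<eta> \<longrightarrow>
      \<bar>Vpos H - Vpos H'\<bar> \<le> C * \<bar>H - H'\<bar> \<and> \<bar>rstrain H - rstrain H'\<bar> \<le> C * \<bar>H - H'\<bar>)"
proof -
  define f' where "f' = deriv_in (phi_dom M) (phi M)"
  define D where "D V = (if V = b then f' b else (phi M b - phi M V) / (b - V))" for V
  obtain B where B: "0 \<le> B" "\<And>x y. x \<in> {b/2..b} \<Longrightarrow> y \<in> {b/2..b} \<Longrightarrow> \<bar>D x - D y\<bar> \<le> B * \<bar>x - y\<bar>"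
    using phi_quotient_lipschitz unfolding D_def f'_def by blast
  define K where "K = (a\<^sup>2 - b\<^sup>2) / 2"
  have K: "0 < K" using half_jump_pos by (simp add: K_def speeds)
  define g where "g V = (a\<^sup>2 - b\<^sup>2) / (b + V) + (b - V)" for V
  define G where "G V = g V * D V / K" for V
  define Dm where "Dm = \<bar>f' b\<bar> + B * b"
  define gm where "gm = (a\<^sup>2 - b\<^sup>2) / b + b"
  define gl where "gl = (a\<^sup>2 - b\<^sup>2) / b\<^sup>2 + 1"
  define LG where "LG = (gm * B + Dm * gl) / K"
  have ab: "0 < a\<^sup>2 - b\<^sup>2" using K by (simp add: K_def)
  have nn: "0 \<le> gm" "0 \<le> gl" "0 \<le> Dm" using ab speeds B by (auto simp: gm_def gl_def Dm_def)
  have LG0: "0 \<le> LG" using nn B K by (simp add: LG_def)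
  have G_lip: "\<bar>G x - G y\<bar> \<le> LG * \<bar>x - y\<bar>" if xy: "x \<in> {b/2..b}" "y \<in> {b/2..b}" for x y
  proof -
    have px: "0 < x" "0 < y" "x \<le> b" "y \<le> b" using xy speeds by auto
    have "\<bar>D y - D b\<bar> \<le> B * \<bar>y - b\<bar>" using B(2)[of y b] xy speeds by auto
    also have "\<dots> \<le> B * b" using px B by (intro mult_left_mono) auto
    finally have Dy: "\<bar>D y\<bar> \<le> Dm" by (simp add: Dm_def D_def split: if_splits)
    have "(a\<^sup>2 - b\<^sup>2) / (b + x) \<le> (a\<^sup>2 - b\<^sup>2) / b" using ab px speeds by (intro divide_left_mono) auto
    moreover have "0 \<le> (a\<^sup>2 - b\<^sup>2) / (b + x)" using ab px speeds by (intro divide_nonneg_nonneg) auto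
    ultimately have gx: "\<bar>g x\<bar> \<le> gm" unfolding g_def gm_def using px by linarith
    have gd: "\<bar>g x - g y\<bar> \<le> gl * \<bar>x - y\<bar>"
    proof -
      have "(a\<^sup>2 - b\<^sup>2) / (b + x) - (a\<^sup>2 - b\<^sup>2) / (b + y) = (a\<^sup>2 - b\<^sup>2) * (y - x) / ((b + x) * (b + y))"
        using px speeds by (simp add: diff_frac_eq algebra_simps)
      then have "\<bar>(a\<^sup>2 - b\<^sup>2) / (b + x) - (a\<^sup>2 - b\<^sup>2) / (b + y)\<bar> = (a\<^sup>2 - b\<^sup>2) * \<bar>x - y\<bar> / ((b + x) * (b + y))"
        using px speeds ab by (simp add: abs_mult abs_divide abs_minus_commute)
      also have "\<dots> \<le> (a\<^sup>2 - b\<^sup>2) * \<bar>x - y\<bar> / b\<^sup>2"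
      proof (rule divide_left_mono)
        show "b\<^sup>2 \<le> (b + x) * (b + y)"
          unfolding power2_eq_square using px speeds by (intro mult_mono) auto
      qed (use px speeds ab in auto)
      finally have "\<bar>(a\<^sup>2 - b\<^sup>2) / (b + x) - (a\<^sup>2 - b\<^sup>2) / (b + y)\<bar> + \<bar>x - y\<bar> \<le> gl * \<bar>x - y\<bar>"
        by (simp add: gl_def distrib_right)
      then show ?thesis unfolding g_def by linarith
    qed
    have "g x * D x - g y * D y = g x * (D x - D y) + D y * (g x - g y)" by (simp add: algebra_simps)
    then have "\<bar>g x * D x - g y * D y\<bar> \<le> \<bar>g x\<bar> * \<bar>D x - D y\<bar> + \<bar>D y\<bar> * \<bar>g x - g y\<bar>"
      by (metis abs_mult abs_triangle_ineq)
    also have "\<dots> \<le> gm * (B * \<bar>x - y\<bar>) + Dm * (gl * \<bar>x - y\<bar>)"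
      using gx gd Dy B(2)[OF xy] nn by (intro add_mono mult_mono) auto
    finally have "\<bar>g x * D x - g y * D y\<bar> / K \<le> (gm * (B * \<bar>x - y\<bar>) + Dm * (gl * \<bar>x - y\<bar>)) / K"
      using K by (intro divide_right_mono) auto
    then show ?thesis using K by (simp add: G_def LG_def diff_divide_distrib[symmetric] abs_divide algebra_simps)
  qed
  have wm: "0 < wm M" using widths by simp
  have Gb: "G b = ws\<^sup>2"
  proof -
    \<comment> \<open>The real \<open>sqrt\<close> is odd, so \<open>ws^2\<close> may be replaced by
      the argument only after \<open>ws > 0\<close> has shown the argument to be positive.\<close>
    have "0 < ws" using ws(2) wm by simp
    then have "0 < f' b / b" unfolding ws(1) f'_def[symmetric] using real_sqrt_gt_0_iff by blast
    then have "ws\<^sup>2 = f' b / b" unfolding ws(1) f'_def[symmetric] by simp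
    moreover have "G b = f' b / b"
      unfolding G_def g_def D_def using ab speeds by (simp add: K_def field_simps)
    ultimately show ?thesis by simp
  qed
  define LW where "LW = LG / wm M"
  have LW0: "0 \<le> LW" using LG0 wm by (simp add: LW_def)
  have sq: "\<bar>s - t\<bar> \<le> LW * d" if "\<bar>s\<^sup>2 - t\<^sup>2\<bar> \<le> LG * d" "wm M \<le> s" "wm M \<le> t" for s t d
  proof -
    have "wm M * \<bar>s - t\<bar> \<le> (s + t) * \<bar>s - t\<bar>" using that wm by (intro mult_right_mono) auto
    also have "\<dots> = \<bar>s\<^sup>2 - t\<^sup>2\<bar>" using that wm by (simp add: power2_eq_square square_diff_square_factored abs_mult)
    finally have "wm M * \<bar>s - t\<bar> \<le> LG * d" using that by simp
    then show ?thesis using wm by (simp add: LW_def field_simps)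
  qed
  define \<kappa> where "\<kappa> = (a - b) / a\<^sup>2"
  have k: "0 < \<kappa>" using speeds by (simp add: \<kappa>_def)
  \<comment> \<open>So small that the variation of the strain, multiplied by
    \<open>r \<le> e / (a - b)\<close>, consumes at most half of the lower bound
    \<open>wm M * \<kappa>\<close> that comes from the slope of \<open>r\<close>.\<close>
  define e where "e = min (b / 2) (wm M * \<kappa> * (a - b) / (2 * (LW + 1)))"
  have e2: "e \<le> b / 2" unfolding e_def by (rule min.cobounded1)
  have e: "0 < e" "e < b" "e \<le> b / 2" using e2 k speeds wm LW0 by (auto simp: e_def)
  have e_small: "LW * (e / (a - b)) \<le> wm M * \<kappa> / 2"
  proof -
    have "(LW + 1) * e \<le> (LW + 1) * (wm M * \<kappa> * (a - b) / (2 * (LW + 1)))"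
      using LW0 by (intro mult_left_mono) (auto simp: e_def)
    moreover have "N * (X / (2 * N)) = X / 2" if "N \<noteq> 0" for N X :: real using that by simp
    ultimately have "(LW + 1) * e \<le> wm M * \<kappa> * (a - b) / 2" using LW0 by (metis add.commute less_add_one not_le)
    then have "LW * e \<le> wm M * \<kappa> * (a - b) / 2" using e by (simp add: distrib_right)
    then have "LW * e / (a - b) \<le> wm M * \<kappa> / 2" using speeds by (simp add: pos_divide_le_eq)
    then show ?thesis by simp
  qed
  obtain \<eta> where \<eta>: "0 < \<eta>" "\<And>H. 0 < H \<Longrightarrow> H \<le> \<eta> \<Longrightarrow> b - e < Vpos H"
    using Vpos_close_to_b[OF e(1,2)] by blast
  define r where "r V = (b - V) / (a - V)" for V
  have near: "Vpos H \<in> {b/2..b}" "Vpos H < b" "0 < Vpos H" "(rstrain H)\<^sup>2 = G (Vpos H)" "wm M \<le> rstrain H"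
      "H = rstrain H * r (Vpos H)" "b - e < Vpos H"
    if H: "0 < H" "H \<le> \<eta>" for H
  proof -
    show 1: "Vpos H < b" "b - e < Vpos H" using Vpos(2)[OF H(1)] \<eta>(2)[OF H] by auto
    then show "Vpos H \<in> {b/2..b}" and pos: "0 < Vpos H" using e speeds by auto
    show "(rstrain H)\<^sup>2 = G (Vpos H)"
      using rstrain_squared[OF H(1) pos] 1 by (simp add: G_def g_def D_def K_def)
    show "wm M \<le> rstrain H" by (rule rstrain_pos[OF H(1)])
    show "H = rstrain H * r (Vpos H)" using 1 speeds by (simp add: rstrain_def r_def)
  qed
  have W_V: "\<bar>rstrain H - rstrain H'\<bar> \<le> LW * \<bar>Vpos H - Vpos H'\<bar>"
    if "0 < H" "H \<le> \<eta>" "0 < H'" "H' \<le> \<eta>" for H H'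
    using near(4,5)[OF that(1,2)] near(4,5)[OF that(3,4)] G_lip[OF near(1)[OF that(1,2)] near(1)[OF that(3,4)]]
    by (intro sq) auto
  have W_b: "\<bar>rstrain H - ws\<bar> \<le> LW * \<bar>Vpos H - b\<bar>" if "0 < H" "H \<le> \<eta>" for H
    using near(4,5)[OF that] G_lip[OF near(1)[OF that], of b] Gb ws speeds by (intro sq) auto
  have V_b: "\<bar>Vpos H - b\<bar> \<le> a / wm M * H" if H: "0 < H" "H \<le> \<eta>" for H
  proof -
    have "(b - Vpos H) / a \<le> r (Vpos H)"
      unfolding r_def using near[OF H] speeds by (intro divide_left_mono) auto
    then have "wm M * ((b - Vpos H) / a) \<le> rstrain H * r (Vpos H)"
      using near[OF H] speeds wm by (intro mult_mono) auto
    then have "wm M * ((b - Vpos H) / a) \<le> H" using near(6)[OF H] by simp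
    then show ?thesis using near[OF H] speeds wm by (simp add: field_simps)
  qed
  have V_lip: "\<bar>Vpos H - Vpos H'\<bar> \<le> 2 / (wm M * \<kappa>) * \<bar>H - H'\<bar>"
    if H: "0 < H" "H \<le> \<eta>" and H': "0 < H'" "H' \<le> \<eta>" for H H'
  proof -
    define d where "d = \<bar>Vpos H - Vpos H'\<bar>"
    note n = near[OF H] and n' = near[OF H']
    have "H - H' = rstrain H * (r (Vpos H) - r (Vpos H')) + (rstrain H - rstrain H') * r (Vpos H')"
      using n(6) n'(6) by (simp add: algebra_simps)
    then have "\<bar>rstrain H * (r (Vpos H) - r (Vpos H'))\<bar> \<le> \<bar>H - H'\<bar> + \<bar>(rstrain H - rstrain H') * r (Vpos H')\<bar>" by linarith
    moreover have "wm M * (\<kappa> * d) \<le> \<bar>rstrain H * (r (Vpos H) - r (Vpos H'))\<bar>"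
      unfolding abs_mult d_def r_def \<kappa>_def using n n' wm speeds
      by (intro mult_mono b_minus_ratio mult_nonneg_nonneg) auto
    moreover have "\<bar>(rstrain H - rstrain H') * r (Vpos H')\<bar> \<le> (LW * d) * (e / (a - b))"
    proof -
      have "0 \<le> r (Vpos H')" unfolding r_def using n' speeds by (intro divide_nonneg_nonneg) auto
      moreover have "r (Vpos H') \<le> e / (a - b)"
        unfolding r_def using n' speeds e by (intro frac_le) auto
      ultimately show ?thesis
        unfolding abs_mult d_def using W_V[OF H H'] LW0 by (intro mult_mono) auto
    qed
    moreover have "(LW * d) * (e / (a - b)) \<le> wm M * \<kappa> / 2 * d"
      using mult_right_mono[OF e_small, of d] by (simp add: d_def mult_ac)
    moreover have "wm M * (\<kappa> * d) = wm M * \<kappa> * d" by simp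
    ultimately have "wm M * \<kappa> * d - wm M * \<kappa> / 2 * d \<le> \<bar>H - H'\<bar>" by linarith
    then have "d * (wm M * \<kappa>) \<le> 2 * \<bar>H - H'\<bar>" by (simp add: mult_ac)
    moreover have "0 < wm M * \<kappa>" using wm k by simp
    ultimately have "d \<le> 2 * \<bar>H - H'\<bar> / (wm M * \<kappa>)" by (simp only: pos_le_divide_eq)
    then show ?thesis by (simp add: d_def)
  qed
  define C where "C = a / wm M + LW * (a / wm M) + 2 / (wm M * \<kappa>) + LW * (2 / (wm M * \<kappa>))"
  have Cs: "a / wm M \<le> C" "LW * (a / wm M) \<le> C" "2 / (wm M * \<kappa>) \<le> C" "LW * (2 / (wm M * \<kappa>)) \<le> C" "0 \<le> C"
    using LW0 wm k speeds by (auto simp: C_def)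
  have up: "x \<le> C * y" if "x \<le> c * y" "c \<le> C" "0 \<le> y" for x y c
    using that mult_right_mono by (meson order_trans)
  have "\<bar>Vpos H - b\<bar> \<le> C * H \<and> \<bar>rstrain H - ws\<bar> \<le> C * H" if H: "0 < H" "H \<le> \<eta>" for H
  proof
    show "\<bar>Vpos H - b\<bar> \<le> C * H" using up[OF V_b[OF H] Cs(1)] H by simp
    have "\<bar>rstrain H - ws\<bar> \<le> LW * (a / wm M * H)"
      using W_b[OF H] mult_left_mono[OF V_b[OF H] LW0] by linarith
    then have "\<bar>rstrain H - ws\<bar> \<le> (LW * (a / wm M)) * H" by (simp only: mult.assoc)
    then show "\<bar>rstrain H - ws\<bar> \<le> C * H" using up[OF _ Cs(2)] H by simp
  qed
  moreover have "\<bar>Vpos H - Vpos H'\<bar> \<le> C * \<bar>H - H'\<bar> \<and> \<bar>rstrain H - rstrain H'\<bar> \<le> C * \<bar>H - H'\<bar>"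
    if H: "0 < H" "H \<le> \<eta>" "0 < H'" "H' \<le> \<eta>" for H H'
  proof
    show "\<bar>Vpos H - Vpos H'\<bar> \<le> C * \<bar>H - H'\<bar>" using up[OF V_lip[OF H] Cs(3)] by simp
    have "\<bar>rstrain H - rstrain H'\<bar> \<le> LW * (2 / (wm M * \<kappa>) * \<bar>H - H'\<bar>)"
      using W_V[OF H] mult_left_mono[OF V_lip[OF H] LW0] by linarith
    then have "\<bar>rstrain H - rstrain H'\<bar> \<le> (LW * (2 / (wm M * \<kappa>))) * \<bar>H - H'\<bar>" by (simp only: mult.assoc)
    then show "\<bar>rstrain H - rstrain H'\<bar> \<le> C * \<bar>H - H'\<bar>" using up[OF _ Cs(4)] by simp
  qed
  ultimately show ?thesis using \<eta>(1) Cs(5) by (intro exI[of _ \<eta>] exI[of _ C] conjI) auto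
qed

text \<open>What the analysis of the scheme uses, in one form for positive, negative and vanishing
  \<open>Hs\<close>. \<open>Wx\<close> extends \<open>rstrain\<close> to \<open>H \<le> 0\<close>,
  where nothing is emitted, so that a Lipschitz quantity can be followed across sign changes of
  \<open>H\<close>.\<close>

definition boundary_modulus :: "real \<Rightarrow> real \<Rightarrow> real \<Rightarrow> real \<Rightarrow> (real \<Rightarrow> real) \<Rightarrow> bool" where
  "boundary_modulus Hs ws \<eta> C Wx \<longleftrightarrow> 0 < \<eta> \<and> 0 \<le> C \<and>
     (\<forall>H. \<bar>H - Hs\<bar> \<le> \<eta> \<longrightarrow> 0 < H \<longrightarrow> Wx H = rstrain H) \<and> Wx Hs = ws \<and>
     (\<forall>H H'. \<bar>H - Hs\<bar> \<le> \<eta> \<longrightarrow> \<bar>H' - Hs\<bar> \<le> \<eta> \<longrightarrow> \<bar>Wx H - Wx H'\<bar> \<le> C * \<bar>H - H'\<bar>) \<and>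
     (\<forall>H H' w w'. \<bar>H - Hs\<bar> \<le> \<eta> \<longrightarrow> \<bar>H' - Hs\<bar> \<le> \<eta> \<longrightarrow> wm M \<le> w \<longrightarrow> wm M \<le> w' \<longrightarrow>
        \<bar>bspeed H w - bspeed H' w'\<bar> \<le> C * \<bar>H - H'\<bar> + C * (max 0 (- H) * \<bar>w - w'\<bar>))"

lemma boundary_modulus_exists:
  assumes spb: "single_phase_boundary M ul ur Vs"
    and sonic: "Vs = b \<Longrightarrow> snd ur = sqrt (deriv_in (phi_dom M) (phi M) b / b)"
  shows "\<exists>\<eta> C Wx. boundary_modulus (h_two_phase M ul ur) (snd ur) \<eta> C Wx"
proof -
  define Hs where "Hs = h_two_phase M ul ur"
  define ws where "ws = snd ur"
  note D = single_phase_boundaryD[OF spb, folded Hs_def ws_def]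
  have ws: "wm M \<le> ws" using D(2) by (auto simp: H3_def ws_def)
  have wm: "0 < wm M" using widths by simp
  define Cn where "Cn = (a - b) / wm M + (a - b) / (wm M)\<^sup>2"
  have Cn: "0 \<le> Cn" "(a - b) / wm M \<le> Cn" "(a - b) / (wm M)\<^sup>2 \<le> Cn"
    using speeds wm by (auto simp: Cn_def)
  have nonpos: "\<bar>bspeed H w - bspeed H' w'\<bar> \<le> Cn * \<bar>H - H'\<bar> + Cn * (max 0 (- H) * \<bar>w - w'\<bar>)"
    if "H \<le> 0" "H' \<le> 0" "wm M \<le> w" "wm M \<le> w'" for H H' w w'
  proof -
    have "max 0 (- H) = - H" using that by simp
    moreover have "(a - b) / wm M * \<bar>H - H'\<bar> \<le> Cn * \<bar>H - H'\<bar>" using Cn by (intro mult_right_mono) auto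
    moreover have "(a - b) / (wm M)\<^sup>2 * (- H * \<bar>w - w'\<bar>) \<le> Cn * (- H * \<bar>w - w'\<bar>)"
      using Cn that by (intro mult_right_mono mult_nonneg_nonneg) auto
    ultimately show ?thesis using bspeed_lipschitz_nonpos[OF that] by linarith
  qed
  consider "0 < Hs" | "Hs < 0" | "Hs = 0" by linarith
  then have "\<exists>\<eta> C Wx. boundary_modulus Hs ws \<eta> C Wx"
  proof cases
    case 1
    define e where "e = Hs / 2"
    define LV where "LV = 2 / (lnrate * e)"
    define LW where "LW = 1 + (a - b) * (1 / (b - Vpos e) + 3 * e * LV / (b - Vpos e)\<^sup>2)"
    have e: "0 < e" using 1 by (simp add: e_def)
    have LV: "0 \<le> LV" using e lnrate_pos by (simp add: LV_def)
    have LW: "0 \<le> LW" using e LV Vpos[OF e] speeds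
      unfolding LW_def by (intro add_nonneg_nonneg mult_nonneg_nonneg divide_nonneg_nonneg) auto
    have "boundary_modulus Hs ws e (LV + LW) rstrain"
      unfolding boundary_modulus_def
    proof (intro conjI allI impI)
      show "0 < e" "0 \<le> LV + LW" "rstrain Hs = ws" using e LV LW D(5) 1 by auto
    next
      fix H H' assume H: "\<bar>H - Hs\<bar> \<le> e" "\<bar>H' - Hs\<bar> \<le> e"
      then have H2: "e \<le> H" "e \<le> H'" "H' \<le> 3 * e" unfolding e_def by linarith+
      have "\<bar>rstrain H - rstrain H'\<bar> \<le> LW * \<bar>H - H'\<bar>"
        using rstrain_lipschitz[OF e H2] by (simp add: LW_def LV_def)
      also have "\<dots> \<le> (LV + LW) * \<bar>H - H'\<bar>" using LV by (intro mult_right_mono) auto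
      finally show "\<bar>rstrain H - rstrain H'\<bar> \<le> (LV + LW) * \<bar>H - H'\<bar>" .
      fix w w'
      have "\<bar>bspeed H w - bspeed H' w'\<bar> \<le> LV * \<bar>H - H'\<bar>"
        using Vpos_lipschitz[OF e H2(1,2)] H2 e by (simp add: bspeed_def LV_def)
      also have "\<dots> \<le> (LV + LW) * \<bar>H - H'\<bar>" using LW by (intro mult_right_mono) auto
      also have "max 0 (- H) = 0" using H2 e by simp
      then have "(LV + LW) * \<bar>H - H'\<bar> = (LV + LW) * \<bar>H - H'\<bar> + (LV + LW) * (max 0 (- H) * \<bar>w - w'\<bar>)" by simp
      finally show "\<bar>bspeed H w - bspeed H' w'\<bar> \<le> (LV + LW) * \<bar>H - H'\<bar> + (LV + LW) * (max 0 (- H) * \<bar>w - w'\<bar>)" .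
    qed auto
    then show ?thesis by blast
  next
    case 2
    have "boundary_modulus Hs ws (- Hs / 2) Cn (\<lambda>_. ws)"
      unfolding boundary_modulus_def
    proof (intro conjI allI impI)
      show "ws = rstrain H" if "\<bar>H - Hs\<bar> \<le> - Hs / 2" "0 < H" for H using that 2 by linarith
      fix H H' w w' assume H: "\<bar>H - Hs\<bar> \<le> - Hs / 2" "\<bar>H' - Hs\<bar> \<le> - Hs / 2" "wm M \<le> w" "wm M \<le> w'"
      then have "H \<le> 0" "H' \<le> 0" using 2 by linarith+
      then show "\<bar>bspeed H w - bspeed H' w'\<bar> \<le> Cn * \<bar>H - H'\<bar> + Cn * (max 0 (- H) * \<bar>w - w'\<bar>)"
        using nonpos H by blast
    qed (use 2 Cn in auto)
    then show ?thesis by blast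
  next
    case 3
    note Hs0 = 3
    have "Vs = b" using D(3) bspeed_nonpos(1)[of Hs ws] 3 ws wm by simp
    then have "ws = sqrt (deriv_in (phi_dom M) (phi M) b / b)" using sonic by (simp add: ws_def)
    from boundary_lipschitz_at_zero[OF this ws] obtain \<eta> C where \<eta>: "0 < \<eta>" and C: "0 \<le> C"
      and near: "\<And>H. 0 < H \<Longrightarrow> H \<le> \<eta> \<Longrightarrow> \<bar>Vpos H - b\<bar> \<le> C * H \<and> \<bar>rstrain H - ws\<bar> \<le> C * H"
      and lip: "\<And>H H'. 0 < H \<Longrightarrow> H \<le> \<eta> \<Longrightarrow> 0 < H' \<Longrightarrow> H' \<le> \<eta> \<Longrightarrow>
        \<bar>Vpos H - Vpos H'\<bar> \<le> C * \<bar>H - H'\<bar> \<and> \<bar>rstrain H - rstrain H'\<bar> \<le> C * \<bar>H - H'\<bar>" by blast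
    define Wx where "Wx H = (if 0 < H then rstrain H else ws)" for H
    have b0: "\<bar>bspeed H w - b\<bar> \<le> Cn * \<bar>H\<bar>" if "H \<le> 0" "wm M \<le> w" for H w
      using nonpos[of 0 H w w] bspeed_nonpos(1)[of 0 w] that wm by (simp add: abs_minus_commute)
    \<comment> \<open>Values of \<open>H\<close> on opposite sides of 0 are compared through the
      common limit \<open>b\<close> of both branches; neither is further from 0 than the distance
      between them.\<close>
    have mixed: "\<bar>bspeed H w - bspeed H' w'\<bar> \<le> (C + Cn) * \<bar>H - H'\<bar>"
      if "0 < H" "H \<le> \<eta>" "H' \<le> 0" "wm M \<le> w'" for H H' w w'
    proof -
      have "\<bar>bspeed H w - bspeed H' w'\<bar> \<le> C * H + Cn * \<bar>H'\<bar>"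
      proof -
        have "bspeed H w = Vpos H" using that by (simp add: bspeed_def)
        then show ?thesis using near[of H] b0[of H' w'] that by linarith
      qed
      also have "\<dots> \<le> C * \<bar>H - H'\<bar> + Cn * \<bar>H - H'\<bar>"
        using C Cn that by (intro add_mono mult_left_mono) auto
      finally show ?thesis by (simp add: distrib_right)
    qed
    have "boundary_modulus Hs ws \<eta> (C + Cn) Wx"
      unfolding boundary_modulus_def
    proof (intro conjI allI impI)
      show "0 < \<eta>" "0 \<le> C + Cn" "Wx Hs = ws" using \<eta> C Cn 3 by (auto simp: Wx_def)
      show "Wx H = rstrain H" if "0 < H" for H using that by (simp add: Wx_def)
    next
      fix H H' assume H: "\<bar>H - Hs\<bar> \<le> \<eta>" "\<bar>H' - Hs\<bar> \<le> \<eta>"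
      have "\<bar>Wx H - Wx H'\<bar> \<le> C * \<bar>H - H'\<bar>"
      proof -
        have m: "\<bar>rstrain x - ws\<bar> \<le> C * \<bar>x - y\<bar>" if "0 < x" "x \<le> \<eta>" "y \<le> 0" for x y
          using near[of x] that C mult_left_mono[of x "x - y" C] by simp
        consider "0 < H" "0 < H'" | "0 < H" "H' \<le> 0" | "H \<le> 0" "0 < H'" | "H \<le> 0" "H' \<le> 0" by linarith
        then show ?thesis
          by cases (use lip[of H H'] m[of H H'] m[of H' H] H Hs0 C in \<open>auto simp: Wx_def abs_minus_commute\<close>)
      qed
      also have "\<dots> \<le> (C + Cn) * \<bar>H - H'\<bar>" using Cn by (intro mult_right_mono) auto
      finally show "\<bar>Wx H - Wx H'\<bar> \<le> (C + Cn) * \<bar>H - H'\<bar>" .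
      fix w w' assume w: "wm M \<le> w" "wm M \<le> w'"
      define R where "R = (C + Cn) * (max 0 (- H) * \<bar>w - w'\<bar>)"
      have R: "0 \<le> R" using C Cn by (simp add: R_def)
      consider "0 < H" "0 < H'" | "0 < H" "H' \<le> 0" | "H \<le> 0" "0 < H'" | "H \<le> 0" "H' \<le> 0" by linarith
      then have "\<bar>bspeed H w - bspeed H' w'\<bar> \<le> (C + Cn) * \<bar>H - H'\<bar> + R"
      proof cases
        case 1
        have "\<bar>bspeed H w - bspeed H' w'\<bar> \<le> C * \<bar>H - H'\<bar>" using lip[of H H'] 1 H Hs0 by (simp add: bspeed_def)
        also have "\<dots> \<le> (C + Cn) * \<bar>H - H'\<bar>" using Cn by (intro mult_right_mono) auto
        finally show ?thesis using R by simp
      next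
        case 2 then show ?thesis using mixed[of H H' w' w] H Hs0 w R by simp
      next
        case 3 then show ?thesis using mixed[of H' H w w'] H Hs0 w R by (simp add: abs_minus_commute)
      next
        case 4
        have "\<bar>bspeed H w - bspeed H' w'\<bar> \<le> Cn * \<bar>H - H'\<bar> + Cn * (max 0 (- H) * \<bar>w - w'\<bar>)"
          using nonpos 4 w by blast
        also have "\<dots> \<le> (C + Cn) * \<bar>H - H'\<bar> + R"
          unfolding R_def using C by (intro add_mono mult_right_mono) auto
        finally show ?thesis .
      qed
      then show "\<bar>bspeed H w - bspeed H' w'\<bar> \<le> (C + Cn) * \<bar>H - H'\<bar> + (C + Cn) * (max 0 (- H) * \<bar>w - w'\<bar>)"
        by (simp add: R_def)
    qed
    then show ?thesis by blast
  qed
  then show ?thesis by (simp add: Hs_def ws_def)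
qed

text \<open>In terms of \<open>x = a + bspeed H w\<close> the strain is
  \<open>(1 - (a - b) / x) * H\<close> with \<open>x > a - b\<close>, so it inherits the Lipschitz
  bound of the speed. The constant obtained here controls the wave emitted to the left.\<close>

lemma lstrain_close:
  assumes bm: "boundary_modulus Hs ws \<eta> C Wx" and ws: "wm M \<le> ws" "wm M \<le> w" and H: "\<bar>H - Hs\<bar> \<le> \<eta>"
  shows "\<bar>lstrain H w - lstrain Hs ws\<bar> \<le> (1 + (\<bar>Hs\<bar> + \<eta>) / (a - b) * (C + C * (\<bar>Hs\<bar> + \<eta>))) * (\<bar>H - Hs\<bar> + \<bar>w - ws\<bar>)"
proof -
  define x y where "x = a + bspeed H w" and "y = a + bspeed Hs ws"
  define B where "B = \<bar>Hs\<bar> + \<eta>"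
  define d where "d = \<bar>H - Hs\<bar> + \<bar>w - ws\<bar>"
  have C: "0 \<le> C" "0 < \<eta>" using bm by (auto simp: boundary_modulus_def)
  have B: "0 \<le> B" "\<bar>Hs\<bar> \<le> B" "max 0 (- H) \<le> B" using C H by (auto simp: B_def)
  have w: "0 < w" "0 < ws" using ws widths by auto
  have x: "a - b < x" "a - b < y" using bspeed_bounds[OF w(1), of H] bspeed_bounds[OF w(2), of Hs] by (auto simp: x_def y_def)
  have ab: "0 < a - b" using speeds by simp
  have V: "\<bar>x - y\<bar> \<le> (C + C * B) * d"
  proof -
    have "\<bar>x - y\<bar> \<le> C * \<bar>H - Hs\<bar> + C * (max 0 (- H) * \<bar>w - ws\<bar>)"
      using bm H ws C unfolding boundary_modulus_def x_def y_def by simp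
    also have "\<dots> \<le> C * d + C * (B * d)"
      using C B unfolding d_def by (intro add_mono mult_left_mono mult_mono) auto
    finally show ?thesis by (simp add: algebra_simps)
  qed
  have f: "lstrain H w = (1 - (a - b) / x) * H" "lstrain Hs ws = (1 - (a - b) / y) * Hs"
  proof -
    have "b + bspeed H w = x - (a - b)" "b + bspeed Hs ws = y - (a - b)" by (auto simp: x_def y_def)
    then show "lstrain H w = (1 - (a - b) / x) * H" "lstrain Hs ws = (1 - (a - b) / y) * Hs"
      using x ab by (simp_all only: lstrain_def x_def[symmetric] y_def[symmetric]) (simp_all add: diff_divide_distrib)
  qed
  have "lstrain H w - lstrain Hs ws = (1 - (a - b) / x) * (H - Hs) + Hs * ((a - b) / y - (a - b) / x)"
  proof -
    have "(1 - p) * H - (1 - q) * Hs = (1 - p) * (H - Hs) + Hs * (q - p)" for p q :: real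
      by (simp add: algebra_simps)
    then show ?thesis unfolding f by blast
  qed
  then have "\<bar>lstrain H w - lstrain Hs ws\<bar> \<le> \<bar>1 - (a - b) / x\<bar> * \<bar>H - Hs\<bar> + \<bar>Hs\<bar> * \<bar>(a - b) / y - (a - b) / x\<bar>"
    by (metis abs_mult abs_triangle_ineq)
  also have "\<dots> \<le> 1 * d + B * (1 / (a - b) * ((C + C * B) * d))"
  proof (intro add_mono mult_mono)
    show "\<bar>1 - (a - b) / x\<bar> \<le> 1" using x ab by (simp add: abs_le_iff divide_le_eq)
    have "(a - b) / y - (a - b) / x = (a - b) * (x - y) / (x * y)"
      using x ab by (simp add: diff_frac_eq algebra_simps)
    then have "\<bar>(a - b) / y - (a - b) / x\<bar> = (a - b) * \<bar>x - y\<bar> / (x * y)"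
      using x ab by (simp add: abs_mult abs_divide)
    also have "\<dots> \<le> (a - b) * \<bar>x - y\<bar> / ((a - b) * (a - b))"
      using x ab by (intro divide_left_mono mult_mono mult_pos_pos) auto
    also have "\<dots> = 1 / (a - b) * \<bar>x - y\<bar>" using ab by simp
    also have "\<dots> \<le> 1 / (a - b) * ((C + C * B) * d)" using V ab by (intro mult_left_mono) auto
    finally show "\<bar>(a - b) / y - (a - b) / x\<bar> \<le> 1 / (a - b) * ((C + C * B) * d)" .
  qed (use B in \<open>auto simp: d_def\<close>)
  also have "\<dots> = (1 + B / (a - b) * (C + C * B)) * d" by (simp add: distrib_right)
  finally show ?thesis by (simp add: B_def d_def)
qed

end

section \<open>The scheme as a system of four shifted sequences\<close>

text \<open>The invariants are listed outwards from the boundary over infinitely many cells; the sum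
  is meaningful only together with \<open>has_seq_var\<close>.\<close>

definition seq_var :: "(nat \<Rightarrow> real) \<Rightarrow> real" where
  "seq_var X = (\<Sum>i. \<bar>X (Suc i) - X i\<bar>)"

definition has_seq_var :: "(nat \<Rightarrow> real) \<Rightarrow> bool" where
  "has_seq_var X \<longleftrightarrow> summable (\<lambda>i. \<bar>X (Suc i) - X i\<bar>)"

lemma seq_var_nonneg: "has_seq_var X \<Longrightarrow> 0 \<le> seq_var X"
  by (simp add: seq_var_def has_seq_var_def suminf_nonneg)

lemma seq_var_pop:
  assumes "has_seq_var X"
  shows "has_seq_var (\<lambda>i. X (Suc i))" "seq_var X = \<bar>X 1 - X 0\<bar> + seq_var (\<lambda>i. X (Suc i))"
proof -
  show "has_seq_var (\<lambda>i. X (Suc i))"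
    using assms summable_Suc_iff[of "\<lambda>i. \<bar>X (Suc i) - X i\<bar>"] by (simp add: has_seq_var_def)
  show "seq_var X = \<bar>X 1 - X 0\<bar> + seq_var (\<lambda>i. X (Suc i))"
    using suminf_split_head[of "\<lambda>i. \<bar>X (Suc i) - X i\<bar>"] assms by (simp add: seq_var_def has_seq_var_def)
qed

lemma seq_var_push:
  assumes "has_seq_var X"
  shows "has_seq_var (case_nat e X)" "seq_var (case_nat e X) = \<bar>X 0 - e\<bar> + seq_var X"
proof -
  show h: "has_seq_var (case_nat e X)"
    using assms summable_Suc_iff[of "\<lambda>i. \<bar>case_nat e X (Suc i) - case_nat e X i\<bar>"]
    by (simp add: has_seq_var_def)
  show "seq_var (case_nat e X) = \<bar>X 0 - e\<bar> + seq_var X"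
    using seq_var_pop(2)[OF h] by simp
qed

text \<open>A time step shifts an invariant by at most one cell relative to the boundary: an
  incoming sequence may lose its head, an outgoing one may receive a new head.\<close>

definition stay_or_pop :: "(nat \<Rightarrow> real) \<Rightarrow> (nat \<Rightarrow> real) \<Rightarrow> bool" where
  "stay_or_pop X X' \<longleftrightarrow> X' = X \<or> X' = (\<lambda>i. X (Suc i))"

definition stay_or_push :: "real \<Rightarrow> (nat \<Rightarrow> real) \<Rightarrow> (nat \<Rightarrow> real) \<Rightarrow> bool" where
  "stay_or_push e X X' \<longleftrightarrow> X' = X \<or> X' = case_nat e X"

text \<open>The jump of the head is exactly what the remaining sequence loses, which makes
  \<open>seq_var\<close> a potential for incoming waves.\<close>

lemma stay_or_pop_var:
  assumes "stay_or_pop X X'" "has_seq_var X"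
  shows "has_seq_var X'" "\<bar>X' 0 - X 0\<bar> + seq_var X' = seq_var X"
  using assms seq_var_pop[OF assms(2)] by (auto simp: stay_or_pop_def)

lemma sum_le_potential:
  fixes d \<Phi> e :: "nat \<Rightarrow> real"
  assumes "\<And>n. d n + \<Phi> (Suc n) \<le> \<Phi> n + e n"
  shows "(\<Sum>k<n. d k) + \<Phi> n \<le> \<Phi> 0 + (\<Sum>k<n. e k)"
proof (induction n)
  case (Suc n)
  then show ?case using assms[of n] by simp
qed simp

section \<open>One time step seen from the phase boundary\<close>

locale glimm_run = admissible_material M for M +
  fixes U :: "nat \<Rightarrow> int \<Rightarrow> state" and \<xi> :: "nat \<Rightarrow> real"
  assumes U_Suc: "U (Suc n) m = riemann M (U n (m - 1)) (U n (m + 1)) (\<xi> n)"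
begin

text \<open>The mesh index of the fan that contains the phase boundary, starting at the jump of the
  initial data. A sample at or left of the boundary speed puts a state of the left phase into the
  new cell, so the boundary moves to the right.\<close>

primrec pos :: "nat \<Rightarrow> int" where
  "pos 0 = 0"
| "pos (Suc n) = pos n +
    (if \<xi> n \<le> bspeed (h_two_phase M (U n (pos n - 2)) (U n (pos n))) (snd (U n (pos n))) then 1 else - 1)"

definition L :: "nat \<Rightarrow> nat \<Rightarrow> state" where "L n i = U n (pos n - 2 - 2 * int i)"
definition R :: "nat \<Rightarrow> nat \<Rightarrow> state" where "R n i = U n (pos n + 2 * int i)"
definition Hn :: "nat \<Rightarrow> real" where "Hn n = h_two_phase M (L n 0) (R n 0)"
definition speed :: "nat \<Rightarrow> real" where "speed n = bspeed (Hn n) (snd (R n 0))"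
definition strain :: "nat \<Rightarrow> real" where "strain n = lstrain (Hn n) (snd (R n 0))"

abbreviation "qL n \<equiv> \<lambda>i. qinv a (L n i)"
abbreviation "pL n \<equiv> \<lambda>i. pinv a (L n i)"
abbreviation "qR n \<equiv> \<lambda>i. qinv b (R n i)"
abbreviation "pR n \<equiv> \<lambda>i. pinv b (R n i)"

lemma pos_Suc: "pos (Suc n) = pos n + (if \<xi> n \<le> speed n then 1 else - 1)"
  by (simp add: speed_def Hn_def L_def R_def)

lemma pos_even: "even (pos n + int n)"
  by (induction n) (auto simp: pos_Suc simp del: pos.simps(2))

lemma L_R_Suc:
  "\<xi> n \<le> speed n \<Longrightarrow> L (Suc n) 0 = riemann M (L n 0) (R n 0) (\<xi> n)"
  "\<xi> n \<le> speed n \<Longrightarrow> L (Suc n) (Suc i) = riemann M (L n (Suc i)) (L n i) (\<xi> n)"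
  "\<xi> n \<le> speed n \<Longrightarrow> R (Suc n) i = riemann M (R n i) (R n (Suc i)) (\<xi> n)"
  "\<not> \<xi> n \<le> speed n \<Longrightarrow> L (Suc n) i = riemann M (L n (Suc i)) (L n i) (\<xi> n)"
  "\<not> \<xi> n \<le> speed n \<Longrightarrow> R (Suc n) 0 = riemann M (L n 0) (R n 0) (\<xi> n)"
  "\<not> \<xi> n \<le> speed n \<Longrightarrow> R (Suc n) (Suc i) = riemann M (R n i) (R n (Suc i)) (\<xi> n)"
proof -
  have U': "U (Suc n) m = riemann M (U n k) (U n l) (\<xi> n)" if "k = m - 1" "l = m + 1" for m k l
    using U_Suc that by simp
  note d = L_def R_def pos_Suc
  show "\<xi> n \<le> speed n \<Longrightarrow> L (Suc n) 0 = riemann M (L n 0) (R n 0) (\<xi> n)"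
    "\<xi> n \<le> speed n \<Longrightarrow> L (Suc n) (Suc i) = riemann M (L n (Suc i)) (L n i) (\<xi> n)"
    "\<xi> n \<le> speed n \<Longrightarrow> R (Suc n) i = riemann M (R n i) (R n (Suc i)) (\<xi> n)"
    "\<not> \<xi> n \<le> speed n \<Longrightarrow> L (Suc n) i = riemann M (L n (Suc i)) (L n i) (\<xi> n)"
    "\<not> \<xi> n \<le> speed n \<Longrightarrow> R (Suc n) 0 = riemann M (L n 0) (R n 0) (\<xi> n)"
    "\<not> \<xi> n \<le> speed n \<Longrightarrow> R (Suc n) (Suc i) = riemann M (R n i) (R n (Suc i)) (\<xi> n)"
    unfolding d by (auto intro!: U' simp del: pos.simps(2))
qed

text \<open>Under these conditions the fans of step \<open>n\<close> are given by the closed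
  formulas and create no new phase, so the states of the next step lie in the expected
  phases.\<close>

definition regular :: "nat \<Rightarrow> bool" where
  "regular n \<longleftrightarrow> (\<forall>i. L n i \<in> H1 M) \<and> (\<forall>i. R n i \<in> H3 M) \<and> - 1 < strain n \<and>
     (\<forall>i. middle_state a (L n (Suc i)) (L n i) \<in> H1 M) \<and>
     (\<forall>i. middle_state b (R n i) (R n (Suc i)) \<in> H3 M)"

lemma regular_speed:
  assumes "regular n"
  shows "- b < speed n" "speed n < a" "0 < Hn n \<Longrightarrow> speed n < b" "Hn n \<le> 0 \<Longrightarrow> b \<le> speed n"
    "0 < snd (R n 0)" "wm M \<le> snd (R n 0)"
proof -
  have "R n 0 \<in> H3 M" using assms by (simp add: regular_def)
  then show w: "wm M \<le> snd (R n 0)" by (auto simp: H3_def)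
  then show "0 < snd (R n 0)" using widths by simp
  with bspeed_bounds bspeed_pos bspeed_nonpos(2) show "- b < speed n" "speed n < a"
    "0 < Hn n \<Longrightarrow> speed n < b" "Hn n \<le> 0 \<Longrightarrow> b \<le> speed n"
    by (auto simp: speed_def)
qed

lemma boundary_fan:
  assumes "regular n"
  shows "riemann M (L n 0) (R n 0) x =
    (if x \<le> - a then L n 0
     else if x \<le> speed n then (fst (L n 0) + a * (strain n - snd (L n 0)), strain n)
     else if 0 < Hn n \<and> x \<le> b then (fst (R n 0) + b * (snd (R n 0) - rstrain (Hn n)), rstrain (Hn n)) else R n 0)"
  unfolding speed_def strain_def Hn_def
  using assms by (intro riemann_two_phase) (auto simp: regular_def strain_def Hn_def)

lemma left_fan:
  assumes "regular n"
  shows "riemann M (L n (Suc i)) (L n i) x =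
    (if x \<le> - a then L n (Suc i) else if x \<le> a then middle_state a (L n (Suc i)) (L n i) else L n i)"
  using assms by (intro riemann_phase1) (auto simp: regular_def)

lemma right_fan:
  assumes "regular n"
  shows "riemann M (R n i) (R n (Suc i)) x =
    (if x \<le> - b then R n i else if x \<le> b then middle_state b (R n i) (R n (Suc i)) else R n (Suc i))"
  using assms by (intro riemann_phase3) (auto simp: regular_def)

lemma fan_phases:
  assumes "regular n"
  shows "riemann M (L n (Suc i)) (L n i) x \<in> H1 M" "riemann M (R n i) (R n (Suc i)) x \<in> H3 M"
    "x \<le> speed n \<Longrightarrow> riemann M (L n 0) (R n 0) x \<in> H1 M"
    "\<not> x \<le> speed n \<Longrightarrow> riemann M (L n 0) (R n 0) x \<in> H3 M"
proof -
  show "riemann M (L n (Suc i)) (L n i) x \<in> H1 M" "riemann M (R n i) (R n (Suc i)) x \<in> H3 M"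
    unfolding left_fan[OF assms] right_fan[OF assms] using assms by (auto simp: regular_def)
  have s: "(y, strain n) \<in> H1 M" for y
    using assms lstrain_le[OF regular_speed(5)[OF assms], of "Hn n"] by (auto simp: regular_def H1_def strain_def)
  have w: "(y, rstrain (Hn n)) \<in> H3 M" if "0 < Hn n" for y
    using rstrain_pos[OF that] by (auto simp: H3_def)
  show "x \<le> speed n \<Longrightarrow> riemann M (L n 0) (R n 0) x \<in> H1 M"
    unfolding boundary_fan[OF assms] using assms s by (auto simp: regular_def)
  show "\<not> x \<le> speed n \<Longrightarrow> riemann M (L n 0) (R n 0) x \<in> H3 M"
    unfolding boundary_fan[OF assms] using assms w speeds regular_speed(1)[OF assms] by (auto simp: regular_def)
qed

lemma phases_Suc:
  assumes "regular n"
  shows "L (Suc n) i \<in> H1 M" "R (Suc n) i \<in> H3 M"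
proof -
  show "L (Suc n) i \<in> H1 M"
    by (cases "\<xi> n \<le> speed n"; cases i) (auto simp: L_R_Suc fan_phases[OF assms])
  show "R (Suc n) i \<in> H3 M"
    by (cases "\<xi> n \<le> speed n"; cases i) (auto simp: L_R_Suc fan_phases[OF assms])
qed

text \<open>Characteristic speeds are compared with the speed of the boundary. \<open>qL\<close>
  moves at \<open>a\<close> and \<open>pR\<close> at \<open>-b\<close>, always towards the boundary;
  \<open>pL\<close> moves at \<open>-a\<close>, away from it. \<open>qR\<close> moves at
  \<open>b\<close>, faster than the boundary if \<open>Hn n > 0\<close> but not if
  \<open>Hn n \<le> 0\<close>, so it is emitted in the first case and overtaken in the
  second.\<close>

lemma invariants_Suc:
  assumes "regular n"
  shows "stay_or_pop (qL n) (qL (Suc n))"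
    "stay_or_pop (pR n) (pR (Suc n))"
    "stay_or_push (qL n 0 + 2 * a * strain n) (pL n) (pL (Suc n))"
    "0 < Hn n \<Longrightarrow> stay_or_push (pR n 0 - 2 * b * rstrain (Hn n)) (qR n) (qR (Suc n))"
    "Hn n \<le> 0 \<Longrightarrow> stay_or_pop (qR n) (qR (Suc n))"
proof -
  note sp = regular_speed[OF assms]
  note fans = boundary_fan[OF assms] left_fan[OF assms] right_fan[OF assms]
  note mid = middle_state_invariants[OF speeds(3)] middle_state_invariants[OF speeds(1)]
  have nat_fun: "f = g \<longleftrightarrow> f 0 = g 0 \<and> (\<forall>i. f (Suc i) = g (Suc i))" for f g :: "nat \<Rightarrow> real"
    by (metis ext not0_implies_Suc)
  have pq: "qinv a (fst u + a * (s - snd u), s) = qinv a u"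
    "pinv a (fst u + a * (s - snd u), s) = qinv a u + 2 * a * s"
    "pinv b (fst u + b * (snd u - s), s) = pinv b u"
    "qinv b (fst u + b * (snd u - s), s) = pinv b u - 2 * b * s" for u s
    by (auto simp: qinv_def pinv_def algebra_simps)
  show "stay_or_pop (qL n) (qL (Suc n))"
  proof (cases "\<xi> n \<le> speed n")
    case True
    then have "qL (Suc n) = qL n" using sp by (subst nat_fun) (auto simp: L_R_Suc fans mid pq)
    then show ?thesis by (simp add: stay_or_pop_def)
  next
    case False
    then show ?thesis using sp speeds
      by (cases "\<xi> n \<le> a") (auto simp: stay_or_pop_def L_R_Suc fans mid)
  qed
  show "stay_or_pop (pR n) (pR (Suc n))"
  proof (cases "\<xi> n \<le> speed n")
    case True
    then show ?thesis using sp
      by (cases "\<xi> n \<le> - b") (auto simp: stay_or_pop_def L_R_Suc fans mid)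
  next
    case False
    then have "pR (Suc n) = pR n" using sp speeds by (subst nat_fun) (auto simp: L_R_Suc fans mid pq)
    then show ?thesis by (simp add: stay_or_pop_def)
  qed
  show "stay_or_push (qL n 0 + 2 * a * strain n) (pL n) (pL (Suc n))"
  proof (cases "\<xi> n \<le> speed n")
    case True
    show ?thesis
    proof (cases "\<xi> n \<le> - a")
      case True
      then have "pL (Suc n) = pL n" using sp speeds
        by (subst nat_fun) (auto simp: L_R_Suc fans mid pq)
      then show ?thesis by (simp add: stay_or_push_def)
    next
      case False
      then have "pL (Suc n) = case_nat (qL n 0 + 2 * a * strain n) (pL n)"
        using True by (subst nat_fun) (auto simp: L_R_Suc fans mid pq)
      then show ?thesis by (simp add: stay_or_push_def)
    qed
  next
    case False
    then show ?thesis using sp speeds by (auto simp: stay_or_push_def L_R_Suc fans mid)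
  qed
  show "stay_or_push (pR n 0 - 2 * b * rstrain (Hn n)) (qR n) (qR (Suc n))" if H: "0 < Hn n"
  proof (cases "\<xi> n \<le> speed n")
    case True
    then show ?thesis using sp(3)[OF H] by (auto simp: stay_or_push_def L_R_Suc fans mid)
  next
    case False
    show ?thesis
    proof (cases "\<xi> n \<le> b")
      case True
      then have "qR (Suc n) = case_nat (pR n 0 - 2 * b * rstrain (Hn n)) (qR n)"
        using False sp speeds H by (subst nat_fun) (auto simp: L_R_Suc fans mid pq)
      then show ?thesis by (simp add: stay_or_push_def)
    next
      case b: False
      then have "qR (Suc n) = qR n" using False sp speeds by (subst nat_fun) (auto simp: L_R_Suc fans mid pq)
      then show ?thesis by (simp add: stay_or_push_def)
    qed
  qed
  show "stay_or_pop (qR n) (qR (Suc n))" if H: "Hn n \<le> 0"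
  proof (cases "\<xi> n \<le> speed n")
    case True
    then show ?thesis using speeds
      by (cases "\<xi> n \<le> b") (auto simp: stay_or_pop_def L_R_Suc fans mid)
  next
    case False
    then have "qR (Suc n) = qR n" using sp(1) sp(4)[OF H] speeds H
      by (subst nat_fun) (auto simp: L_R_Suc fans mid pq)
    then show ?thesis by (simp add: stay_or_pop_def)
  qed
qed

end

section \<open>Uniform bounds along a run\<close>

context admissible_material
begin

text \<open>Amplification factors. If the incoming invariants are within \<epsilon> of the
  reference, \<open>H\<close> is within \<open>2 * \<epsilon> / (a + b)\<close>, and
  \<open>right_gain\<close>, \<open>strain_gain\<close> and \<open>left_gain\<close> times
  \<epsilon> bound the deviations of the invariant emitted to the right, of the left strain and of
  the invariant emitted to the left.\<close>

definition right_gain :: "real \<Rightarrow> real" where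
  "right_gain C = 1 + 4 * b * C / (a + b)"

definition strain_gain :: "real \<Rightarrow> real \<Rightarrow> real" where
  "strain_gain K C = K * (2 / (a + b) + (1 + right_gain C) / (2 * b))"

definition left_gain :: "real \<Rightarrow> real \<Rightarrow> real" where
  "left_gain K C = 1 + 2 * a * strain_gain K C"

text \<open>Written out without reference to a run, so that one number serves all meshes.
  \<open>B\<close> bounds the size of \<open>H\<close>, \<epsilon> the initial deviation of the
  invariants and \<open>v\<close> their initial variation.\<close>

definition variation_bound :: "real \<Rightarrow> real \<Rightarrow> real \<Rightarrow> real \<Rightarrow> real" where
  "variation_bound C B \<epsilon> v =
    (let GH = 2 * v / (a + b); GT = 2 * right_gain C * \<epsilon> + v + (v + 2 * b * C * GH)
     in C * GH + C * ((B * v + B * GT + GT * GH) / (2 * b)))"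

end

text \<open>The smallness conditions keep the strains above \<open>-1\<close> and, for a reference
  state inside its phase, the intermediate states inside as well; for a reference state on the edge
  \<open>no_new_phase\<close> takes over.\<close>

locale glimm_run_near = glimm_run M U \<xi> for M U \<xi> +
  fixes ul ur :: state and \<eta> C :: real and Wx :: "real \<Rightarrow> real" and \<epsilon> K v :: real
  assumes uls: "ul \<in> H1 M" and urs: "ur \<in> H3 M"
    and lstrain_ref: "lstrain (h_two_phase M ul ur) (snd ur) = snd ul"
    and modulus: "boundary_modulus (h_two_phase M ul ur) (snd ur) \<eta> C Wx"
    and strain_close: "\<And>H w. \<bar>H - h_two_phase M ul ur\<bar> \<le> \<eta> \<Longrightarrow> wm M \<le> w \<Longrightarrow>
       \<bar>lstrain H w - snd ul\<bar> \<le> K * (\<bar>H - h_two_phase M ul ur\<bar> + \<bar>w - snd ur\<bar>)"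
    and K: "0 \<le> K" and eps: "0 \<le> \<epsilon>"
    and small_H: "2 * \<epsilon> / (a + b) \<le> \<eta>"
    and small_strain: "strain_gain K C * \<epsilon> < 1 + snd ul"
    and small_L: "(1 + left_gain K C) * \<epsilon> / (2 * a) < 1 + snd ul"
    and interior_L: "snd ul = wM M \<or> snd ul + (1 + left_gain K C) * \<epsilon> / (2 * a) \<le> wM M"
    and boundary_L: "snd ul = wM M \<Longrightarrow> no_new_phase (H1 M) a U"
    and interior_R: "snd ur = wm M \<or> wm M \<le> snd ur - (1 + right_gain C) * \<epsilon> / (2 * b)"
    and boundary_R: "snd ur = wm M \<Longrightarrow> no_new_phase (H3 M) b U"
    and init: "\<And>i. L 0 i \<in> H1 M" "\<And>i. R 0 i \<in> H3 M"
      "\<And>i. \<bar>qL 0 i - qinv a ul\<bar> \<le> \<epsilon>" "\<And>i. \<bar>pL 0 i - pinv a ul\<bar> \<le> \<epsilon>"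
      "\<And>i. \<bar>qR 0 i - qinv b ur\<bar> \<le> \<epsilon>" "\<And>i. \<bar>pR 0 i - pinv b ur\<bar> \<le> \<epsilon>"
    and init_var: "has_seq_var (qL 0)" "seq_var (qL 0) \<le> v" "has_seq_var (pR 0)" "seq_var (pR 0) \<le> v"
      "has_seq_var (qR 0)" "seq_var (qR 0) \<le> v"
begin

abbreviation "KR \<equiv> right_gain C"
abbreviation "KB \<equiv> strain_gain K C"
abbreviation "KL \<equiv> left_gain K C"
abbreviation "Hs \<equiv> h_two_phase M ul ur"
abbreviation "ws \<equiv> snd ur"

lemma C_nonneg: "0 \<le> C" "0 < \<eta>" "Wx Hs = ws"
  using modulus by (auto simp: boundary_modulus_def)

lemma KR1: "1 \<le> KR" using C_nonneg speeds by (simp add: right_gain_def)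
lemma KB0: "0 \<le> KB" using K KR1 speeds by (simp add: strain_gain_def)
lemma KL1: "1 \<le> KL" using KB0 speeds by (simp add: left_gain_def)

definition near :: "nat \<Rightarrow> bool" where
  "near n \<longleftrightarrow> (\<forall>i. L n i \<in> H1 M \<and> R n i \<in> H3 M \<and>
     \<bar>qL n i - qinv a ul\<bar> \<le> \<epsilon> \<and> \<bar>pL n i - pinv a ul\<bar> \<le> KL * \<epsilon> \<and>
     \<bar>qR n i - qinv b ur\<bar> \<le> KR * \<epsilon> \<and> \<bar>pR n i - pinv b ur\<bar> \<le> \<epsilon>)"

lemma near_H:
  assumes "near n"
  shows "\<bar>Hn n - Hs\<bar> \<le> 2 * \<epsilon> / (a + b)" "\<bar>Hn n - Hs\<bar> \<le> \<eta>"
proof -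
  have ab: "0 < a + b" using speeds by simp
  have "(a + b) * (Hn n - Hs) = (pR n 0 - pinv b ur) - (qL n 0 - qinv a ul)"
    using h_two_phase_eq[of ul ur] h_two_phase_eq[of "L n 0" "R n 0"] by (simp add: Hn_def right_diff_distrib)
  moreover have "\<bar>pR n 0 - pinv b ur\<bar> \<le> \<epsilon>" "\<bar>qL n 0 - qinv a ul\<bar> \<le> \<epsilon>"
    using assms by (auto simp: near_def)
  ultimately have "\<bar>(a + b) * (Hn n - Hs)\<bar> \<le> 2 * \<epsilon>" by linarith
  then have "\<bar>Hn n - Hs\<bar> * (a + b) \<le> 2 * \<epsilon>" using ab by (simp add: abs_mult mult.commute)
  then show "\<bar>Hn n - Hs\<bar> \<le> 2 * \<epsilon> / (a + b)" using ab by (simp only: pos_le_divide_eq)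
  then show "\<bar>Hn n - Hs\<bar> \<le> \<eta>" using small_H by linarith
qed

lemma snd_close:
  assumes "0 < c" "\<bar>qinv c u - qinv c u'\<bar> \<le> d" "\<bar>pinv c u - pinv c u'\<bar> \<le> d'"
  shows "\<bar>snd u - snd u'\<bar> \<le> (d + d') / (2 * c)"
proof -
  have "2 * c * (snd u - snd u') = (pinv c u - pinv c u') - (qinv c u - qinv c u')"
    by (simp add: pinv_def qinv_def algebra_simps)
  then have "\<bar>2 * c * (snd u - snd u')\<bar> \<le> d + d'" using assms by linarith
  moreover have "\<bar>2 * c * (snd u - snd u')\<bar> = \<bar>snd u - snd u'\<bar> * (2 * c)"
    by (subst abs_mult) (use assms in simp)
  ultimately have "\<bar>snd u - snd u'\<bar> * (2 * c) \<le> d + d'" by simp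
  then show ?thesis using assms by (simp add: pos_le_divide_eq)
qed

lemma near_w:
  assumes "near n"
  shows "\<bar>snd (R n 0) - ws\<bar> \<le> (1 + KR) * \<epsilon> / (2 * b)" "wm M \<le> snd (R n 0)"
proof -
  have "\<bar>snd (R n 0) - ws\<bar> \<le> (KR * \<epsilon> + \<epsilon>) / (2 * b)"
    using assms speeds by (intro snd_close) (auto simp: near_def)
  then show "\<bar>snd (R n 0) - ws\<bar> \<le> (1 + KR) * \<epsilon> / (2 * b)" by (simp add: algebra_simps)
  have "R n 0 \<in> H3 M" using assms by (simp add: near_def)
  then show "wm M \<le> snd (R n 0)" by (auto simp: H3_def)
qed

lemma near_strain:
  assumes "near n"
  shows "\<bar>strain n - snd ul\<bar> \<le> KB * \<epsilon>"
proof -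
  have "\<bar>strain n - snd ul\<bar> \<le> K * (\<bar>Hn n - Hs\<bar> + \<bar>snd (R n 0) - ws\<bar>)"
    unfolding strain_def using near_H[OF assms] near_w[OF assms] by (intro strain_close) auto
  also have "\<dots> \<le> K * (2 * \<epsilon> / (a + b) + (1 + KR) * \<epsilon> / (2 * b))"
    using near_H[OF assms] near_w[OF assms] K by (intro mult_left_mono add_mono) auto
  also have "\<dots> = KB * \<epsilon>" by (simp add: strain_gain_def algebra_simps)
  finally show ?thesis .
qed

lemma near_regular:
  assumes "near n"
  shows "regular n"
proof -
  have mL: "middle_state a (L n (Suc i)) (L n i) \<in> H1 M" for i
  proof (cases "snd ul = wM M")
    case True
    have "even (pos n - 2 - 2 * int (Suc i) + int n)" using pos_even[of n] by simp
    moreover have "pos n - 2 - 2 * int (Suc i) + 2 = pos n - 2 - 2 * int i" by simp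
    moreover have "L n (Suc i) \<in> H1 M" "L n i \<in> H1 M" using assms by (auto simp: near_def)
    ultimately show ?thesis
      using boundary_L[OF True] unfolding no_new_phase_def L_def by metis
  next
    case False
    have "\<bar>snd (middle_state a (L n (Suc i)) (L n i)) - snd ul\<bar> \<le> (\<epsilon> + KL * \<epsilon>) / (2 * a)"
      using assms speeds by (intro snd_close) (auto simp: near_def middle_state_invariants)
    also have "\<dots> = (1 + KL) * \<epsilon> / (2 * a)" by (simp add: algebra_simps)
    finally show ?thesis using False interior_L small_L by (auto simp: H1_def case_prod_beta)
  qed
  have mR: "middle_state b (R n i) (R n (Suc i)) \<in> H3 M" for i
  proof (cases "ws = wm M")
    case True
    have "even (pos n + 2 * int i + int n)" using pos_even[of n] by simp
    moreover have "pos n + 2 * int i + 2 = pos n + 2 * int (Suc i)" by simp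
    moreover have "R n (Suc i) \<in> H3 M" "R n i \<in> H3 M" using assms by (auto simp: near_def)
    ultimately show ?thesis
      using boundary_R[OF True] unfolding no_new_phase_def R_def by metis
  next
    case False
    have "\<bar>snd (middle_state b (R n i) (R n (Suc i))) - ws\<bar> \<le> (KR * \<epsilon> + \<epsilon>) / (2 * b)"
      using assms speeds by (intro snd_close) (auto simp: near_def middle_state_invariants)
    also have "\<dots> = (1 + KR) * \<epsilon> / (2 * b)" by (simp add: algebra_simps)
    finally show ?thesis using False interior_R by (auto simp: H3_def case_prod_beta)
  qed
  have "- 1 < strain n" using near_strain[OF assms] small_strain by linarith
  then show ?thesis using assms mL mR by (auto simp: regular_def near_def)
qed

text \<open>The value that step \<open>n\<close> pushes onto \<open>qR\<close> if it emits at all.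
  Through \<open>Wx\<close> it makes sense also while nothing is emitted, so that its variation can
  be summed over all steps.\<close>

definition emit :: "nat \<Rightarrow> real" where "emit n = pR n 0 - 2 * b * Wx (Hn n)"

lemma emit_eq: "near n \<Longrightarrow> 0 < Hn n \<Longrightarrow> pR n 0 - 2 * b * rstrain (Hn n) = emit n"
  using modulus near_H by (simp add: boundary_modulus_def emit_def)

lemma emit_close:
  assumes "near n"
  shows "\<bar>emit n - qinv b ur\<bar> \<le> KR * \<epsilon>"
proof -
  have "\<bar>Wx (Hn n) - Wx Hs\<bar> \<le> C * \<bar>Hn n - Hs\<bar>"
  proof -
    have "\<bar>Hs - Hs\<bar> \<le> \<eta>" using C_nonneg by simp
    then show ?thesis using modulus near_H(2)[OF assms] unfolding boundary_modulus_def by blast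
  qed
  also have "\<dots> \<le> C * (2 * \<epsilon> / (a + b))" using near_H[OF assms] C_nonneg by (intro mult_left_mono) auto
  finally have rstrain: "\<bar>Wx (Hn n) - ws\<bar> \<le> C * (2 * \<epsilon> / (a + b))" using C_nonneg by simp
  have "2 * b * \<bar>Wx (Hn n) - ws\<bar> \<le> 2 * b * (C * (2 * \<epsilon> / (a + b)))"
    using rstrain speeds by (intro mult_left_mono) auto
  moreover have "emit n - qinv b ur = (pR n 0 - pinv b ur) - 2 * b * (Wx (Hn n) - ws)"
    by (simp add: emit_def qinv_def pinv_def algebra_simps)
  moreover have "\<bar>2 * b * (Wx (Hn n) - ws)\<bar> = 2 * b * \<bar>Wx (Hn n) - ws\<bar>"
    using speeds by (simp add: abs_mult)
  moreover have "\<bar>pR n 0 - pinv b ur\<bar> \<le> \<epsilon>" using assms by (simp add: near_def)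
  ultimately have "\<bar>emit n - qinv b ur\<bar> \<le> \<epsilon> + 2 * b * (C * (2 * \<epsilon> / (a + b)))" by linarith
  also have "\<dots> = KR * \<epsilon>" by (simp add: right_gain_def algebra_simps)
  finally show ?thesis .
qed

lemma stay_or_pop_all: "stay_or_pop X X' \<Longrightarrow> \<forall>i. P (X i) \<Longrightarrow> \<forall>i. P (X' i)"
  by (auto simp: stay_or_pop_def)

lemma stay_or_push_all: "stay_or_push e X X' \<Longrightarrow> P e \<Longrightarrow> \<forall>i. P (X i) \<Longrightarrow> \<forall>i. P (X' i)"
  by (auto simp: stay_or_push_def split: nat.split)

text \<open>The radii do not grow with \<open>n\<close>: incoming invariants are initial values, and
  the wave emitted to the right is computed from incoming invariants only. A returning
  \<open>qR\<close> influences the left strain but not \<open>H\<close>, so no loop arises.\<close>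

lemma near_all: "near n"
proof (induction n)
  case 0
  have "\<epsilon> \<le> KR * \<epsilon>" "\<epsilon> \<le> KL * \<epsilon>" using KR1 KL1 eps by (simp_all add: mult_le_cancel_right1)
  then show ?case using init unfolding near_def by (meson order_trans)
next
  case (Suc n)
  note reg = near_regular[OF Suc]
  note inv = invariants_Suc[OF reg]
  have old: "\<forall>i. \<bar>qL n i - qinv a ul\<bar> \<le> \<epsilon>" "\<forall>i. \<bar>pL n i - pinv a ul\<bar> \<le> KL * \<epsilon>"
    "\<forall>i. \<bar>qR n i - qinv b ur\<bar> \<le> KR * \<epsilon>" "\<forall>i. \<bar>pR n i - pinv b ur\<bar> \<le> \<epsilon>"
    using Suc by (auto simp: near_def)
  have 1: "\<forall>i. \<bar>qL (Suc n) i - qinv a ul\<bar> \<le> \<epsilon>"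
    using stay_or_pop_all[OF inv(1), of "\<lambda>x. \<bar>x - qinv a ul\<bar> \<le> \<epsilon>"] old by blast
  have 2: "\<forall>i. \<bar>pR (Suc n) i - pinv b ur\<bar> \<le> \<epsilon>"
    using stay_or_pop_all[OF inv(2), of "\<lambda>x. \<bar>x - pinv b ur\<bar> \<le> \<epsilon>"] old by blast
  have "qL n 0 + 2 * a * strain n - pinv a ul = (qL n 0 - qinv a ul) + 2 * a * (strain n - snd ul)"
    by (simp add: pinv_def qinv_def algebra_simps)
  moreover have "\<bar>2 * a * (strain n - snd ul)\<bar> \<le> 2 * a * (KB * \<epsilon>)"
    using near_strain[OF Suc] speeds by (simp add: abs_mult)
  moreover have "\<bar>qL n 0 - qinv a ul\<bar> \<le> \<epsilon>" using old by blast
  ultimately have "\<bar>qL n 0 + 2 * a * strain n - pinv a ul\<bar> \<le> \<epsilon> + 2 * a * (KB * \<epsilon>)" by linarith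
  then have "\<bar>qL n 0 + 2 * a * strain n - pinv a ul\<bar> \<le> KL * \<epsilon>" by (simp add: left_gain_def algebra_simps)
  then have 3: "\<forall>i. \<bar>pL (Suc n) i - pinv a ul\<bar> \<le> KL * \<epsilon>"
    using stay_or_push_all[OF inv(3), of "\<lambda>x. \<bar>x - pinv a ul\<bar> \<le> KL * \<epsilon>"] old by blast
  have 4: "\<forall>i. \<bar>qR (Suc n) i - qinv b ur\<bar> \<le> KR * \<epsilon>"
  proof (cases "0 < Hn n")
    case True
    show ?thesis
      using stay_or_push_all[OF inv(4)[OF True], of "\<lambda>x. \<bar>x - qinv b ur\<bar> \<le> KR * \<epsilon>"]
        emit_close[OF Suc] emit_eq[OF Suc True] old by auto
  next
    case False
    then have "Hn n \<le> 0" by simp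
    from stay_or_pop_all[OF inv(5)[OF this], of "\<lambda>x. \<bar>x - qinv b ur\<bar> \<le> KR * \<epsilon>"] old show ?thesis by blast
  qed
  show ?case using 1 2 3 4 phases_Suc[OF reg] by (auto simp: near_def)
qed

lemma regular_all: "regular n"
  using near_regular near_all by blast

lemma has_var: "has_seq_var (qL n)" "has_seq_var (pR n)" "has_seq_var (qR n)"
proof -
  show "has_seq_var (qL n)"
    by (induction n) (use init_var invariants_Suc(1)[OF regular_all] stay_or_pop_var in blast)+
  show "has_seq_var (pR n)"
    by (induction n) (use init_var invariants_Suc(2)[OF regular_all] stay_or_pop_var in blast)+
  show "has_seq_var (qR n)"
  proof (induction n)
    case (Suc n)
    show ?case
    proof (cases "0 < Hn n")
      case True
      then show ?thesis using invariants_Suc(4)[OF regular_all True] Suc seq_var_push(1)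
        by (auto simp: stay_or_push_def)
    next
      case False
      then show ?thesis using invariants_Suc(5)[OF regular_all, of n] Suc stay_or_pop_var by force
    qed
  qed (use init_var in blast)
qed

section \<open>Total variation of the boundary speed\<close>

abbreviation "dH k \<equiv> \<bar>Hn (Suc k) - Hn k\<bar>"
abbreviation "dq k \<equiv> \<bar>qL (Suc k) 0 - qL k 0\<bar>"
abbreviation "dp k \<equiv> \<bar>pR (Suc k) 0 - pR k 0\<bar>"

text \<open>Every change of a head uses up variation of its sequence, of which there is at most
  \<open>v\<close> initially.\<close>

lemma sum_dq: "(\<Sum>k<n. dq k) \<le> v" and sum_dp: "(\<Sum>k<n. dp k) \<le> v"
proof -
  have "(\<Sum>k<n. dq k) + seq_var (qL n) \<le> seq_var (qL 0) + (\<Sum>k<n. 0)"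
    using stay_or_pop_var(2)[OF invariants_Suc(1)[OF regular_all] has_var(1)]
    by (intro sum_le_potential) simp
  then show "(\<Sum>k<n. dq k) \<le> v" using seq_var_nonneg[OF has_var(1), of n] init_var by simp
  have "(\<Sum>k<n. dp k) + seq_var (pR n) \<le> seq_var (pR 0) + (\<Sum>k<n. 0)"
    using stay_or_pop_var(2)[OF invariants_Suc(2)[OF regular_all] has_var(2)]
    by (intro sum_le_potential) simp
  then show "(\<Sum>k<n. dp k) \<le> v" using seq_var_nonneg[OF has_var(2), of n] init_var by simp
qed

lemma dH_le: "dH k \<le> (dp k + dq k) / (a + b)"
proof -
  have ab: "0 < a + b" using speeds by simp
  have "(a + b) * (Hn (Suc k) - Hn k) = (pR (Suc k) 0 - pR k 0) - (qL (Suc k) 0 - qL k 0)"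
    using h_two_phase_eq[of "L (Suc k) 0" "R (Suc k) 0"] h_two_phase_eq[of "L k 0" "R k 0"]
    by (simp add: Hn_def right_diff_distrib)
  then have "\<bar>(a + b) * (Hn (Suc k) - Hn k)\<bar> \<le> dp k + dq k" by linarith
  then have "dH k * (a + b) \<le> dp k + dq k" using ab by (simp add: abs_mult mult.commute)
  then show ?thesis using ab by (simp only: pos_le_divide_eq)
qed

text \<open>\<open>GH\<close> and \<open>GE\<close> bound the variation over all steps of
  \<open>Hn\<close> and of \<open>emit\<close>; \<open>GT\<close> bounds the variation of the stack
  \<open>qR\<close> at any one step.\<close>

definition GH :: real where "GH = 2 * v / (a + b)"
definition GE :: real where "GE = v + 2 * b * C * GH"
definition GT :: real where "GT = 2 * KR * \<epsilon> + v + GE"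

lemma sum_dH: "(\<Sum>k<n. dH k) \<le> GH"
proof -
  have "(\<Sum>k<n. dH k) \<le> (\<Sum>k<n. (dp k + dq k) / (a + b))" by (intro sum_mono dH_le)
  also have "\<dots> = ((\<Sum>k<n. dp k) + (\<Sum>k<n. dq k)) / (a + b)"
    by (simp add: sum_divide_distrib[symmetric] sum.distrib)
  also have "\<dots> \<le> (v + v) / (a + b)"
    using sum_dp[of n] sum_dq[of n] speeds by (intro divide_right_mono) auto
  finally show ?thesis by (simp add: GH_def)
qed

lemma demit_le: "\<bar>emit (Suc k) - emit k\<bar> \<le> dp k + 2 * b * C * dH k"
proof -
  have "\<bar>Wx (Hn (Suc k)) - Wx (Hn k)\<bar> \<le> C * dH k"
    using modulus near_H(2)[OF near_all] by (simp add: boundary_modulus_def)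
  then have "2 * b * \<bar>Wx (Hn (Suc k)) - Wx (Hn k)\<bar> \<le> 2 * b * (C * dH k)"
    using speeds by (intro mult_left_mono) auto
  moreover have "emit (Suc k) - emit k = (pR (Suc k) 0 - pR k 0) - 2 * b * (Wx (Hn (Suc k)) - Wx (Hn k))"
    by (simp add: emit_def algebra_simps)
  moreover have "\<bar>2 * b * (Wx (Hn (Suc k)) - Wx (Hn k))\<bar> = 2 * b * \<bar>Wx (Hn (Suc k)) - Wx (Hn k)\<bar>"
    using speeds by (simp add: abs_mult)
  moreover have "2 * b * (C * dH k) = 2 * b * C * dH k" by simp
  ultimately show ?thesis by linarith
qed

lemma sum_demit: "(\<Sum>k<n. \<bar>emit (Suc k) - emit k\<bar>) \<le> GE"
proof -
  have "(\<Sum>k<n. \<bar>emit (Suc k) - emit k\<bar>) \<le> (\<Sum>k<n. dp k + 2 * b * C * dH k)"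
    by (intro sum_mono demit_le)
  also have "\<dots> = (\<Sum>k<n. dp k) + 2 * b * C * (\<Sum>k<n. dH k)"
    by (simp add: sum.distrib sum_distrib_left)
  also have "\<dots> \<le> v + 2 * b * C * GH"
    using sum_dp sum_dH C_nonneg speeds by (intro add_mono mult_left_mono) auto
  finally show ?thesis by (simp add: GE_def)
qed

text \<open>The invariants \<open>qR n\<close> to the right of the boundary behave like a stack: they are emitted
  only while \<open>Hn n > 0\<close> and absorbed, in reverse order, only while \<open>Hn n \<le> 0\<close>.\<close>

lemma stack_potential:
  "\<bar>qR (Suc n) 0 - emit (Suc n)\<bar> + seq_var (qR (Suc n))
     \<le> \<bar>qR n 0 - emit n\<bar> + seq_var (qR n) + \<bar>emit (Suc n) - emit n\<bar>"
proof -
  have "\<bar>qR (Suc n) 0 - emit n\<bar> + seq_var (qR (Suc n)) \<le> \<bar>qR n 0 - emit n\<bar> + seq_var (qR n)"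
  proof (cases "0 < Hn n")
    case True
    have "stay_or_push (emit n) (qR n) (qR (Suc n))"
      using invariants_Suc(4)[OF regular_all True] emit_eq[OF near_all True] by simp
    then consider "qR (Suc n) = qR n" | "qR (Suc n) = case_nat (emit n) (qR n)"
      by (auto simp: stay_or_push_def)
    then show ?thesis
    proof cases
      case 1 then show ?thesis by (metis order_refl)
    next
      case 2
      then have "qR (Suc n) 0 = emit n" by (metis nat.case(1))
      then show ?thesis using seq_var_push(2)[OF has_var(3), of "emit n" n] 2 by simp
    qed
  next
    case False
    then have "stay_or_pop (qR n) (qR (Suc n))" using invariants_Suc(5)[OF regular_all] by simp
    from stay_or_pop_var(2)[OF this has_var(3)] show ?thesis by linarith
  qed
  then show ?thesis by linarith
qed

text \<open>The potential is the variation of the stack with \<open>emit n\<close> placed on top.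
  Pushing or popping does not increase it, so only the variation of \<open>emit\<close> is added.
  Initially the top contributes at most \<open>2 * KR * \<epsilon>\<close>, both values being near
  the reference.\<close>

lemma seq_var_qR_le: "seq_var (qR n) \<le> GT"
proof -
  have "(\<Sum>k<n. 0) + (\<bar>qR n 0 - emit n\<bar> + seq_var (qR n))
      \<le> (\<bar>qR 0 0 - emit 0\<bar> + seq_var (qR 0)) + (\<Sum>k<n. \<bar>emit (Suc k) - emit k\<bar>)"
    using stack_potential by (intro sum_le_potential[where d = "\<lambda>_. 0"]) simp
  moreover have "\<bar>qR 0 0 - emit 0\<bar> \<le> 2 * KR * \<epsilon>"
  proof -
    have "\<bar>qR 0 0 - qinv b ur\<bar> \<le> KR * \<epsilon>" using near_all[of 0] by (simp add: near_def)
    then show ?thesis using emit_close[OF near_all, of 0] by linarith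
  qed
  ultimately show ?thesis using sum_demit[of n] init_var by (simp add: GT_def)
qed

lemma GT_nonneg: "0 \<le> GT"
  using seq_var_qR_le[of 0] seq_var_nonneg[OF has_var(3), of 0] by linarith

abbreviation "Hm k \<equiv> max 0 (- Hn k)"
abbreviation "dx k \<equiv> \<bar>qR (Suc k) 0 - qR k 0\<bar>"

lemma Hm_le: "Hm n \<le> \<bar>Hs\<bar> + \<eta>"
  using near_H(2)[OF near_all, of n] C_nonneg by linarith

text \<open>The weight \<open>Hm\<close> vanishes while the stack grows, so the weighted variation
  \<open>Hm n * seq_var (qR n)\<close> increases only through a change of \<open>Hn\<close>, at a
  cost of at most \<open>GT\<close> per unit. Popping while \<open>Hn n \<le> 0\<close> spends
  it.\<close>

lemma sum_absorbed: "(\<Sum>k<n. Hm k * dx k) \<le> (\<bar>Hs\<bar> + \<eta>) * GT + GT * GH"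
proof -
  define Y where "Y n = Hm n * seq_var (qR n)" for n
  have step: "Hm k * dx k + Y (Suc k) \<le> Y k + GT * dH k" for k
  proof -
    have "Hm k * dx k = Hm k * (seq_var (qR k) - seq_var (qR (Suc k)))"
    proof (cases "0 < Hn k")
      case False
      then have "stay_or_pop (qR k) (qR (Suc k))" using invariants_Suc(5)[OF regular_all] by simp
      from stay_or_pop_var(2)[OF this has_var(3)] show ?thesis by (metis add_diff_cancel_right')
    qed simp
    then have "Hm k * dx k + Y (Suc k) = Y k + (Hm (Suc k) - Hm k) * seq_var (qR (Suc k))"
      by (simp add: Y_def algebra_simps)
    also have "\<dots> \<le> Y k + dH k * GT"
      using seq_var_qR_le[of "Suc k"] seq_var_nonneg[OF has_var(3), of "Suc k"]
      by (intro add_left_mono mult_mono) auto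
    finally show ?thesis by (simp add: mult.commute)
  qed
  have "(\<Sum>k<n. Hm k * dx k) + Y n \<le> Y 0 + (\<Sum>k<n. GT * dH k)"
    using step by (rule sum_le_potential)
  moreover have "0 \<le> Y n" using seq_var_nonneg[OF has_var(3)] by (simp add: Y_def)
  moreover have "Y 0 \<le> (\<bar>Hs\<bar> + \<eta>) * GT"
    unfolding Y_def using Hm_le[of 0] seq_var_qR_le[of 0] seq_var_nonneg[OF has_var(3)] C_nonneg
    by (intro mult_mono) auto
  moreover have "(\<Sum>k<n. GT * dH k) \<le> GT * GH"
    unfolding sum_distrib_left[symmetric] using sum_dH GT_nonneg by (intro mult_left_mono) auto
  ultimately show ?thesis by linarith
qed

text \<open>The change of the right strain splits into a part from \<open>pR\<close>, with total at
  most \<open>v\<close>, and a part from \<open>qR\<close>, for which the sum weighted with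
  \<open>Hm\<close> is available.\<close>

lemma speed_variation: "(\<Sum>k<n. \<bar>speed (Suc k) - speed k\<bar>) \<le> variation_bound C (\<bar>Hs\<bar> + \<eta>) \<epsilon> v"
proof -
  have step: "\<bar>speed (Suc k) - speed k\<bar>
     \<le> C * dH k + C / (2 * b) * ((\<bar>Hs\<bar> + \<eta>) * dp k + Hm k * dx k)" for k
  proof -
    have "\<bar>speed k - speed (Suc k)\<bar>
        \<le> C * \<bar>Hn k - Hn (Suc k)\<bar> + C * (Hm k * \<bar>snd (R k 0) - snd (R (Suc k) 0)\<bar>)"
      unfolding speed_def using modulus near_H(2)[OF near_all] near_w(2)[OF near_all]
      unfolding boundary_modulus_def by blast
    moreover have "Hm k * \<bar>snd (R k 0) - snd (R (Suc k) 0)\<bar>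
        \<le> ((\<bar>Hs\<bar> + \<eta>) * dp k + Hm k * dx k) / (2 * b)"
    proof -
      have "\<bar>snd (R k 0) - snd (R (Suc k) 0)\<bar> \<le> (dx k + dp k) / (2 * b)"
        using speeds by (intro snd_close) (auto simp: abs_minus_commute)
      then have "Hm k * \<bar>snd (R k 0) - snd (R (Suc k) 0)\<bar> \<le> Hm k * ((dx k + dp k) / (2 * b))"
        by (intro mult_left_mono) auto
      also have "\<dots> = (Hm k * dp k + Hm k * dx k) / (2 * b)" by (simp add: algebra_simps)
      also have "\<dots> \<le> ((\<bar>Hs\<bar> + \<eta>) * dp k + Hm k * dx k) / (2 * b)"
        using Hm_le[of k] speeds by (intro divide_right_mono add_right_mono mult_right_mono) auto
      finally show ?thesis .
    qed
    then have "C * (Hm k * \<bar>snd (R k 0) - snd (R (Suc k) 0)\<bar>)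
        \<le> C * (((\<bar>Hs\<bar> + \<eta>) * dp k + Hm k * dx k) / (2 * b))"
      using C_nonneg by (intro mult_left_mono) auto
    ultimately show ?thesis by (simp add: abs_minus_commute)
  qed
  have "(\<Sum>k<n. \<bar>speed (Suc k) - speed k\<bar>)
      \<le> (\<Sum>k<n. C * dH k + C / (2 * b) * ((\<bar>Hs\<bar> + \<eta>) * dp k + Hm k * dx k))"
    by (intro sum_mono step)
  also have "\<dots> = C * (\<Sum>k<n. dH k)
      + C / (2 * b) * ((\<bar>Hs\<bar> + \<eta>) * (\<Sum>k<n. dp k) + (\<Sum>k<n. Hm k * dx k))"
    by (simp only: sum.distrib sum_distrib_left[symmetric])
  also have "\<dots> \<le> C * GH + C / (2 * b) * ((\<bar>Hs\<bar> + \<eta>) * v + ((\<bar>Hs\<bar> + \<eta>) * GT + GT * GH))"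
    using sum_dH sum_dp sum_absorbed C_nonneg speeds by (intro add_mono mult_left_mono) auto
  finally show ?thesis
    unfolding GT_def GE_def GH_def by (simp add: variation_bound_def Let_def add.assoc)
qed

end

section \<open>Cell averages of functions of bounded variation\<close>

text \<open>A partition of the part up to \<open>x\<close> is prolonged by the points
  \<open>x\<close> and \<open>y\<close>.\<close>

lemma variation_append:
  fixes g :: "real \<Rightarrow> 'a::metric_space"
  assumes "x \<in> S" "y \<in> S" "x \<le> y"
  shows "pointwise_variation (S \<inter> {..x}) g + ennreal (dist (g x) (g y)) \<le> pointwise_variation (S \<inter> {..y}) g"
proof -
  define I where "I = {xs. sorted xs \<and> set xs \<subseteq> S \<inter> {..x}}"
  define f where "f xs = (\<Sum>i<length xs - 1. ennreal (dist (g (xs ! i)) (g (xs ! Suc i))))" for xs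
  have "[] \<in> I" by (simp add: I_def)
  then have "(SUP xs\<in>I. f xs) + ennreal (dist (g x) (g y)) = (SUP xs\<in>I. f xs + ennreal (dist (g x) (g y)))"
    by (intro ennreal_SUP_add_left[symmetric]) auto
  also have "\<dots> \<le> pointwise_variation (S \<inter> {..y}) g"
  proof (rule SUP_least)
    fix xs assume xs: "xs \<in> I"
    define ys where "ys = xs @ [x, y]"
    have ys: "sorted ys" "set ys \<subseteq> S \<inter> {..y}"
      using xs assms by (auto simp: I_def ys_def sorted_append)
    \<comment> \<open>The term that joins the last point of \<open>xs\<close> to \<open>x\<close> is
      left out of the sum; this also covers \<open>xs = []\<close>.\<close>
    have "f xs + ennreal (dist (g x) (g y))
        = (\<Sum>i\<in>insert (length xs) {..<length xs - 1}. ennreal (dist (g (ys ! i)) (g (ys ! Suc i))))"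
    proof -
      have "(\<Sum>i<length xs - 1. ennreal (dist (g (ys ! i)) (g (ys ! Suc i)))) = f xs"
        unfolding f_def by (rule sum.cong) (auto simp: ys_def nth_append)
      moreover have "ys ! length xs = x" "ys ! Suc (length xs) = y" by (auto simp: ys_def nth_append)
      ultimately show ?thesis by (subst sum.insert) (auto simp: add.commute)
    qed
    also have "\<dots> \<le> f ys"
      unfolding f_def by (intro sum_mono2) (auto simp: ys_def)
    also have "\<dots> \<le> pointwise_variation (S \<inter> {..y}) g"
      unfolding pointwise_variation_def f_def using ys by (intro SUP_upper) simp
    finally show "f xs + ennreal (dist (g x) (g y)) \<le> pointwise_variation (S \<inter> {..y}) g" .
  qed
  finally show ?thesis unfolding pointwise_variation_def I_def f_def .
qed

lemma pointwise_variation_mono: "S \<subseteq> T \<Longrightarrow> pointwise_variation S g \<le> pointwise_variation T g"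
  unfolding pointwise_variation_def by (intro SUP_subset_mono) auto

text \<open>The variation up to \<open>x\<close>, as a function of \<open>x\<close>, dominates every
  increment of \<open>g\<close>. It takes the place of partitions from here on.\<close>

lemma variation_function:
  fixes g :: "real \<Rightarrow> 'a::metric_space"
  assumes "pointwise_variation S g < ennreal \<delta>"
  shows "\<exists>v. mono v \<and> (\<forall>x. 0 \<le> v x \<and> v x \<le> \<delta>) \<and>
    (\<forall>x\<in>S. \<forall>y\<in>S. x \<le> y \<longrightarrow> dist (g x) (g y) \<le> v y - v x)"
proof -
  define v where "v x = enn2real (pointwise_variation (S \<inter> {..x}) g)" for x :: real
  have fin: "pointwise_variation (S \<inter> {..x}) g < ennreal \<delta>" for x
    using pointwise_variation_mono[of "S \<inter> {..x}" S g] assms by (simp add: le_less_trans)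
  have fin': "pointwise_variation (S \<inter> {..x}) g < top" for x
    using fin[of x] by (rule less_trans) simp
  have \<delta>: "0 \<le> \<delta>" using assms by (metis ennreal_neg linorder_le_cases not_less_zero)
  have eq: "ennreal (v x) = pointwise_variation (S \<inter> {..x}) g" for x
    using fin'[of x] by (simp add: v_def)
  have "mono v"
    unfolding v_def using fin' by (intro monoI enn2real_mono pointwise_variation_mono) auto
  moreover have "0 \<le> v x \<and> v x \<le> \<delta>" for x
    using fin[of x] \<delta> unfolding eq[symmetric] by (simp add: v_def ennreal_less_iff)
  moreover have "dist (g x) (g y) \<le> v y - v x" if "x \<in> S" "y \<in> S" "x \<le> y" for x y
  proof -
    have "ennreal (v x) + ennreal (dist (g x) (g y)) \<le> ennreal (v y)"
      unfolding eq using variation_append[OF that] .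
    then have "v x + dist (g x) (g y) \<le> v y"
      by (simp add: ennreal_plus[symmetric] v_def del: ennreal_plus)
    then show ?thesis by simp
  qed
  ultimately show ?thesis by blast
qed

text \<open>The pointwise bound on \<open>g\<close> comes from the infinite measure of
  \<open>S\<close>: the oscillation of \<open>g\<close> is at most \<delta>, so one value of norm
  above \<delta> would keep the norm away from 0 on all of \<open>S\<close>, against
  integrability.\<close>

lemma BV_norm_representative:
  fixes f :: "real \<Rightarrow> 'a::{real_normed_vector}"
  assumes bv: "BV_norm S f < ennreal \<delta>" and S: "S \<in> sets lebesgue" "emeasure lebesgue S = \<infinity>"
  shows "\<exists>g v. (AE x in lebesgue. x \<in> S \<longrightarrow> g x = f x) \<and> mono v \<and> (\<forall>x. 0 \<le> v x \<and> v x \<le> \<delta>) \<and>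
    (\<forall>x\<in>S. \<forall>y\<in>S. x \<le> y \<longrightarrow> dist (g x) (g y) \<le> v y - v x) \<and> (\<forall>x\<in>S. norm (g x) \<le> \<delta>)"
proof -
  have "TV S f < ennreal \<delta>" using bv unfolding BV_norm_def
    by (metis add.commute le_iff_add le_less_trans)
  then obtain g where g: "AE x in lebesgue. x \<in> S \<longrightarrow> g x = f x" "pointwise_variation S g < ennreal \<delta>"
    unfolding TV_def by (auto simp: INF_less_iff)
  obtain v where v: "mono v" "\<And>x. 0 \<le> v x \<and> v x \<le> \<delta>"
    "\<And>x y. x \<in> S \<Longrightarrow> y \<in> S \<Longrightarrow> x \<le> y \<Longrightarrow> dist (g x) (g y) \<le> v y - v x"
    using variation_function[OF g(2)] by blast
  have close: "dist (g x) (g y) \<le> \<delta>" if "x \<in> S" "y \<in> S" for x y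
    using v(3)[of x y] v(3)[of y x] v(2)[of x] v(2)[of y] that
    by (cases "x \<le> y") (auto simp: dist_commute)
  have "norm (g x) \<le> \<delta>" if x: "x \<in> S" for x
  proof (rule ccontr)
    assume "\<not> norm (g x) \<le> \<delta>"
    define \<kappa> where "\<kappa> = norm (g x) - \<delta>"
    have \<kappa>: "0 < \<kappa>" using \<open>\<not> norm (g x) \<le> \<delta>\<close> by (simp add: \<kappa>_def)
    have lower: "\<kappa> \<le> norm (g y)" if "y \<in> S" for y
      using close[OF x that] norm_triangle_ineq2[of "g x" "g y"] by (simp add: \<kappa>_def dist_norm)
    have "\<infinity> = ennreal \<kappa> * emeasure lebesgue S" using S(2) \<kappa> by (simp add: ennreal_mult_top)
    also have "\<dots> = (\<integral>\<^sup>+y. ennreal \<kappa> * indicator S y \<partial>lebesgue)"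
      using S(1) by (simp add: nn_integral_cmult_indicator)
    also have "\<dots> \<le> (\<integral>\<^sup>+y\<in>S. ennreal (norm (f y)) \<partial>lebesgue)"
    proof (rule nn_integral_mono_AE)
      show "AE y in lebesgue. ennreal \<kappa> * indicator S y \<le> ennreal (norm (f y)) * indicator S y"
        using g(1)
      proof eventually_elim
        fix y assume "y \<in> S \<longrightarrow> g y = f y"
        then show "ennreal \<kappa> * indicator S y \<le> ennreal (norm (f y)) * indicator S y"
          using lower[of y] by (cases "y \<in> S") (auto intro: ennreal_leI)
      qed
    qed
    also have "\<dots> \<le> BV_norm S f" by (simp add: BV_norm_def)
    finally have "(\<infinity> :: ennreal) < ennreal \<delta>" using bv by (rule le_less_trans)
    then show False by simp
  qed
  then show ?thesis using g(1) v by blast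
qed

lemma emeasure_halflines: "emeasure lebesgue {..<0::real} = \<infinity>" "emeasure lebesgue {0::real<..} = \<infinity>"
proof -
  have "ennreal (real n) \<le> emeasure lebesgue {..<0::real}" for n :: nat
  proof -
    have "ennreal (real n) = emeasure lebesgue {- real n..<0}" by simp
    also have "\<dots> \<le> emeasure lebesgue {..<0::real}" by (intro emeasure_mono) auto
    finally show ?thesis .
  qed
  then show "emeasure lebesgue {..<0::real} = \<infinity>"
    using ennreal_Ex_less_of_nat[of "emeasure lebesgue {..<0::real}"]
    by (metis ennreal_of_nat_eq_real_of_nat infinity_ennreal_def leD less_top)
  have "ennreal (real n) \<le> emeasure lebesgue {0::real<..}" for n :: nat
  proof -
    have "ennreal (real n) = emeasure lebesgue {0<..real n}" by simp
    also have "\<dots> \<le> emeasure lebesgue {0::real<..}" by (intro emeasure_mono) auto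
    finally show ?thesis .
  qed
  then show "emeasure lebesgue {0::real<..} = \<infinity>"
    using ennreal_Ex_less_of_nat[of "emeasure lebesgue {0::real<..}"]
    by (metis ennreal_of_nat_eq_real_of_nat infinity_ennreal_def leD less_top)
qed

definition average :: "(real \<Rightarrow> state) \<Rightarrow> real \<Rightarrow> real \<Rightarrow> state" where
  "average u p q = (1 / (q - p)) *\<^sub>R (LINT y:{p..<q}|lebesgue. u y)"

lemma set_integrable_const_Ico: "set_integrable lebesgue {p..<q::real} (\<lambda>_. k :: 'a::{banach, second_countable_topology})"
  unfolding set_integrable_def
  by (intro integrable_scaleR_left integrable_real_indicator; cases "p \<le> q") (auto simp: less_top[symmetric])

lemma set_integral_const_Ico:
  "p \<le> q \<Longrightarrow> (LINT y:{p..<q::real}|lebesgue. k :: 'a::{banach, second_countable_topology}) = (q - p) *\<^sub>R k"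
  unfolding set_lebesgue_integral_def
  by (subst integral_scaleR_left) (auto intro!: integrable_real_indicator simp: less_top[symmetric])

lemma average_near:
  assumes pq: "p < q" and int: "set_integrable lebesgue {p..<q} u"
    and near: "AE y in lebesgue. y \<in> {p..<q} \<longrightarrow> norm (u y - k) \<le> D"
  shows "norm (average u p q - k) \<le> D"
proof -
  have c: "set_integrable lebesgue {p..<q} (\<lambda>y. u y - k)"
    using int set_integrable_const_Ico by (rule set_integral_diff(1))
  have "(LINT y:{p..<q}|lebesgue. u y - k) = (LINT y:{p..<q}|lebesgue. u y) - (q - p) *\<^sub>R k"
    using set_integral_diff(2)[OF int set_integrable_const_Ico[of p q k]] pq
    by (simp add: set_integral_const_Ico)
  then have eq: "average u p q - k = (1 / (q - p)) *\<^sub>R (LINT y:{p..<q}|lebesgue. u y - k)"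
    using pq by (simp add: average_def scaleR_right_diff_distrib)
  have "norm (LINT y:{p..<q}|lebesgue. u y - k) \<le> (LINT y:{p..<q}|lebesgue. norm (u y - k))"
    using c by (rule set_integral_norm_bound)
  also have "\<dots> \<le> (LINT y:{p..<q}|lebesgue. D)"
    unfolding set_lebesgue_integral_def
  proof (rule integral_mono_AE)
    show "integrable lebesgue (\<lambda>x. indicat_real {p..<q} x *\<^sub>R norm (u x - k))"
      using set_integrable_norm[OF c] by (simp add: set_integrable_def)
    show "integrable lebesgue (\<lambda>x. indicat_real {p..<q} x *\<^sub>R D)"
      using set_integrable_const_Ico[of p q D] by (simp add: set_integrable_def)
    show "AE x in lebesgue. indicat_real {p..<q} x *\<^sub>R norm (u x - k) \<le> indicat_real {p..<q} x *\<^sub>R D"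
      using near by eventually_elim (auto simp: indicator_def)
  qed
  also have "\<dots> = (q - p) * D" using pq by (simp add: set_integral_const_Ico)
  finally have "norm (LINT y:{p..<q}|lebesgue. u y - k) / (q - p) \<le> D" using pq by (simp add: divide_le_eq mult.commute)
  then show ?thesis unfolding eq using pq by simp
qed

lemma snd_average:
  assumes "set_integrable lebesgue {p..<q} u"
  shows "snd (average u p q) = (1 / (q - p)) * (LINT y:{p..<q}|lebesgue. snd (u y))"
proof -
  have "snd (LINT y:{p..<q}|lebesgue. u y) = (LINT y:{p..<q}|lebesgue. snd (u y))"
    unfolding set_lebesgue_integral_def
    using integral_bounded_linear[OF bounded_linear_snd assms[unfolded set_integrable_def]] by simp
  then show ?thesis by (simp add: average_def)
qed

lemma snd_average_bounds:
  assumes pq: "p < q" and int: "set_integrable lebesgue {p..<q} u"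
  shows "(AE y in lebesgue. y \<in> {p..<q} \<longrightarrow> snd (u y) \<le> k) \<Longrightarrow> snd (average u p q) \<le> k"
    "(AE y in lebesgue. y \<in> {p..<q} \<longrightarrow> k \<le> snd (u y)) \<Longrightarrow> k \<le> snd (average u p q)"
proof -
  have s: "integrable lebesgue (\<lambda>x. indicat_real {p..<q} x *\<^sub>R snd (u x))"
    using integrable_bounded_linear[OF bounded_linear_snd int[unfolded set_integrable_def]] by simp
  have c: "integrable lebesgue (\<lambda>x. indicat_real {p..<q} x *\<^sub>R k)"
    using set_integrable_const_Ico[of p q k] by (simp add: set_integrable_def)
  have k: "(LINT y:{p..<q}|lebesgue. k) = (q - p) * k" using pq by (simp add: set_integral_const_Ico)
  show "snd (average u p q) \<le> k" if "AE y in lebesgue. y \<in> {p..<q} \<longrightarrow> snd (u y) \<le> k"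
  proof -
    have "(LINT y:{p..<q}|lebesgue. snd (u y)) \<le> (LINT y:{p..<q}|lebesgue. k)"
      unfolding set_lebesgue_integral_def
      by (rule integral_mono_AE[OF s c]) (use that in eventually_elim, auto simp: indicator_def)
    then show ?thesis unfolding snd_average[OF int] k using pq by (simp add: divide_le_eq mult.commute)
  qed
  show "k \<le> snd (average u p q)" if "AE y in lebesgue. y \<in> {p..<q} \<longrightarrow> k \<le> snd (u y)"
  proof -
    have "(LINT y:{p..<q}|lebesgue. k) \<le> (LINT y:{p..<q}|lebesgue. snd (u y))"
      unfolding set_lebesgue_integral_def
      by (rule integral_mono_AE[OF c s]) (use that in eventually_elim, auto simp: indicator_def)
    then show ?thesis unfolding snd_average[OF int] k using pq by (simp add: le_divide_eq mult.commute)
  qed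
qed

lemma AE_not_zero: "AE x in lebesgue. x \<noteq> (0::real)"
proof (rule AE_I')
  show "{0::real} \<in> null_sets lebesgue" by simp
qed auto

text \<open>\<open>S\<close> is one of the two half-lines; the cells of the mesh may contain the null set \<open>{0}\<close>.\<close>

lemma averages_of_BV:
  fixes u0 u :: "real \<Rightarrow> state"
  assumes bv: "BV_norm S (\<lambda>x. u x - k) < ennreal \<delta>"
    and S: "S \<in> sets lebesgue" "emeasure lebesgue S = \<infinity>" "0 \<notin> S"
    and meas: "u \<in> borel_measurable (lebesgue_on S)" and u0: "\<And>x. x \<in> S \<Longrightarrow> u0 x = u x"
  shows "\<exists>v. mono v \<and> (\<forall>x. 0 \<le> v x \<and> v x \<le> \<delta>) \<and>
    (\<forall>p q. p < q \<longrightarrow> {p..<q} \<subseteq> insert 0 S \<longrightarrow>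
       set_integrable lebesgue {p..<q} u0 \<and> norm (average u0 p q - k) \<le> \<delta>) \<and>
    (\<forall>p q r. p < q \<longrightarrow> q < r \<longrightarrow> {p..<r} \<subseteq> insert 0 S \<longrightarrow>
       norm (average u0 q r - average u0 p q) \<le> v r - v p)"
proof -
  obtain g v where g: "AE x in lebesgue. x \<in> S \<longrightarrow> g x = u x - k" and v: "mono v" "\<And>x. 0 \<le> v x \<and> v x \<le> \<delta>"
    and gv: "\<And>x y. x \<in> S \<Longrightarrow> y \<in> S \<Longrightarrow> x \<le> y \<Longrightarrow> dist (g x) (g y) \<le> v y - v x"
    and gn: "\<And>x. x \<in> S \<Longrightarrow> norm (g x) \<le> \<delta>"
    using BV_norm_representative[OF bv S(1,2)] by blast
  have int: "set_integrable lebesgue {p..<q} u0" if C: "{p..<q} \<subseteq> insert 0 S" for p q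
  proof -
    have "(\<lambda>x. u x - k) \<in> borel_measurable (lebesgue_on S)" using meas by simp
    then have m: "(\<lambda>x. indicat_real S x *\<^sub>R (u x - k)) \<in> borel_measurable lebesgue"
      using borel_measurable_restrict_space_iff[of S lebesgue "\<lambda>x. u x - k"] S(1) by simp
    have "(\<integral>\<^sup>+x. ennreal (norm (indicat_real S x *\<^sub>R (u x - k))) \<partial>lebesgue)
       = (\<integral>\<^sup>+x\<in>S. ennreal (norm (u x - k)) \<partial>lebesgue)"
      by (intro nn_integral_cong) (auto simp: indicator_def)
    also have "\<dots> \<le> BV_norm S (\<lambda>x. u x - k)" by (simp add: BV_norm_def)
    also have "\<dots> < \<infinity>" using bv by (rule less_trans) simp
    finally have 0: "integrable lebesgue (\<lambda>x. indicat_real S x *\<^sub>R (u x - k))" using m by (intro integrableI_bounded) auto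
    have 1: "integrable lebesgue (\<lambda>x. indicat_real {p..<q} x *\<^sub>R (indicat_real S x *\<^sub>R (u x - k)))"
      by (rule integrable_mult_indicator[OF _ 0]) simp
    have 2: "integrable lebesgue (\<lambda>x. indicat_real {p..<q} x *\<^sub>R k)"
      using set_integrable_const_Ico[of p q k] by (simp add: set_integrable_def)
    \<comment> \<open>\<open>u0\<close> is unconstrained at 0, which may belong to the cell.\<close>
    have 3: "integrable lebesgue (\<lambda>x. indicat_real ({p..<q} \<inter> {0}) x *\<^sub>R (u0 0 - k))"
    proof -
      have "{p..<q} \<inter> {0} = {0} \<or> {p..<q} \<inter> {0} = {}" by blast
      then have "{p..<q} \<inter> {0} \<in> null_sets lebesgue" by (elim disjE) simp_all
      then show ?thesis by (intro integrable_scaleR_left integrable_real_indicator) (auto dest: null_setsD1)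
    qed
    have "indicat_real {p..<q} x *\<^sub>R u0 x = indicat_real {p..<q} x *\<^sub>R (indicat_real S x *\<^sub>R (u x - k))
        + indicat_real {p..<q} x *\<^sub>R k + indicat_real ({p..<q} \<inter> {0}) x *\<^sub>R (u0 0 - k)" for x
      using C u0[of x] S(3) by (cases "x \<in> {p..<q}"; cases "x = 0") auto
    then show ?thesis
      unfolding set_integrable_def using Bochner_Integration.integrable_add[OF Bochner_Integration.integrable_add[OF 1 2] 3] by simp
  qed
  have good: "AE x in lebesgue. x \<in> insert 0 S \<longrightarrow> x \<in> S \<and> u0 x = g x + k"
    using g AE_not_zero by eventually_elim (use u0 in auto)
  have near: "norm (average u0 p q - k) \<le> \<delta>" if "p < q" "{p..<q} \<subseteq> insert 0 S" for p q
  proof (rule average_near[OF that(1) int[OF that(2)]])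
    show "AE y in lebesgue. y \<in> {p..<q} \<longrightarrow> norm (u0 y - k) \<le> \<delta>"
      using good by eventually_elim (use that(2) gn in auto)
  qed
  have diff: "norm (average u0 q r - average u0 p q) \<le> v r - v p"
    if pqr: "p < q" "q < r" "{p..<r} \<subseteq> insert 0 S" for p q r
  proof -
    have "{p..<q} \<subseteq> {p..<r}" "{q..<r} \<subseteq> {p..<r}" using pqr by auto
    then have sub: "{p..<q} \<subseteq> insert 0 S" "{q..<r} \<subseteq> insert 0 S" using pqr(3) by blast+
    \<comment> \<open>The average over the right cell is first compared with the value at a fixed
      \<open>y\<close> in the left cell; averaging over \<open>y\<close> then gives the
      claim.\<close>
    have inner: "norm (average u0 q r - (g y + k)) \<le> v r - v p" if y: "y \<in> S" "y \<in> {p..<q}" for y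
    proof (rule average_near[OF pqr(2) int[OF sub(2)]])
      show "AE x in lebesgue. x \<in> {q..<r} \<longrightarrow> norm (u0 x - (g y + k)) \<le> v r - v p"
        using good
      proof eventually_elim
        fix x assume x: "x \<in> insert 0 S \<longrightarrow> x \<in> S \<and> u0 x = g x + k"
        show "x \<in> {q..<r} \<longrightarrow> norm (u0 x - (g y + k)) \<le> v r - v p"
        proof
          assume xr: "x \<in> {q..<r}"
          then have "x \<in> S" "u0 x = g x + k" using x sub by auto
          then have "norm (u0 x - (g y + k)) \<le> v x - v y"
            using gv[of y x] y xr by (simp add: dist_norm norm_minus_commute)
          also have "\<dots> \<le> v r - v p" using monoD[OF v(1), of x r] monoD[OF v(1), of p y] xr y by auto
          finally show "norm (u0 x - (g y + k)) \<le> v r - v p" .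
        qed
      qed
    qed
    have "norm (average u0 p q - average u0 q r) \<le> v r - v p"
    proof (rule average_near[OF pqr(1) int[OF sub(1)]])
      show "AE y in lebesgue. y \<in> {p..<q} \<longrightarrow> norm (u0 y - average u0 q r) \<le> v r - v p"
        using good
      proof eventually_elim
        fix y assume y: "y \<in> insert 0 S \<longrightarrow> y \<in> S \<and> u0 y = g y + k"
        show "y \<in> {p..<q} \<longrightarrow> norm (u0 y - average u0 q r) \<le> v r - v p"
          using y inner[of y] sub(1) by (auto simp: norm_minus_commute)
      qed
    qed
    then show ?thesis by (simp add: norm_minus_commute)
  qed
  show ?thesis using v int near diff by blast
qed

section \<open>The position of the approximate phase boundary\<close>

lemma right_deriv_affine:
  assumes "t < u" "\<And>s. t \<le> s \<Longrightarrow> s < u \<Longrightarrow> f s = c + V * s"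
  shows "right_deriv f t = V"
proof -
  have "((\<lambda>s. c + V * s) has_vector_derivative V) (at t within {t..})"
    by (auto intro!: derivative_eq_intros)
  then have "(f has_vector_derivative V) (at t within {t..})"
    by (rule has_vector_derivative_transform_within[where d = "u - t"])
      (use assms in \<open>auto simp: dist_real_def\<close>)
  then have "(f has_vector_derivative V) (at_right t)" by (simp add: at_within_Ici_at_right)
  then show ?thesis unfolding right_deriv_def by (intro vector_derivative_within) auto
qed

lemma seq_var_leI:
  assumes "\<And>N. (\<Sum>i<N. \<bar>X (Suc i) - X i\<bar>) \<le> B"
  shows "has_seq_var X" "seq_var X \<le> B"
proof -
  show s: "has_seq_var X"
    unfolding has_seq_var_def using assms by (intro summableI_nonneg_bounded) auto
  show "seq_var X \<le> B"
    using s assms unfolding seq_var_def has_seq_var_def by (intro suminf_le_const) auto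
qed

text \<open>Two neighbouring averages are compared through the increment of the variation function
  over both cells, so consecutive estimates overlap. This is the origin of the factor 2 in the bound
  for the variation.\<close>

lemma telescope_two:
  fixes f :: "nat \<Rightarrow> real"
  shows "(\<Sum>i<N. f (Suc (Suc i)) - f i) = f (Suc N) + f N - f 1 - f 0"
  by (induction N) auto

lemma component_diff: "\<bar>fst u - fst k\<bar> \<le> norm (u - k)" "\<bar>snd u - snd k\<bar> \<le> norm (u - k)" for u k :: state
  using norm_fst_le[of "fst u - fst k" "snd u - snd k"] norm_snd_le[of "snd u - snd k" "fst u - fst k"]
  by (simp_all add: minus_prod_def)

lemma invariant_diff:
  assumes "0 \<le> c"
  shows "\<bar>qinv c u - qinv c k\<bar> \<le> (1 + c) * norm (u - k)" "\<bar>pinv c u - pinv c k\<bar> \<le> (1 + c) * norm (u - k)"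
proof -
  note f = component_diff[of u k]
  have m: "\<bar>c * (snd u - snd k)\<bar> \<le> c * norm (u - k)"
    using f assms by (simp add: abs_mult mult_left_mono)
  have "qinv c u - qinv c k = (fst u - fst k) - c * (snd u - snd k)"
    "pinv c u - pinv c k = (fst u - fst k) + c * (snd u - snd k)"
    by (auto simp: qinv_def pinv_def algebra_simps)
  then show "\<bar>qinv c u - qinv c k\<bar> \<le> (1 + c) * norm (u - k)" "\<bar>pinv c u - pinv c k\<bar> \<le> (1 + c) * norm (u - k)"
    using f m by (auto simp: algebra_simps)
qed

context glimm_run
begin

text \<open>By parity, a fan not centered at the boundary has both its states on one side of
  it.\<close>

lemma cell_states:
  assumes "even (m + int n)"
  shows "m < pos n \<Longrightarrow> \<exists>i. U n (m - 2) = L n (Suc i) \<and> U n m = L n i"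
    "pos n < m \<Longrightarrow> \<exists>i. U n (m - 2) = R n i \<and> U n m = R n (Suc i)"
proof -
  have ev: "even (pos n - m)" using assms pos_even[of n] by presburger
  then obtain d where d: "pos n - m = 2 * d" by (rule evenE)
  show "\<exists>i. U n (m - 2) = L n (Suc i) \<and> U n m = L n i" if "m < pos n"
  proof (intro exI conjI)
    have "m = pos n - 2 - 2 * int (nat (d - 1))" "m - 2 = pos n - 2 - 2 * int (Suc (nat (d - 1)))" using d that by auto
    then show "U n (m - 2) = L n (Suc (nat (d - 1)))" "U n m = L n (nat (d - 1))" by (auto simp: L_def)
  qed
  show "\<exists>i. U n (m - 2) = R n i \<and> U n m = R n (Suc i)" if "pos n < m"
  proof (intro exI conjI)
    have "m = pos n + 2 * int (Suc (nat (- d - 1)))" "m - 2 = pos n + 2 * int (nat (- d - 1))" using d that by auto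
    then show "U n (m - 2) = R n (nat (- d - 1))" "U n m = R n (Suc (nat (- d - 1)))" by (auto simp: R_def)
  qed
qed

text \<open>Only the fan centered at \<open>pos n\<close> contains both phases, and
  \<open>\<tau> * a < h\<close> keeps the boundary inside it until the next sampling. Disjointness
  of the phases makes the point unique.\<close>

lemma phase_boundary_eq:
  assumes U: "U = glimm_state M \<tau> h A u0" and reg: "\<And>n. regular n"
    and pos_h: "0 < \<tau>" "0 < h" "\<tau> * a < h" and t: "0 \<le> t" "n = nat \<lfloor>t / \<tau>\<rfloor>"
  shows "phase_boundary M (glimm M \<tau> h A u0) t = of_int (pos n) * h + speed n * (t - real n * \<tau>)"
proof -
  define s where "s = t - real n * \<tau>"
  define X where "X = of_int (pos n) * h + speed n * s"
  define m where "m y = 2 * \<lfloor>(y / h + 1 - real n) / 2\<rfloor> + int n" for y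
  have "0 \<le> t / \<tau>" using t pos_h by simp
  then have "real n \<le> t / \<tau>" "t / \<tau> < real n + 1" using t by linarith+
  then have s: "0 \<le> s" "s < \<tau>" using pos_h by (auto simp: s_def pos_le_divide_eq pos_divide_less_eq algebra_simps)
  have sp: "- b < speed n" "speed n < a" using regular_speed[OF reg] by auto
  have "\<bar>speed n * s\<bar> \<le> a * \<tau>"
    unfolding abs_mult using sp s speeds by (intro mult_mono) auto
  then have small: "- h < speed n * s" "speed n * s < h" using pos_h by (auto simp: abs_le_iff mult.commute)
  have even: "even (m y + int n)" for y by (simp add: m_def)
  \<comment> \<open>The rounding in \<open>glimm\<close> selects the fan whose interval of length
    \<open>2 * h\<close> contains \<open>y\<close>.\<close>
  have my: "(of_int (m y) - 1) * h \<le> y" "y < (of_int (m y) + 1) * h" for y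
  proof -
    define z where "z = y / h"
    define w where "w = (z + 1 - real n) / 2"
    have "of_int (m y) = 2 * real_of_int \<lfloor>w\<rfloor> + real n" by (simp add: m_def z_def w_def)
    moreover have "z = 2 * w + real n - 1" unfolding w_def by (simp add: field_simps)
    moreover have "of_int \<lfloor>w\<rfloor> \<le> w" "w < of_int \<lfloor>w\<rfloor> + 1" by auto
    ultimately have "of_int (m y) - 1 \<le> z" "z < of_int (m y) + 1" by argo+
    then show "(of_int (m y) - 1) * h \<le> y" "y < (of_int (m y) + 1) * h"
      using pos_h by (auto simp: z_def pos_le_divide_eq pos_divide_less_eq)
  qed
  have val: "glimm M \<tau> h A u0 t y = (if s = 0 then (if y < of_int (m y) * h then U n (m y - 2) else U n (m y))
       else riemann M (U n (m y - 2)) (U n (m y)) ((y - of_int (m y) * h) / s))" for y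
    unfolding glimm_def Let_def U t(2)[symmetric] m_def s_def by simp
  have LR: "L n i \<in> H1 M" "R n i \<in> H3 M" for i using reg[of n] by (auto simp: regular_def)
  have inH1: "glimm M \<tau> h A u0 t y \<in> H1 M" if "m y < pos n" for y
    using cell_states(1)[OF even that] LR fan_phases[OF reg] unfolding val by auto
  have inH3: "glimm M \<tau> h A u0 t y \<in> H3 M" if "pos n < m y" for y
    using cell_states(2)[OF even that] LR fan_phases[OF reg] unfolding val by auto
  have at: "U n (pos n - 2) = L n 0" "U n (pos n) = R n 0" by (auto simp: L_def R_def)
  have left: "glimm M \<tau> h A u0 t y \<in> H1 M" if y: "y < X" for y
  proof -
    have "\<not> pos n < m y"
    proof
      assume "pos n < m y"
      \<comment> \<open>Centers at one time level are two mesh widths apart, so \<open>y\<close>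
        would be at least \<open>(pos n + 1) * h\<close>, which the boundary does not reach.\<close>
      moreover have "even (m y - pos n)" using even[of y] pos_even[of n] by presburger
      ultimately have "pos n + 2 \<le> m y" by presburger
      then have "of_int (pos n) + 1 \<le> (of_int (m y) - 1 :: real)" by linarith
      then have "(of_int (pos n) + 1) * h \<le> (of_int (m y) - 1) * h" using pos_h by (intro mult_right_mono) auto
      then show False using my(1)[of y] y small by (simp add: X_def algebra_simps)
    qed
    moreover have "glimm M \<tau> h A u0 t y \<in> H1 M" if e: "m y = pos n"
    proof (cases "s = 0")
      case True
      then show ?thesis unfolding val e at using y LR by (simp add: X_def)
    next
      case False
      have "(y - of_int (pos n) * h) / s \<le> speed n"
        using y False s by (simp add: X_def pos_divide_le_eq)
      then show ?thesis unfolding val e at using False fan_phases(3)[OF reg] by simp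
    qed
    ultimately show ?thesis using inH1[of y] by linarith
  qed
  have right: "glimm M \<tau> h A u0 t y \<in> H3 M" if y: "X < y" for y
  proof -
    have "\<not> m y < pos n"
    proof
      assume "m y < pos n"
      moreover have "even (m y - pos n)" using even[of y] pos_even[of n] by presburger
      ultimately have "m y \<le> pos n - 2" by presburger
      then have "of_int (m y) + 1 \<le> (of_int (pos n) - 1 :: real)" by linarith
      then have "(of_int (m y) + 1) * h \<le> (of_int (pos n) - 1) * h" using pos_h by (intro mult_right_mono) auto
      then show False using my(2)[of y] y small by (simp add: X_def algebra_simps)
    qed
    moreover have "glimm M \<tau> h A u0 t y \<in> H3 M" if e: "m y = pos n"
    proof (cases "s = 0")
      case True
      then show ?thesis unfolding val e at using y LR by (simp add: X_def)
    next
      case False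
      have "\<not> (y - of_int (pos n) * h) / s \<le> speed n"
        using y False s by (simp add: X_def pos_divide_le_eq)
      then show ?thesis unfolding val e at using False fan_phases(4)[OF reg] by simp
    qed
    ultimately show ?thesis using inH3[of y] by linarith
  qed
  have "phase_boundary M (glimm M \<tau> h A u0) t = X"
    unfolding phase_boundary_def
  proof (rule the_equality)
    show "(\<forall>y<X. glimm M \<tau> h A u0 t y \<in> H1 M) \<and> (\<forall>y>X. glimm M \<tau> h A u0 t y \<in> H3 M)"
      using left right by blast
    fix x assume x: "(\<forall>y<x. glimm M \<tau> h A u0 t y \<in> H1 M) \<and> (\<forall>y>x. glimm M \<tau> h A u0 t y \<in> H3 M)"
    show "x = X"
    proof (rule ccontr)
      assume "x \<noteq> X"
      then consider y where "x < y" "y < X" | y where "X < y" "y < x" by (meson dense linorder_neqE)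
      then show False using x left right H1_H3_disjoint by cases metis+
    qed
  qed
  then show ?thesis by (simp add: X_def s_def)
qed

end

section \<open>From the initial data to a run near the reference states\<close>

context admissible_material
begin

text \<open>Apart from the alternatives that hold outright, each condition follows from one of the
  form \<open>k * \<delta> < p\<close> with \<open>p > 0\<close>, which holds for all small
  \<delta>.\<close>

lemma admissible_delta_exists:
  assumes "ul \<in> H1 M" "ur \<in> H3 M" "0 < \<eta>"
  shows "\<exists>\<delta>>0. 2 * ((1 + a) * \<delta>) / (a + b) \<le> \<eta> \<and> strain_gain K C * ((1 + a) * \<delta>) < 1 + snd ul \<and>
    (1 + left_gain K C) * ((1 + a) * \<delta>) / (2 * a) < 1 + snd ul \<and> \<delta> < 1 + snd ul \<and>
    (snd ul = wM M \<or> snd ul + (1 + left_gain K C) * ((1 + a) * \<delta>) / (2 * a) \<le> wM M) \<and>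
    (snd ur = wm M \<or> wm M \<le> snd ur - (1 + right_gain C) * ((1 + a) * \<delta>) / (2 * b))"
proof -
  have ev: "\<forall>\<^sub>F \<delta> in at_right 0. k * \<delta> < p" if "0 < p" for k p :: real
  proof -
    have "((\<lambda>\<delta>. k * \<delta>) \<longlongrightarrow> k * 0) (at_right 0)" by (intro tendsto_intros)
    then show ?thesis using order_tendstoD(2)[of _ "k * 0" _ p] that by simp
  qed
  have wl: "0 < 1 + snd ul" and wl': "snd ul \<le> wM M" and wr: "wm M \<le> snd ur"
    using assms by (auto simp: H1_def H3_def)
  \<comment> \<open>Distance of the reference strain to the edge of its phase; on the edge itself
    the condition is void and 1 is a placeholder.\<close>
  define p1 where "p1 = (if snd ul = wM M then 1 else wM M - snd ul)"
  define p2 where "p2 = (if snd ur = wm M then 1 else snd ur - wm M)"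
  have p: "0 < p1" "0 < p2" using wl' wr by (auto simp: p1_def p2_def)
  have ev': "\<forall>\<^sub>F \<delta> in at_right 0. k * ((1 + a) * \<delta>) < p" "\<forall>\<^sub>F \<delta> in at_right 0. k * ((1 + a) * \<delta>) / x < p"
    if "0 < p" for k p x :: real
    using ev[OF that, of "k * (1 + a)"] ev[OF that, of "k * (1 + a) / x"] by (simp_all add: mult.assoc)
  have "\<forall>\<^sub>F \<delta> in at_right (0::real). 0 < \<delta> \<and> 2 * ((1 + a) * \<delta>) / (a + b) < \<eta> \<and>
     strain_gain K C * ((1 + a) * \<delta>) < 1 + snd ul \<and>
     (1 + left_gain K C) * ((1 + a) * \<delta>) / (2 * a) < 1 + snd ul \<and> 1 * \<delta> < 1 + snd ul \<and>
     (1 + left_gain K C) * ((1 + a) * \<delta>) / (2 * a) < p1 \<and>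
     (1 + right_gain C) * ((1 + a) * \<delta>) / (2 * b) < p2"
    by (intro eventually_conj ev ev' wl p assms eventually_at_right_less)
  from eventually_happens'[OF _ this] obtain \<delta> where d: "0 < \<delta>" "2 * ((1 + a) * \<delta>) / (a + b) < \<eta>"
     "strain_gain K C * ((1 + a) * \<delta>) < 1 + snd ul"
     "(1 + left_gain K C) * ((1 + a) * \<delta>) / (2 * a) < 1 + snd ul" "1 * \<delta> < 1 + snd ul"
     "(1 + left_gain K C) * ((1 + a) * \<delta>) / (2 * a) < p1"
     "(1 + right_gain C) * ((1 + a) * \<delta>) / (2 * b) < p2"
    using trivial_limit_at_right_real by blast
  have "snd ul = wM M \<or> snd ul + (1 + left_gain K C) * ((1 + a) * \<delta>) / (2 * a) \<le> wM M"
    using d(6) unfolding p1_def by (cases "snd ul = wM M") simp_all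
  moreover have "snd ur = wm M \<or> wm M \<le> snd ur - (1 + right_gain C) * ((1 + a) * \<delta>) / (2 * b)"
    using d(7) unfolding p2_def by (cases "snd ur = wm M") simp_all
  ultimately show ?thesis using d(1-5) by (intro exI[of _ \<delta>]) (simp only: less_imp_le mult_1)
qed

lemma glimm_boundary_run:
  fixes uL0 uR0 u0 :: "real \<Rightarrow> state"
  assumes ul: "ul \<in> H1 M" and ur: "ur \<in> H3 M" and ref: "lstrain (h_two_phase M ul ur) (snd ur) = snd ul"
    and bm: "boundary_modulus (h_two_phase M ul ur) (snd ur) \<eta> C Wx"
    and K: "0 \<le> K" "\<And>H w. \<bar>H - h_two_phase M ul ur\<bar> \<le> \<eta> \<Longrightarrow> wm M \<le> w \<Longrightarrow>
       \<bar>lstrain H w - snd ul\<bar> \<le> K * (\<bar>H - h_two_phase M ul ur\<bar> + \<bar>w - snd ur\<bar>)"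
    and \<delta>: "0 < \<delta>" "2 * ((1 + a) * \<delta>) / (a + b) \<le> \<eta>" "strain_gain K C * ((1 + a) * \<delta>) < 1 + snd ul"
      "(1 + left_gain K C) * ((1 + a) * \<delta>) / (2 * a) < 1 + snd ul" "\<delta> < 1 + snd ul"
      "snd ul = wM M \<or> snd ul + (1 + left_gain K C) * ((1 + a) * \<delta>) / (2 * a) \<le> wM M"
      "snd ur = wm M \<or> wm M \<le> snd ur - (1 + right_gain C) * ((1 + a) * \<delta>) / (2 * b)"
    and uL0: "uL0 \<in> BV_loc {..<0} (H1 M)" and uR0: "uR0 \<in> BV_loc {0<..} (H3 M)"
    and bv: "BV_norm {..<0} (\<lambda>x. uL0 x - ul) + BV_norm {0<..} (\<lambda>x. uR0 x - ur) < ennreal \<delta>"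
    and u0: "\<And>x. x < 0 \<Longrightarrow> u0 x = uL0 x" "\<And>x. 0 < x \<Longrightarrow> u0 x = uR0 x"
    and mesh: "0 < \<tau>" "0 < h" "\<tau> * a < h"
    and nL: "snd ul = wM M \<Longrightarrow> no_new_phase (H1 M) a (glimm_state M \<tau> h A u0)"
    and nR: "snd ur = wm M \<Longrightarrow> no_new_phase (H3 M) b (glimm_state M \<tau> h A u0)"
  shows "\<exists>p V. p 0 = (0::int) \<and> (\<forall>n. p (Suc n) = p n + (if A (Suc n) * h / \<tau> \<le> V n then 1 else - 1)) \<and>
    (\<forall>n. \<bar>V n\<bar> \<le> a) \<and>
    (\<forall>n. (\<Sum>k<n. \<bar>V (Suc k) - V k\<bar>)
       \<le> variation_bound C (\<bar>h_two_phase M ul ur\<bar> + \<eta>) ((1 + a) * \<delta>) (2 * ((1 + a) * \<delta>))) \<and>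
    (\<forall>t\<ge>0. \<forall>n. n = nat \<lfloor>t / \<tau>\<rfloor> \<longrightarrow>
       phase_boundary M (glimm M \<tau> h A u0) t = of_int (p n) * h + V n * (t - real n * \<tau>))"
proof -
  define U where "U = glimm_state M \<tau> h A u0"
  interpret run: glimm_run M U "\<lambda>n. A (Suc n) * h / \<tau>"
    by unfold_locales (simp add: U_def)
  have U0: "U 0 m = average u0 (of_int m * h) (of_int (m + 2) * h)" for m
    by (simp add: U_def average_def algebra_simps)
  \<comment> \<open>Cell edges listed outwards from 0 on either side, matching the order of the
    sequences \<open>L\<close> and \<open>R\<close>.\<close>
  define xL where "xL i = - 2 * real i * h" for i
  define xR where "xR i = 2 * real i * h" for i
  have L0: "run.L 0 i = average u0 (xL (Suc i)) (xL i)" for i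
  proof -
    have "run.L 0 i = U 0 (- 2 - 2 * int i)" by (simp add: run.L_def)
    moreover have "of_int (- 2 - 2 * int i) * h = xL (Suc i)" "of_int (- 2 - 2 * int i + 2) * h = xL i"
      by (simp_all add: xL_def algebra_simps)
    ultimately show ?thesis by (simp only: U0)
  qed
  have R0: "run.R 0 i = average u0 (xR i) (xR (Suc i))" for i
  proof -
    have "run.R 0 i = U 0 (2 * int i)" by (simp add: run.R_def)
    moreover have "of_int (2 * int i) * h = xR i" "of_int (2 * int i + 2) * h = xR (Suc i)"
      by (simp_all add: xR_def algebra_simps)
    ultimately show ?thesis by (simp only: U0)
  qed
  have lt: "xL (Suc i) < xL i" "xR i < xR (Suc i)" for i using mesh by (auto simp: xL_def xR_def algebra_simps)
  have le0: "xL i \<le> 0" "0 \<le> xR i" for i using mesh by (auto simp: xL_def xR_def)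
  have bvL: "BV_norm {..<0} (\<lambda>x. uL0 x - ul) < ennreal \<delta>" and bvR: "BV_norm {0<..} (\<lambda>x. uR0 x - ur) < ennreal \<delta>"
    using bv by (metis le_iff_add le_less_trans, metis add.commute le_iff_add le_less_trans)
  have mL: "uL0 \<in> borel_measurable (lebesgue_on {..<0})" "AE x in lebesgue. x \<in> {..<0} \<longrightarrow> uL0 x \<in> H1 M"
    using uL0 by (auto simp: BV_loc_def)
  have mR: "uR0 \<in> borel_measurable (lebesgue_on {0<..})" "AE x in lebesgue. x \<in> {0<..} \<longrightarrow> uR0 x \<in> H3 M"
    using uR0 by (auto simp: BV_loc_def)
  obtain vL where vL: "mono vL" "\<And>x. 0 \<le> vL x \<and> vL x \<le> \<delta>"
    "\<And>p q. p < q \<Longrightarrow> {p..<q} \<subseteq> insert 0 {..<0} \<Longrightarrow>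
       set_integrable lebesgue {p..<q} u0 \<and> norm (average u0 p q - ul) \<le> \<delta>"
    "\<And>p q r. p < q \<Longrightarrow> q < r \<Longrightarrow> {p..<r} \<subseteq> insert 0 {..<0} \<Longrightarrow>
       norm (average u0 q r - average u0 p q) \<le> vL r - vL p"
    using averages_of_BV[OF bvL _ emeasure_halflines(1) _ mL(1), of u0] u0 by auto
  obtain vR where vR: "mono vR" "\<And>x. 0 \<le> vR x \<and> vR x \<le> \<delta>"
    "\<And>p q. p < q \<Longrightarrow> {p..<q} \<subseteq> insert 0 {0<..} \<Longrightarrow>
       set_integrable lebesgue {p..<q} u0 \<and> norm (average u0 p q - ur) \<le> \<delta>"
    "\<And>p q r. p < q \<Longrightarrow> q < r \<Longrightarrow> {p..<r} \<subseteq> insert 0 {0<..} \<Longrightarrow>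
       norm (average u0 q r - average u0 p q) \<le> vR r - vR p"
    using averages_of_BV[OF bvR _ emeasure_halflines(2) _ mR(1), of u0] u0 by auto
  have subL: "{p..<q} \<subseteq> insert 0 {..<0}" if "q \<le> 0" for p q :: real using that by auto
  have subR: "{p..<q} \<subseteq> insert 0 {0<..}" if "0 \<le> p" for p q :: real using that by auto
  have nearL: "set_integrable lebesgue {xL (Suc i)..<xL i} u0" "norm (run.L 0 i - ul) \<le> \<delta>" for i
    using vL(3)[OF lt(1) subL[OF le0(1)]] by (auto simp: L0)
  have nearR: "set_integrable lebesgue {xR i..<xR (Suc i)} u0" "norm (run.R 0 i - ur) \<le> \<delta>" for i
    using vR(3)[OF lt(2) subR[OF le0(2)]] by (auto simp: R0)
  have diffL: "norm (run.L 0 (Suc i) - run.L 0 i) \<le> vL (xL i) - vL (xL (Suc (Suc i)))" for i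
    using vL(4)[OF lt(1)[of "Suc i"] lt(1)[of i] subL[OF le0(1)]] by (simp add: L0 norm_minus_commute)
  have diffR: "norm (run.R 0 (Suc i) - run.R 0 i) \<le> vR (xR (Suc (Suc i))) - vR (xR i)" for i
    using vR(4)[OF lt(2)[of i] lt(2)[of "Suc i"] subR[OF le0(2)]] by (simp add: R0)
  have LH1: "run.L 0 i \<in> H1 M" for i
  proof -
    have "AE y in lebesgue. y \<in> {xL (Suc i)..<xL i} \<longrightarrow> snd (u0 y) \<le> wM M"
      using mL(2) by eventually_elim (use u0(1) le0(1)[of i] in \<open>force simp: H1_def case_prod_beta\<close>)
    then have "snd (run.L 0 i) \<le> wM M" unfolding L0 by (rule snd_average_bounds(1)[OF lt(1) nearL(1)])
    moreover have "\<bar>snd (run.L 0 i) - snd ul\<bar> \<le> \<delta>"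
      using nearL(2)[of i] component_diff(2)[of "run.L 0 i" ul] by linarith
    ultimately show ?thesis using \<delta>(5) by (auto simp: H1_def case_prod_beta)
  qed
  have RH3: "run.R 0 i \<in> H3 M" for i
  proof -
    have "AE y in lebesgue. y \<in> {xR i..<xR (Suc i)} \<longrightarrow> wm M \<le> snd (u0 y)"
      using mR(2) AE_not_zero by eventually_elim (use u0(2) le0(2)[of i] in \<open>force simp: H3_def case_prod_beta\<close>)
    then have "wm M \<le> snd (run.R 0 i)" unfolding R0 by (rule snd_average_bounds(2)[OF lt(2) nearR(1)])
    then show ?thesis by (auto simp: H3_def case_prod_beta)
  qed
  have ca: "(1 + c) * x \<le> (1 + a) * y" if "c \<le> a" "0 \<le> x" "x \<le> y" for c x y
    using that speeds by (intro mult_mono) auto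
  have sumL: "(\<Sum>i<N. norm (run.L 0 (Suc i) - run.L 0 i)) \<le> 2 * \<delta>" for N
  proof -
    have "(\<Sum>i<N. norm (run.L 0 (Suc i) - run.L 0 i)) \<le> (\<Sum>i<N. - (vL (xL (Suc (Suc i))) - vL (xL i)))"
      using diffL by (intro sum_mono) simp
    also have "\<dots> = - (\<Sum>i<N. vL (xL (Suc (Suc i))) - vL (xL i))" by (rule sum_negf)
    also have "\<dots> \<le> 2 * \<delta>"
      using telescope_two[of "\<lambda>i. vL (xL i)" N] vL(2)[of "xL (Suc N)"] vL(2)[of "xL N"] vL(2)[of "xL 1"] vL(2)[of "xL 0"]
      by linarith
    finally show ?thesis .
  qed
  have sumR: "(\<Sum>i<N. norm (run.R 0 (Suc i) - run.R 0 i)) \<le> 2 * \<delta>" for N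
  proof -
    have "(\<Sum>i<N. norm (run.R 0 (Suc i) - run.R 0 i)) \<le> (\<Sum>i<N. vR (xR (Suc (Suc i))) - vR (xR i))"
      using diffR by (intro sum_mono)
    also have "\<dots> \<le> 2 * \<delta>"
      using telescope_two[of "\<lambda>i. vR (xR i)" N] vR(2)[of "xR (Suc N)"] vR(2)[of "xR N"] vR(2)[of "xR 1"] vR(2)[of "xR 0"]
      by linarith
    finally show ?thesis .
  qed
  have var: "has_seq_var X \<and> seq_var X \<le> 2 * ((1 + a) * \<delta>)"
    if "\<And>i. \<bar>X (Suc i) - X i\<bar> \<le> (1 + c) * d i" "\<And>N. (\<Sum>i<N. d i) \<le> 2 * \<delta>" "0 \<le> c" "c \<le> a" for X d c
  proof -
    have "(\<Sum>i<N. \<bar>X (Suc i) - X i\<bar>) \<le> 2 * ((1 + a) * \<delta>)" for N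
    proof -
      have "(\<Sum>i<N. \<bar>X (Suc i) - X i\<bar>) \<le> (\<Sum>i<N. (1 + c) * d i)" by (intro sum_mono that(1))
      also have "\<dots> = (1 + c) * (\<Sum>i<N. d i)" by (simp add: sum_distrib_left)
      also have "\<dots> \<le> (1 + c) * (2 * \<delta>)" using that by (intro mult_left_mono) auto
      also have "\<dots> \<le> (1 + a) * (2 * \<delta>)" using that \<delta>(1) by (intro mult_right_mono) auto
      finally show ?thesis by simp
    qed
    then show ?thesis using seq_var_leI by blast
  qed
  have close: "\<bar>x - y\<bar> \<le> (1 + a) * \<delta>" if "\<bar>x - y\<bar> \<le> (1 + c) * norm (u - k)" "norm (u - k) \<le> \<delta>" "c \<le> a"
    for x y c and u k :: state
    using that ca[of c "norm (u - k)" \<delta>] by simp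
  note ab = less_imp_le[OF speeds(2)] less_imp_le[OF speeds(1)] less_imp_le[OF speeds(3)]
  \<comment> \<open>The factor \<open>1 + a\<close> is a Lipschitz constant of all four invariants
    as functions of the state; the 2 in the variation comes from the overlapping pairs of
    cells.\<close>
  interpret near: glimm_run_near M U "\<lambda>n. A (Suc n) * h / \<tau>" ul ur \<eta> C Wx "(1 + a) * \<delta>" K "2 * ((1 + a) * \<delta>)"
  proof (unfold_locales, goal_cases)
    case 5 then show ?case using K(2) by blast
  next
    case 15 then show ?case by (rule LH1)
  next
    case 16 then show ?case by (rule RH3)
  next
    case (17 i) show ?case by (rule close[OF invariant_diff(1)[OF ab(3)] nearL(2) order_refl])
  next
    case (18 i) show ?case by (rule close[OF invariant_diff(2)[OF ab(3)] nearL(2) order_refl])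
  next
    case (19 i) show ?case by (rule close[OF invariant_diff(1)[OF ab(2)] nearR(2) ab(1)])
  next
    case (20 i) show ?case by (rule close[OF invariant_diff(2)[OF ab(2)] nearR(2) ab(1)])
  next
    case 21 show ?case using var[OF invariant_diff(1)[OF ab(3)] sumL ab(3) order_refl] by blast
  next
    case 22 show ?case using var[OF invariant_diff(1)[OF ab(3)] sumL ab(3) order_refl] by blast
  next
    case 23 show ?case using var[OF invariant_diff(2)[OF ab(2)] sumR ab(2) ab(1)] by blast
  next
    case 24 show ?case using var[OF invariant_diff(2)[OF ab(2)] sumR ab(2) ab(1)] by blast
  next
    case 25 show ?case using var[OF invariant_diff(1)[OF ab(2)] sumR ab(2) ab(1)] by blast
  next
    case 26 show ?case using var[OF invariant_diff(1)[OF ab(2)] sumR ab(2) ab(1)] by blast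
  qed (use assms speeds U_def in auto)
  have "\<bar>run.speed n\<bar> \<le> a" for n
    using run.regular_speed(1,2)[OF near.regular_all, of n] speeds by linarith
  then show ?thesis
    using run.pos_Suc near.speed_variation run.phase_boundary_eq[OF U_def near.regular_all mesh]
    by (intro exI[of _ run.pos] exI[of _ run.speed]) auto
qed

end

section \<open>Sampling by an equidistributed sequence\<close>

text \<open>Let \<alpha> be the boundary speed in mesh widths per time step. In one step the
  boundary jumps one mesh width to the right or left instead of moving by \<alpha>; this is the
  error, and its mean is 0 for a sample uniformly distributed in \<open>]-1, 1[\<close>.\<close>

definition bias :: "(nat \<Rightarrow> real) \<Rightarrow> nat \<Rightarrow> real \<Rightarrow> real" where
  "bias A k \<alpha> = (if A (Suc k) \<le> \<alpha> then 1 else - 1) - \<alpha>"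

lemma sum_bias_eq:
  "(\<Sum>k<n. bias A k \<alpha>) = 2 * real (card {k \<in> {1..n}. A k \<le> \<alpha>}) - real n * (1 + \<alpha>)"
proof (induction n)
  case (Suc n)
  have "{k \<in> {1..Suc n}. A k \<le> \<alpha>}
     = (if A (Suc n) \<le> \<alpha> then insert (Suc n) {k \<in> {1..n}. A k \<le> \<alpha>} else {k \<in> {1..n}. A k \<le> \<alpha>})"
    by (auto simp: le_Suc_eq)
  then have "card {k \<in> {1..Suc n}. A k \<le> \<alpha>}
     = card {k \<in> {1..n}. A k \<le> \<alpha>} + (if A (Suc n) \<le> \<alpha> then 1 else 0)" by simp
  then show ?case using Suc by (simp add: bias_def algebra_simps)
qed simp

text \<open>Equidistribution is a statement for each \<alpha> separately. The counting function and
  its limit are both monotone in \<alpha>, so closeness at finitely many grid points gives closeness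
  for all \<alpha> at once.\<close>

lemma discrepancy_grid:
  assumes "equidistributed A" "0 < e"
  shows "\<exists>N1\<ge>1. \<forall>n\<ge>N1. \<forall>\<alpha>\<in>{-1..1}. \<bar>\<Sum>k<n. bias A k \<alpha>\<bar> \<le> e * real n"
proof -
  \<comment> \<open>The grid spacing \<open>2 / G\<close> is then at most \<open>e / 2\<close>; the
    other half of \<open>e\<close> is spent on the error at the grid points.\<close>
  obtain G :: nat where G: "4 / e < real G" using reals_Archimedean2 by blast
  have G0: "0 < real G" using G assms(2) by (smt (verit) divide_pos_pos)
  have Ge: "2 / real G \<le> e / 2" using G G0 assms(2) by (simp add: field_simps)
  define g where "g i = - 1 + 2 * real i / real G" for i
  define Q where "Q n \<alpha> = real (card {k \<in> {1..n}. A k \<in> {- 1<..<\<alpha>}})" for n \<alpha>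
  have g: "- 1 \<le> g i" "i \<le> G \<Longrightarrow> g i \<le> 1" for i using G0 by (auto simp: g_def divide_le_eq)
  have Ain: "- 1 < A k" "A k < 1" if "1 \<le> k" for k using assms(1) that by (auto simp: equidistributed_def)
  have lim: "(\<lambda>n. Q n (g i) / real n) \<longlonglongrightarrow> (g i + 1) / 2" if "i \<le> G" for i
  proof -
    have "- 1 \<le> (- 1 :: real) \<and> - 1 \<le> g i \<and> g i \<le> 1" using g(1)[of i] g(2)[OF that] by simp
    then have "(\<lambda>n. real (card {k \<in> {1..n}. A k \<in> {- 1<..<g i}}) / real n) \<longlonglongrightarrow> (g i - - 1) / 2"
      using assms(1) unfolding equidistributed_def by blast
    then show ?thesis by (simp add: Q_def)
  qed
  have "\<forall>\<^sub>F n in sequentially. \<forall>i\<in>{..G}. \<bar>Q n (g i) / real n - (g i + 1) / 2\<bar> < e / 4"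
  proof (rule eventually_ball_finite)
    show "\<forall>i\<in>{..G}. \<forall>\<^sub>F n in sequentially. \<bar>Q n (g i) / real n - (g i + 1) / 2\<bar> < e / 4"
    proof
      fix i assume "i \<in> {..G}"
      then have "\<forall>\<^sub>F n in sequentially. dist (Q n (g i) / real n) ((g i + 1) / 2) < e / 4"
        using assms(2) by (intro tendstoD lim) auto
      then show "\<forall>\<^sub>F n in sequentially. \<bar>Q n (g i) / real n - (g i + 1) / 2\<bar> < e / 4"
        by (simp only: dist_real_def)
    qed
  qed simp
  then obtain N where N: "\<And>n i. N \<le> n \<Longrightarrow> i \<le> G \<Longrightarrow> \<bar>Q n (g i) / real n - (g i + 1) / 2\<bar> < e / 4"
    by (auto simp: eventually_sequentially)
  have N': "\<bar>2 * Q n (g i) - real n * (g i + 1)\<bar> \<le> e / 2 * real n" if "N \<le> n" "1 \<le> n" "i \<le> G" for n i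
  proof -
    have n: "0 < real n" using that by simp
    have "2 * Q n (g i) - real n * (g i + 1) = (Q n (g i) / real n - (g i + 1) / 2) * (2 * real n)"
      using n by (simp add: field_simps)
    then have "\<bar>2 * Q n (g i) - real n * (g i + 1)\<bar> = \<bar>Q n (g i) / real n - (g i + 1) / 2\<bar> * (2 * real n)"
      by (simp add: abs_mult)
    also have "\<dots> \<le> e / 4 * (2 * real n)" using N[OF that(1,3)] by (intro mult_right_mono) auto
    finally show ?thesis by simp
  qed
  have "\<bar>\<Sum>k<n. bias A k \<alpha>\<bar> \<le> e * real n" if n: "N \<le> n" "1 \<le> n" and \<alpha>: "\<alpha> \<in> {-1..1}" for n \<alpha>
  proof -
    define c where "c = real (card {k \<in> {1..n}. A k \<le> \<alpha>})"
    have eq: "(\<Sum>k<n. bias A k \<alpha>) = 2 * c - real n * (1 + \<alpha>)" by (simp add: sum_bias_eq c_def)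
    show ?thesis
    proof (cases "\<alpha> = 1")
      \<comment> \<open>No grid point lies above 1, but all samples are below 1, so the count is
        \<open>n\<close> and the error is 0.\<close>
      case True
      have "{k \<in> {1..n}. A k \<le> \<alpha>} = {1..n}" using True Ain(2) by (auto intro: less_imp_le)
      then have "c = real n" by (simp add: c_def)
      then show ?thesis using eq True assms(2) by simp
    next
      case False
      define i where "i = nat \<lfloor>(\<alpha> + 1) * real G / 2\<rfloor>"
      have y: "0 \<le> (\<alpha> + 1) * real G / 2" using \<alpha> G0 by simp
      have "(\<alpha> + 1) * real G / 2 < real G" using \<alpha> False G0 by simp
      then have iG: "i < G" unfolding i_def using y by linarith
      have i1: "real i \<le> (\<alpha> + 1) * real G / 2" "(\<alpha> + 1) * real G / 2 < real i + 1"
        unfolding i_def using y by linarith+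
      then have gi: "g i \<le> \<alpha>" "\<alpha> < g (Suc i)" using G0 by (auto simp: g_def field_simps)
      have gd: "g (Suc i) - g i \<le> e / 2" using Ge by (simp add: g_def add_divide_distrib)
      have "Q n (g i) \<le> c" unfolding Q_def c_def using gi by (intro of_nat_mono card_mono) auto
      moreover have "c \<le> Q n (g (Suc i))"
        unfolding Q_def c_def using gi Ain(1) by (intro of_nat_mono card_mono) auto
      moreover have "real n * (g (Suc i) + 1) - real n * (1 + \<alpha>) \<le> e / 2 * real n"
        "real n * (1 + \<alpha>) - real n * (g i + 1) \<le> e / 2 * real n"
        using mult_left_mono[of "g (Suc i) - \<alpha>" "e / 2" "real n"] mult_left_mono[of "\<alpha> - g i" "e / 2" "real n"]
          gd gi by (auto simp: algebra_simps)
      moreover note N'[OF n less_imp_le[OF iG]] N'[OF n Suc_leI[OF iG]]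
      moreover have "\<bar>2 * c - z\<bar> \<le> 2 * w"
        if "q \<le> c" "c \<le> q'" "y - z \<le> w" "z - x \<le> w" "\<bar>2 * q - x\<bar> \<le> w" "\<bar>2 * q' - y\<bar> \<le> w"
        for q q' x y z w :: real
        using that by linarith
      ultimately have "\<bar>2 * c - real n * (1 + \<alpha>)\<bar> \<le> 2 * (e / 2 * real n)" by blast
      then show ?thesis unfolding eq by simp
    qed
  qed
  then show ?thesis by (intro exI[of _ "max N 1"]) auto
qed

lemma bias_bound: "\<alpha> \<in> {-1..1} \<Longrightarrow> \<bar>bias A k \<alpha>\<bar> \<le> 2"
  by (auto simp: bias_def)

text \<open>For the finitely many small \<open>n\<close> the trivial bound \<open>2 * n\<close> is
  absorbed by taking \<open>N\<close> large, which gives uniformity in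
  \<open>n \<le> N\<close>.\<close>

lemma discrepancy:
  assumes "equidistributed A" "0 < e"
  shows "\<exists>N0. \<forall>N\<ge>N0. \<forall>n\<le>N. \<forall>\<alpha>\<in>{-1..1}. \<bar>\<Sum>k<n. bias A k \<alpha>\<bar> \<le> e * real N"
proof -
  obtain N1 where N1: "\<And>n \<alpha>. N1 \<le> n \<Longrightarrow> \<alpha> \<in> {-1..1} \<Longrightarrow> \<bar>\<Sum>k<n. bias A k \<alpha>\<bar> \<le> e * real n"
    using discrepancy_grid[OF assms] by blast
  obtain N0 :: nat where N0: "2 * real N1 / e < real N0" using reals_Archimedean2 by blast
  have "\<bar>\<Sum>k<n. bias A k \<alpha>\<bar> \<le> e * real N" if "N0 \<le> N" "n \<le> N" "\<alpha> \<in> {-1..1}" for N n \<alpha>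
  proof (cases "N1 \<le> n")
    case True
    have "e * real n \<le> e * real N" using that assms(2) by simp
    then show ?thesis using N1[OF True that(3)] by linarith
  next
    case False
    have "\<bar>\<Sum>k<n. bias A k \<alpha>\<bar> \<le> (\<Sum>k<n. \<bar>bias A k \<alpha>\<bar>)" by (rule sum_abs)
    also have "\<dots> \<le> (\<Sum>k<n. 2)" using bias_bound that by (intro sum_mono) blast
    also have "\<dots> \<le> 2 * real N1" using False by simp
    also have "\<dots> \<le> e * real N0" using N0 assms(2) by (simp add: pos_divide_less_eq mult.commute)
    also have "\<dots> \<le> e * real N" using that assms(2) by simp
    finally show ?thesis .
  qed
  then show ?thesis by blast
qed

section \<open>Sampling with a moving threshold\<close>

lemma oscillation_le_variation:
  fixes \<theta> :: "nat \<Rightarrow> real"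
  assumes "s \<le> k" "k < t"
  shows "\<bar>\<theta> k - \<theta> s\<bar> \<le> (\<Sum>i\<in>{s..<t}. \<bar>\<theta> (Suc i) - \<theta> i\<bar>)"
proof -
  have "\<theta> k - \<theta> s = (\<Sum>i\<in>{s..<k}. \<theta> (Suc i) - \<theta> i)" using assms by (simp add: sum_Suc_diff')
  then have "\<bar>\<theta> k - \<theta> s\<bar> \<le> (\<Sum>i\<in>{s..<k}. \<bar>\<theta> (Suc i) - \<theta> i\<bar>)" by (metis sum_abs)
  also have "\<dots> \<le> (\<Sum>i\<in>{s..<t}. \<bar>\<theta> (Suc i) - \<theta> i\<bar>)" using assms by (intro sum_mono2) auto
  finally show ?thesis .
qed

text \<open>Within a block the threshold is enclosed between two constants. The jump part of
  \<open>bias\<close> is monotone in \<alpha>, so passing to a constant costs at most twice the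
  variation of \<theta> per step; \<open>2 * e\<close> arises because a block is a difference of two
  initial segments.\<close>

lemma bias_block:
  assumes E: "\<And>n \<alpha>. n \<le> N \<Longrightarrow> \<alpha> \<in> {-1..1} \<Longrightarrow> \<bar>\<Sum>k<n. bias A k \<alpha>\<bar> \<le> e"
    and \<theta>: "\<And>k. \<theta> k \<in> {-1..1}" and st: "s \<le> t" "t \<le> N"
  shows "\<bar>\<Sum>k\<in>{s..<t}. bias A k (\<theta> k)\<bar>
    \<le> 2 * e + 2 * real (t - s) * (\<Sum>i\<in>{s..<t}. \<bar>\<theta> (Suc i) - \<theta> i\<bar>)"
proof -
  define D where "D = (\<Sum>i\<in>{s..<t}. \<bar>\<theta> (Suc i) - \<theta> i\<bar>)"
  have D: "0 \<le> D" unfolding D_def by (rule sum_nonneg) simp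
  have osc: "\<bar>\<theta> k - \<theta> s\<bar> \<le> D" if "k \<in> {s..<t}" for k
    using oscillation_le_variation[of s k t \<theta>] that by (simp add: D_def)
  have B: "\<bar>\<Sum>k\<in>{s..<t}. bias A k \<alpha>\<bar> \<le> 2 * e" if "\<alpha> \<in> {-1..1}" for \<alpha>
  proof -
    have "(\<Sum>k\<in>{s..<t}. bias A k \<alpha>) = (\<Sum>k<t. bias A k \<alpha>) - (\<Sum>k<s. bias A k \<alpha>)"
      using sum_diff_nat_ivl[of 0 s t "\<lambda>k. bias A k \<alpha>"] st by (simp add: lessThan_atLeast0)
    then show ?thesis using E[of t \<alpha>] E[of s \<alpha>] st that by simp
  qed
  have const: "(\<Sum>k\<in>{s..<t}. 2 * D) = 2 * real (t - s) * D" by simp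
  define \<beta> where "\<beta> = min 1 (\<theta> s + D)"
  define \<alpha> where "\<alpha> = max (- 1) (\<theta> s - D)"
  have r: "\<alpha> \<in> {-1..1}" "\<beta> \<in> {-1..1}" using \<theta>[of s] D by (auto simp: \<alpha>_def \<beta>_def)
  have u: "bias A k (\<theta> k) \<le> bias A k \<beta> + 2 * D" "bias A k \<alpha> - 2 * D \<le> bias A k (\<theta> k)"
    if "k \<in> {s..<t}" for k
    using osc[OF that] \<theta>[of k] by (auto simp: bias_def \<alpha>_def \<beta>_def)
  have "(\<Sum>k\<in>{s..<t}. bias A k (\<theta> k)) \<le> (\<Sum>k\<in>{s..<t}. bias A k \<beta> + 2 * D)"
    by (intro sum_mono u)
  then have "(\<Sum>k\<in>{s..<t}. bias A k (\<theta> k)) \<le> 2 * e + 2 * real (t - s) * D"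
    unfolding sum.distrib const using B[OF r(2)] by linarith
  moreover have "(\<Sum>k\<in>{s..<t}. bias A k \<alpha> - 2 * D) \<le> (\<Sum>k\<in>{s..<t}. bias A k (\<theta> k))"
    by (intro sum_mono u)
  then have "- (2 * e + 2 * real (t - s) * D) \<le> (\<Sum>k\<in>{s..<t}. bias A k (\<theta> k))"
    unfolding sum_subtractf const using B[OF r(1)] by linarith
  ultimately show ?thesis by (simp add: D_def abs_le_iff)
qed

text \<open>The steps are cut into \<open>P\<close> blocks: many blocks make the oscillation of
  \<theta> cheap, and for fixed \<open>P\<close> the discrepancies at their ends are negligible for
  large \<open>N\<close>. The order of quantifiers matters: \<open>N0\<close> must serve all
  sequences \<theta> of variation at most \<open>C\<close>.\<close>

lemma equidistributed_walk:
  assumes eq: "equidistributed A" and C: "0 \<le> C" and \<epsilon>: "0 < \<epsilon>"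
  shows "\<exists>N0. \<forall>N\<ge>N0. \<forall>\<theta>. (\<forall>k. \<theta> k \<in> {-1..1}) \<longrightarrow> (\<forall>n. (\<Sum>k<n. \<bar>\<theta> (Suc k) - \<theta> k\<bar>) \<le> C) \<longrightarrow>
    (\<forall>n\<le>N. \<bar>\<Sum>k<n. bias A k (\<theta> k)\<bar> \<le> \<epsilon> * real N)"
proof -
  \<comment> \<open>Three contributions of \<open>\<epsilon> / 3\<close> are aimed at: the variation
    inside the blocks (\<open>P\<close>), the discrepancies at their ends (\<open>e\<close>) and the
    rounding of the block length (\<open>N2\<close>).\<close>
  obtain P :: nat where P: "6 * C / \<epsilon> + 1 < real P" using reals_Archimedean2 by blast
  have P0: "0 < real P" using P C \<epsilon> by (smt (verit) divide_nonneg_pos)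
  have PC: "2 * C / real P \<le> \<epsilon> / 3"
  proof -
    have "6 * C / \<epsilon> \<le> real P" using P by simp
    then have "6 * C \<le> real P * \<epsilon>" using \<epsilon> by (simp add: pos_divide_le_eq)
    then show ?thesis using P0 by (simp add: field_simps)
  qed
  define e where "e = \<epsilon> / (6 * real P)"
  have e: "0 < e" using \<epsilon> P0 by (simp add: e_def)
  obtain N1 where N1: "\<And>N n \<alpha>. N1 \<le> N \<Longrightarrow> n \<le> N \<Longrightarrow> \<alpha> \<in> {-1..1} \<Longrightarrow> \<bar>\<Sum>k<n. bias A k \<alpha>\<bar> \<le> e * real N"
    using discrepancy[OF eq e] by blast
  obtain N2 :: nat where N2: "6 * C / \<epsilon> < real N2" using reals_Archimedean2 by blast
  have bound: "\<bar>\<Sum>k<n. bias A k (\<theta> k)\<bar> \<le> \<epsilon> * real N"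
    if N: "max N1 N2 \<le> N" and \<theta>: "\<forall>k. \<theta> k \<in> {-1..1}"
      and var: "\<forall>n. (\<Sum>k<n. \<bar>\<theta> (Suc k) - \<theta> k\<bar>) \<le> C" and n: "n \<le> N" for N \<theta> n
  proof -
    \<comment> \<open>Block length, rounded up so that \<open>P\<close> blocks cover all
      \<open>N\<close> steps.\<close>
    define B where "B = N div P + 1"
    define Va where "Va n = (\<Sum>k<n. \<bar>\<theta> (Suc k) - \<theta> k\<bar>)" for n
    have Va: "0 \<le> Va n" "Va n \<le> C" for n using var by (auto simp: Va_def sum_nonneg)
    have blocks: "\<bar>\<Sum>k<m. bias A k (\<theta> k)\<bar> \<le> real j * (2 * (e * real N)) + 2 * real B * Va m"
      if "m \<le> j * B" "m \<le> N" for j m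
      using that
    proof (induction j arbitrary: m)
      case (Suc j)
      show ?case
      proof (cases "m \<le> j * B")
        case True
        have "0 \<le> 2 * (e * real N)" using e by simp
        then show ?thesis using Suc.IH[OF True Suc.prems(2)] by (simp add: distrib_right)
      next
        case False
        define s where "s = j * B"
        have s: "s \<le> m" "s \<le> N" "m - s \<le> B" using False Suc.prems by (auto simp: s_def)
        have "\<bar>\<Sum>k\<in>{s..<m}. bias A k (\<theta> k)\<bar>
          \<le> 2 * (e * real N) + 2 * real (m - s) * (\<Sum>i\<in>{s..<m}. \<bar>\<theta> (Suc i) - \<theta> i\<bar>)"
          using N1[of N] N \<theta> Suc.prems s by (intro bias_block[where N = N]) auto
        also have "\<dots> \<le> 2 * (e * real N) + 2 * real B * (\<Sum>i\<in>{s..<m}. \<bar>\<theta> (Suc i) - \<theta> i\<bar>)"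
          using s by (intro add_left_mono mult_right_mono sum_nonneg) auto
        finally have blk: "\<bar>\<Sum>k\<in>{s..<m}. bias A k (\<theta> k)\<bar>
          \<le> 2 * (e * real N) + 2 * real B * (\<Sum>i\<in>{s..<m}. \<bar>\<theta> (Suc i) - \<theta> i\<bar>)" .
        have split: "(\<Sum>k<m. f k) = (\<Sum>k<s. f k) + (\<Sum>k\<in>{s..<m}. f k)" for f :: "nat \<Rightarrow> real"
          using sum.atLeastLessThan_concat[of 0 s m f] s by (simp add: lessThan_atLeast0)
        have "\<bar>\<Sum>k<s. bias A k (\<theta> k)\<bar> \<le> real j * (2 * (e * real N)) + 2 * real B * Va s"
          using s by (intro Suc.IH) (auto simp: s_def)
        with blk have "\<bar>\<Sum>k<m. bias A k (\<theta> k)\<bar> \<le> real j * (2 * (e * real N)) + 2 * real B * Va s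
            + (2 * (e * real N) + 2 * real B * (\<Sum>i\<in>{s..<m}. \<bar>\<theta> (Suc i) - \<theta> i\<bar>))"
          unfolding split[of "\<lambda>k. bias A k (\<theta> k)"] by linarith
        also have "\<dots> = real (Suc j) * (2 * (e * real N)) + 2 * real B * Va m"
          unfolding Va_def split[of "\<lambda>k. \<bar>\<theta> (Suc k) - \<theta> k\<bar>"] by (simp add: algebra_simps)
        finally show ?thesis .
      qed
    qed (simp add: Va_def)
    have "N = P * (N div P) + N mod P" "N mod P < P" using P0 by (auto simp: mult.commute)
    then have "N \<le> P * B" unfolding B_def distrib_left by linarith
    then have "\<bar>\<Sum>k<n. bias A k (\<theta> k)\<bar> \<le> real P * (2 * (e * real N)) + 2 * real B * Va n"
      using n by (intro blocks) auto
    also have "\<dots> \<le> real P * (2 * (e * real N)) + 2 * (real N / real P + 1) * C"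
    proof -
      have "real (N div P) \<le> real N / real P" by (rule of_nat_div_le_of_nat)
      then have "real B \<le> real N / real P + 1" by (simp add: B_def)
      then show ?thesis using Va[of n] C by (intro add_left_mono mult_mono) auto
    qed
    also have "\<dots> = \<epsilon> / 3 * real N + (2 * C / real P) * real N + 2 * C"
    proof -
      have "real P * (2 * (e * real N)) = (real P * e) * (2 * real N)" by (simp only: mult_ac)
      also have "real P * e = \<epsilon> / 6" using P0 by (simp add: e_def)
      finally have "real P * (2 * (e * real N)) = \<epsilon> / 3 * real N" by simp
      then show ?thesis by (simp only:) (simp add: distrib_right)
    qed
    also have "\<dots> \<le> \<epsilon> / 3 * real N + \<epsilon> / 3 * real N + \<epsilon> / 3 * real N"
    proof -
      have "6 * C \<le> \<epsilon> * real N2" using N2 \<epsilon> by (simp add: pos_divide_less_eq mult.commute)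
      also have "\<dots> \<le> \<epsilon> * real N" using N \<epsilon> by simp
      finally show ?thesis using PC by (intro add_mono mult_right_mono) auto
    qed
    finally show ?thesis by simp
  qed
  show ?thesis
    by (intro exI[of _ "max N1 N2"] allI impI) (rule bound)
qed

section \<open>Compactness of the boundary speed\<close>

definition time_step :: "real \<Rightarrow> (nat \<Rightarrow> real) \<Rightarrow> real \<Rightarrow> real" where
  "time_step \<tau> V t = V (nat \<lfloor>t / \<tau>\<rfloor>)"

lemma time_step_right_continuous:
  assumes "0 < \<tau>"
  shows "continuous (at_right x) (time_step \<tau> V)"
proof -
  define n where "n = \<lfloor>x / \<tau>\<rfloor>"
  have "x / \<tau> < of_int n + 1" by (simp add: n_def)
  then have x: "x < (of_int n + 1) * \<tau>" using assms by (simp add: pos_divide_less_eq)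
  have "time_step \<tau> V y = time_step \<tau> V x" if "x < y" "y < (of_int n + 1) * \<tau>" for y
  proof -
    have "x / \<tau> \<le> y / \<tau>" using that assms by (simp add: divide_right_mono)
    then have "of_int n \<le> y / \<tau>" using of_int_floor_le[of "x / \<tau>"] unfolding n_def by linarith
    moreover have "y / \<tau> < of_int n + 1" using that assms by (simp add: pos_divide_less_eq)
    ultimately have "\<lfloor>y / \<tau>\<rfloor> = n" by (simp add: floor_unique)
    then show ?thesis by (simp add: time_step_def n_def)
  qed
  then have "\<forall>\<^sub>F y in at_right x. time_step \<tau> V y = time_step \<tau> V x"
    using x eventually_at_right_field by blast
  then show ?thesis by (simp add: continuous_within tendsto_eventually)
qed

lemma time_step_mono:
  assumes "0 < \<tau>" "mono V"
  shows "mono (time_step \<tau> V)"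
proof (rule monoI)
  fix x y :: real assume "x \<le> y"
  then have "x / \<tau> \<le> y / \<tau>" using assms by (simp add: divide_right_mono)
  then have "nat \<lfloor>x / \<tau>\<rfloor> \<le> nat \<lfloor>y / \<tau>\<rfloor>" by (intro nat_mono floor_mono)
  then show "time_step \<tau> V x \<le> time_step \<tau> V y" using assms by (simp add: time_step_def monoD)
qed

text \<open>Helly's theorem concerns monotone functions, so it is applied to the two parts of the
  Jordan decomposition, the second time along the first subsequence.\<close>

lemma helly_time_steps:
  fixes V :: "nat \<Rightarrow> nat \<Rightarrow> real"
  assumes \<tau>: "\<And>j. 0 < \<tau> j" and B: "\<And>j n. \<bar>V j n\<bar> \<le> B"
    and C: "\<And>j n. (\<Sum>k<n. \<bar>V j (Suc k) - V j k\<bar>) \<le> C"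
  shows "\<exists>r F G. strict_mono (r :: nat \<Rightarrow> nat) \<and> mono F \<and> mono G \<and>
    (\<forall>x. \<bar>F x\<bar> \<le> B + C \<and> \<bar>G x\<bar> \<le> B + C) \<and>
    (\<forall>x. isCont F x \<longrightarrow> isCont G x \<longrightarrow> (\<lambda>j. time_step (\<tau> (r j)) (V (r j)) x) \<longlonglongrightarrow> F x - G x)"
proof -
  define P where "P j n = V j 0 + (\<Sum>k<n. max 0 (V j (Suc k) - V j k))" for j n
  define N where "N j n = (\<Sum>k<n. max 0 (V j k - V j (Suc k)))" for j n
  have PN: "V j n = P j n - N j n" for j n
    by (induction n) (auto simp: P_def N_def)
  have Ps: "\<bar>\<Sum>k<n. max 0 (V j (Suc k) - V j k)\<bar> \<le> (\<Sum>k<n. \<bar>V j (Suc k) - V j k\<bar>)" for j n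
    by (rule order_trans[OF sum_abs sum_mono]) auto
  have Pb: "\<bar>P j n\<bar> \<le> B + C" for j n
    using Ps[where j = j and n = n] B[of j 0] C[of j n] unfolding P_def by linarith
  have Ns: "\<bar>N j n\<bar> \<le> (\<Sum>k<n. \<bar>V j (Suc k) - V j k\<bar>)" for j n
    unfolding N_def by (rule order_trans[OF sum_abs sum_mono]) auto
  have Nb: "\<bar>N j n\<bar> \<le> B + C" for j n
    using Ns[where j = j and n = n] B[of j 0] C[of j n] by linarith
  have mono: "mono (P j)" "mono (N j)" for j
    by (auto simp: P_def N_def intro!: monoI add_left_mono sum_mono2)
  obtain s1 F where s1: "strict_mono (s1 :: nat \<Rightarrow> nat)" "mono F" "\<And>x. \<bar>F x\<bar> \<le> B + C"
    "\<And>x. isCont F x \<Longrightarrow> (\<lambda>j. time_step (\<tau> (s1 j)) (P (s1 j)) x) \<longlonglongrightarrow> F x"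
    using Helly_selection[of "\<lambda>j. time_step (\<tau> j) (P j)" "B + C"]
      time_step_right_continuous[OF \<tau>] time_step_mono[OF \<tau> mono(1)] Pb by (auto simp: time_step_def)
  obtain s2 G where s2: "strict_mono (s2 :: nat \<Rightarrow> nat)" "mono G" "\<And>x. \<bar>G x\<bar> \<le> B + C"
    "\<And>x. isCont G x \<Longrightarrow> (\<lambda>j. time_step (\<tau> (s1 (s2 j))) (N (s1 (s2 j))) x) \<longlonglongrightarrow> G x"
    using Helly_selection[of "\<lambda>j. time_step (\<tau> (s1 j)) (N (s1 j))" "B + C"]
      time_step_right_continuous[OF \<tau>] time_step_mono[OF \<tau> mono(2)] Nb by (auto simp: time_step_def)
  have "(\<lambda>j. time_step (\<tau> (s1 (s2 j))) (V (s1 (s2 j))) x) \<longlonglongrightarrow> F x - G x"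
    if "isCont F x" "isCont G x" for x
  proof -
    have "(\<lambda>j. time_step (\<tau> (s1 (s2 j))) (P (s1 (s2 j))) x) \<longlonglongrightarrow> F x"
      using LIMSEQ_subseq_LIMSEQ[OF s1(4)[OF that(1)] s2(1)] by (simp add: comp_def)
    from tendsto_diff[OF this s2(4)[OF that(2)]] show ?thesis by (simp add: time_step_def PN)
  qed
  then show ?thesis
    using s1 s2 by (intro exI[of _ "s1 \<circ> s2"] exI[of _ F] exI[of _ G]) (auto simp: strict_mono_o)
qed

lemma time_step_has_integral:
  assumes \<tau>: "0 < \<tau>" and t: "0 \<le> t" "n = nat \<lfloor>t / \<tau>\<rfloor>"
  shows "(time_step \<tau> V has_integral (\<tau> * (\<Sum>k<n. V k) + V n * (t - real n * \<tau>))) {0..t}"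
proof -
  have piece: "(time_step \<tau> V has_integral (V m * (s - real m * \<tau>))) {real m * \<tau>..s}"
    if s: "real m * \<tau> \<le> s" "s \<le> real (Suc m) * \<tau>" for m s
  proof -
    have "((\<lambda>_. V m) has_integral (V m * (s - real m * \<tau>))) {real m * \<tau>..s}"
      using has_integral_const_real[of "V m" "real m * \<tau>" s] s by (simp add: mult.commute)
    \<comment> \<open>At \<open>x = s\<close> the next value may already be taken; one point does
      not affect the integral.\<close>
    moreover have "time_step \<tau> V x = V m" if x: "x \<in> {real m * \<tau>..s} - {s}" for x
    proof -
      have "real m * \<tau> \<le> x" "x < (real m + 1) * \<tau>" using x s by (auto simp: algebra_simps)
      then have "real m \<le> x / \<tau>" "x / \<tau> < real m + 1"
        using \<tau> by (auto simp: pos_le_divide_eq pos_divide_less_eq)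
      then have "\<lfloor>x / \<tau>\<rfloor> = int m" by (simp add: floor_unique)
      then show ?thesis by (simp add: time_step_def)
    qed
    ultimately show ?thesis
      using has_integral_spike_finite[of "{s}" "{real m * \<tau>..s}" "time_step \<tau> V" "\<lambda>_. V m"] by blast
  qed
  have main: "(time_step \<tau> V has_integral (\<tau> * (\<Sum>k<m. V k) + V m * (s - real m * \<tau>))) {0..s}"
    if "real m * \<tau> \<le> s" "s \<le> real (Suc m) * \<tau>" for m s
    using that
  proof (induction m arbitrary: s)
    case 0
    then show ?case using piece[of 0 s] by simp
  next
    case (Suc m)
    have mid: "0 \<le> real (Suc m) * \<tau>" using \<tau> by simp
    have "(time_step \<tau> V has_integral
       (\<tau> * (\<Sum>k<m. V k) + V m * (real (Suc m) * \<tau> - real m * \<tau>))) {0..real (Suc m) * \<tau>}"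
      using \<tau> by (intro Suc.IH) auto
    from has_integral_combine[OF mid Suc.prems(1) this piece[OF Suc.prems]]
    show ?case by (simp add: algebra_simps)
  qed
  have "0 \<le> t / \<tau>" using t \<tau> by simp
  then have "real n \<le> t / \<tau>" "t / \<tau> \<le> real (Suc n)" using t by linarith+
  then show ?thesis using \<tau> by (intro main) (auto simp: pos_le_divide_eq pos_divide_le_eq)
qed

lemma time_step_measurable[measurable]: "time_step \<tau> V \<in> borel_measurable borel"
  unfolding time_step_def[abs_def] by measurable

section \<open>The limit speed and its primitive\<close>

locale bounded_monotone_difference =
  fixes F G :: "real \<Rightarrow> real" and B :: real
  assumes mono: "mono F" "mono G" and bounded: "\<And>x. \<bar>F x\<bar> \<le> B" "\<And>x. \<bar>G x\<bar> \<le> B"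
begin

definition V :: "real \<Rightarrow> real" where "V x = F x - G x"
definition chi :: "real \<Rightarrow> real" where "chi t = integral {0..t} V"

text \<open>The part in \<open>[0, \<infinity>[\<close>, together with 0, becomes the exceptional
  set of the theorem.\<close>

definition jumps :: "real set" where "jumps = {x. \<not> isCont F x} \<union> {x. \<not> isCont G x}"

lemma countable_jumps: "countable jumps"
  unfolding jumps_def using mono_ctble_discont mono by auto

lemma V_bound: "\<bar>V x\<bar> \<le> 2 * B"
  using bounded[of x] unfolding V_def by linarith

lemma B_nonneg: "0 \<le> B" using bounded(1)[of 0] by linarith

lemma V_measurable[measurable]: "V \<in> borel_measurable borel"
  unfolding V_def[abs_def] using borel_measurable_mono[OF mono(1)] borel_measurable_mono[OF mono(2)] by simp

lemma V_integrable: "V integrable_on {s..t}"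
  unfolding V_def[abs_def] using mono
  by (intro integrable_diff integrable_on_mono_on) (auto simp: mono_on_def mono_def)

lemma integral_V_bound: "s \<le> t \<Longrightarrow> \<bar>integral {s..t} V\<bar> \<le> 2 * B * (t - s)"
  using integrable_bound[of "2 * B" V s t] V_integrable V_bound B_nonneg by (simp add: cbox_interval)

text \<open>For \<open>t < 0\<close> the interval \<open>{0..t}\<close> is empty and
  \<open>chi t = 0\<close>, so the Lipschitz bound holds on the whole line.\<close>

lemma chi_diff: "\<bar>chi t - chi s\<bar> \<le> 2 * B * \<bar>t - s\<bar>"
proof -
  have main: "\<bar>chi y - chi x\<bar> \<le> 2 * B * (y - x)" if xy: "x \<le> y" for x y
  proof (cases "0 \<le> x")
    case True
    have "integral {0..x} V + integral {x..y} V = integral {0..y} V"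
      using True xy V_integrable by (intro Henstock_Kurzweil_Integration.integral_combine) auto
    then have "chi y - chi x = integral {x..y} V" by (simp add: chi_def)
    then show ?thesis using integral_V_bound[OF xy] by simp
  next
    case False
    then have x: "chi x = 0" by (simp add: chi_def)
    show ?thesis
    proof (cases "0 \<le> y")
      case True
      have "\<bar>integral {0..y} V\<bar> \<le> 2 * B * (y - 0)" using integral_V_bound True by blast
      also have "\<dots> \<le> 2 * B * (y - x)" using True False B_nonneg by (intro mult_left_mono) auto
      finally show ?thesis using x by (simp add: chi_def)
    next
      case False
      then show ?thesis using x B_nonneg xy by (simp add: chi_def)
    qed
  qed
  show ?thesis
    using main[of s t] main[of t s] by (cases "s \<le> t") (auto simp: abs_minus_commute)
qed

lemma chi_continuous: "continuous_on S chi"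
proof (rule continuous_on_subset[of UNIV])
  show "continuous_on UNIV chi"
    by (rule lipschitz_on_continuous_on[of "2 * B"], rule lipschitz_onI)
      (use chi_diff B_nonneg in \<open>auto simp: dist_real_def\<close>)
qed simp

lemma chi_measurable[measurable]: "chi \<in> borel_measurable borel"
  using chi_continuous by (rule borel_measurable_continuous_onI)

lemma chi_bound: "\<bar>chi t\<bar> \<le> 2 * B * \<bar>t\<bar>"
  using chi_diff[of t 0] by (simp add: chi_def)

lemma chi_derivative:
  assumes "0 < t" "t \<notin> jumps"
  shows "(chi has_real_derivative V t) (at t)"
proof -
  have "isCont V t" using assms unfolding V_def[abs_def] jumps_def by (auto intro!: continuous_intros)
  then have "continuous (at t within ({0..t+1} - {})) V"
    by (meson continuous_within_subset subset_UNIV)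
  then have "(chi has_vector_derivative V t) (at t within ({0..t+1} - {}))"
    unfolding chi_def[abs_def] using assms
    by (intro integral_has_vector_derivative_continuous_at V_integrable) auto
  moreover have "at t within {0..t+1} = at t" using assms by (intro at_within_Icc_at) auto
  ultimately show ?thesis by (simp add: has_real_derivative_iff_has_vector_derivative)
qed

end

text \<open>By translation invariance, the difference quotients have vanishing integral.\<close>

lemma lipschitz_compact_support_integral_deriv:
  fixes \<psi> :: "real \<Rightarrow> real"
  assumes lip: "\<And>x y. \<bar>\<psi> x - \<psi> y\<bar> \<le> K * \<bar>x - y\<bar>" and supp: "\<And>x. x \<notin> {p..q} \<Longrightarrow> \<psi> x = 0"
    and E: "countable E" and der: "\<And>x. x \<notin> E \<Longrightarrow> (\<psi> has_real_derivative \<psi>' x) (at x)"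
    and [measurable]: "\<psi>' \<in> borel_measurable borel"
  shows "integral\<^sup>L lborel \<psi>' = 0"
proof -
  have K: "0 \<le> K" using order_trans[OF abs_ge_zero lip[of 1 0]] by simp
  have cont: "continuous_on UNIV \<psi>"
    by (rule lipschitz_on_continuous_on[of K], rule lipschitz_onI)
      (use lip K in \<open>auto simp: dist_real_def\<close>)
  then have [measurable]: "\<psi> \<in> borel_measurable borel" by (rule borel_measurable_continuous_onI)
  have int: "integrable lborel \<psi>"
  proof -
    have "set_integrable lborel {p..q} \<psi>"
      by (intro borel_integrable_atLeastAtMost' continuous_on_subset[OF cont]) simp
    moreover have "(\<lambda>x. indicator {p..q} x *\<^sub>R \<psi> x) = \<psi>"
    proof
      show "indicator {p..q} x *\<^sub>R \<psi> x = \<psi> x" for x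
        by (cases "x \<in> {p..q}") (use supp[of x] in simp_all)
    qed
    ultimately show ?thesis by (simp add: set_integrable_def)
  qed
  \<comment> \<open>Difference quotients with step \<open>1 / Suc n\<close>; the Lipschitz bound and
    a support enlarged by 1 provide an integrable majorant for all of them.\<close>
  define Q where "Q n x = (\<psi> (1 / real (Suc n) + x) - \<psi> x) * real (Suc n)" for n x
  have [measurable]: "Q n \<in> borel_measurable borel" for n unfolding Q_def[abs_def] by measurable
  have Q0: "integral\<^sup>L lborel (Q n) = 0" for n
  proof -
    have sh: "integral\<^sup>L lborel (\<lambda>x. \<psi> (1 / real (Suc n) + x)) = integral\<^sup>L lborel \<psi>"
      using lborel_integral_real_affine[of 1 \<psi> "1 / real (Suc n)"] by simp
    have "integrable lborel (\<lambda>x. \<psi> (1 / real (Suc n) + 1 * x))"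
      using lborel_integrable_real_affine[OF int, of 1] by simp
    then show ?thesis unfolding Q_def using sh int by simp
  qed
  have "(\<lambda>n. integral\<^sup>L lborel (Q n)) \<longlonglongrightarrow> integral\<^sup>L lborel \<psi>'"
  proof (rule integral_dominated_convergence[where w = "\<lambda>x. K * indicator {p - 1..q + 1} x"])
    show "integrable lborel (\<lambda>x. K * indicator {p - 1..q + 1} x)"
      by (intro integrable_mult_right integrable_real_indicator) (auto simp: emeasure_lborel_Icc_eq)
    show "AE x in lborel. norm (Q n x) \<le> K * indicator {p - 1..q + 1} x" for n
    proof (rule AE_I2)
      fix x
      have r: "0 < 1 / real (Suc n)" "1 / real (Suc n) \<le> 1" by auto
      show "norm (Q n x) \<le> K * indicator {p - 1..q + 1} x"
      proof (cases "x \<in> {p - 1..q + 1}")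
        case True
        have "\<bar>\<psi> (1 / real (Suc n) + x) - \<psi> x\<bar> \<le> K * (1 / real (Suc n))"
          using lip[of "1 / real (Suc n) + x" x] by simp
        then have "\<bar>\<psi> (1 / real (Suc n) + x) - \<psi> x\<bar> * real (Suc n) \<le> K * (1 / real (Suc n)) * real (Suc n)"
          by (intro mult_right_mono) auto
        then show ?thesis using True by (simp add: Q_def abs_mult)
      next
        case False
        moreover have "x \<notin> {p..q} \<and> e + x \<notin> {p..q}" if "0 < e" "e \<le> 1" for e
          using that False by auto
        ultimately have "\<psi> x = 0" "\<psi> (1 / real (Suc n) + x) = 0" using r supp by blast+
        then show ?thesis using False by (simp add: Q_def)
      qed
    qed
    show "AE x in lborel. (\<lambda>n. Q n x) \<longlonglongrightarrow> \<psi>' x"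
    proof (rule AE_I')
      show "E \<in> null_sets lborel" using E by (rule countable_imp_null_set_lborel)
      have "(\<lambda>n. Q n x) \<longlonglongrightarrow> \<psi>' x" if "x \<notin> E" for x
      proof -
        have "((\<lambda>h. (\<psi> (x + h) - \<psi> x) / h) \<longlongrightarrow> \<psi>' x) (at 0)"
          using der[OF that] by (simp add: DERIV_def)
        moreover have "filterlim (\<lambda>n. 1 / real (Suc n)) (at 0) sequentially"
          unfolding filterlim_at using LIMSEQ_inverse_real_of_nat by (auto simp: inverse_eq_divide)
        ultimately have "(\<lambda>n. (\<psi> (x + 1 / real (Suc n)) - \<psi> x) / (1 / real (Suc n))) \<longlonglongrightarrow> \<psi>' x"
          by (rule filterlim_compose)
        then show ?thesis by (simp add: Q_def[abs_def] add.commute)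
      qed
      then show "{x \<in> space lborel. \<not> (\<lambda>n. Q n x) \<longlonglongrightarrow> \<psi>' x} \<subseteq> E" by auto
    qed
  qed simp_all
  then show ?thesis unfolding Q0 by (simp add: LIMSEQ_const_iff)
qed

section \<open>Membership of the primitive in \<open>W1inf_loc\<close>\<close>

lemma borel_measurable_lebesgue_onI: "f \<in> borel_measurable borel \<Longrightarrow> f \<in> borel_measurable (lebesgue_on S)"
  for f :: "real \<Rightarrow> real"
  by (intro measurable_restrict_space1 measurable_completion) simp

lemma Linf_norm_le:
  assumes "f \<in> borel_measurable (lebesgue_on S)" "\<And>x. x \<in> S \<Longrightarrow> \<bar>f x\<bar> \<le> K"
  shows "Linf_norm S f \<le> ennreal K"
  unfolding Linf_norm_def
proof (rule esssup_I)
  show "(\<lambda>x. ennreal \<bar>f x\<bar>) \<in> borel_measurable (lebesgue_on S)" using assms(1) by measurable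
  show "AE x in lebesgue_on S. ennreal \<bar>f x\<bar> \<le> ennreal K"
    using assms(2) by (intro AE_I2 ennreal_leI) simp
qed

lemma Linf_bounded:
  assumes "f \<in> borel_measurable borel" "\<And>x. x \<in> S \<Longrightarrow> \<bar>f x\<bar> \<le> K"
  shows "f \<in> Linf S"
  using Linf_norm_le[OF borel_measurable_lebesgue_onI[OF assms(1)] assms(2)]
    borel_measurable_lebesgue_onI[OF assms(1)]
  by (auto simp: Linf_def intro: le_less_trans[OF _ ennreal_less_top])

text \<open>Passes from the set integrals in \<open>weak_derivative\<close> to integrals over the
  whole line.\<close>

lemma compact_support_integral:
  fixes f :: "real \<Rightarrow> real"
  assumes [measurable]: "f \<in> borel_measurable borel" and b: "\<And>x. x \<in> {p..q} \<Longrightarrow> \<bar>f x\<bar> \<le> K"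
    and z: "\<And>x. x \<notin> {p..q} \<Longrightarrow> f x = 0" and S: "{p..q} \<subseteq> S"
  shows "integrable lborel f" "(LINT x:S|lebesgue. f x) = integral\<^sup>L lborel f"
proof -
  show "integrable lborel f"
  proof (rule Bochner_Integration.integrable_bound)
    show "integrable lborel (\<lambda>x. K * indicator {p..q} x)"
      by (intro integrable_mult_right integrable_real_indicator) (auto simp: emeasure_lborel_Icc_eq)
    show "AE x in lborel. norm (f x) \<le> norm (K * indicator {p..q} x)"
      using b z by (intro AE_I2) (auto simp: indicator_def intro: order_trans[OF _ abs_ge_self])
  qed simp
  have "(\<lambda>x. indicator S x *\<^sub>R f x) = f"
  proof
    fix x
    show "indicator S x *\<^sub>R f x = f x"
    proof (cases "x \<in> {p..q}")
      case True
      then have "x \<in> S" using S by blast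
      then show ?thesis by simp
    qed (simp add: z)
  qed
  then show "(LINT x:S|lebesgue. f x) = integral\<^sup>L lborel f"
    unfolding set_lebesgue_integral_def by (simp add: integral_completion)
qed

context bounded_monotone_difference
begin

text \<open>Integration by parts takes the form that the derivative of
  \<open>chi x * \<theta> x\<close> has integral 0. The product rule holds off the countable set
  \<open>jumps\<close>, which suffices for a Lipschitz function of compact support.\<close>

lemma chi_weak_derivative: "weak_derivative {0<..<T} chi V"
  unfolding weak_derivative_def
proof (intro allI impI)
  fix \<theta> \<theta>' :: "real \<Rightarrow> real"
  assume der: "\<forall>x. (\<theta> has_real_derivative \<theta>' x) (at x)" and cont: "continuous_on UNIV \<theta>'"
    and "\<exists>a b. {a..b} \<subseteq> {0<..<T} \<and> (\<forall>x. x \<notin> {a..b} \<longrightarrow> \<theta> x = 0)"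
  then obtain p q where pq: "{p..q} \<subseteq> {0<..<T}" and z: "\<And>x. x \<notin> {p..q} \<Longrightarrow> \<theta> x = 0" by blast
  have z': "\<theta>' x = 0" if "x \<notin> {p..q}" for x
  proof -
    have "open (- {p..q})" by (simp add: open_Compl)
    then have "(\<theta> has_real_derivative 0) (at x)"
      by (rule has_field_derivative_transform_within_open[OF DERIV_const[of 0]]) (use z that in simp_all)
    then show ?thesis using der DERIV_unique by blast
  qed
  have ct: "continuous_on UNIV \<theta>" using der by (intro DERIV_continuous_on) auto
  have [measurable]: "\<theta> \<in> borel_measurable borel" "\<theta>' \<in> borel_measurable borel"
    using cont ct by (auto intro: borel_measurable_continuous_onI)
  have bdd: "\<exists>K. \<forall>x. \<bar>f x\<bar> \<le> K" if "continuous_on UNIV f" "\<And>x. x \<notin> {p..q} \<Longrightarrow> f x = 0"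
    for f :: "real \<Rightarrow> real"
  proof -
    have "compact (f ` {p..q})" using that(1) by (intro compact_continuous_image) (auto intro: continuous_on_subset)
    then obtain K where K: "\<forall>y\<in>f ` {p..q}. norm y \<le> K" using compact_imp_bounded bounded_iff by blast
    have "\<bar>f x\<bar> \<le> max K 0" for x using K that(2)[of x] by (cases "x \<in> {p..q}") (auto simp: le_max_iff_disj)
    then show ?thesis by blast
  qed
  obtain K1 where K1: "\<And>x. \<bar>\<theta> x\<bar> \<le> K1" using bdd[OF ct z] by blast
  obtain K2 where K2: "\<And>x. \<bar>\<theta>' x\<bar> \<le> K2" using bdd[OF cont z'] by blast
  have K0: "0 \<le> K1" "0 \<le> K2" using K1[of 0] K2[of 0] by linarith+
  define K3 where "K3 = 2 * B * (\<bar>p\<bar> + \<bar>q\<bar>)"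
  have K3: "\<bar>chi x\<bar> \<le> K3" if "x \<in> {p..q}" for x
  proof -
    have "\<bar>chi x\<bar> \<le> 2 * B * \<bar>x\<bar>" by (rule chi_bound)
    also have "\<dots> \<le> K3" unfolding K3_def using that B_nonneg by (intro mult_left_mono) auto
    finally show ?thesis .
  qed
  define \<psi> where "\<psi> x = chi x * \<theta> x" for x
  define \<psi>' where "\<psi>' x = V x * \<theta> x + chi x * \<theta>' x" for x
  have \<theta>_lip: "\<bar>\<theta> x - \<theta> y\<bar> \<le> K2 * \<bar>x - y\<bar>" for x y
    using field_differentiable_bound[of UNIV \<theta> \<theta>' K2 x y] der K2 by simp
  have lip1: "\<bar>\<psi> x - \<psi> y\<bar> \<le> (K3 * K2 + K1 * (2 * B)) * \<bar>x - y\<bar>" if "x \<in> {p..q}" for x y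
  proof -
    have "\<psi> x - \<psi> y = chi x * (\<theta> x - \<theta> y) + \<theta> y * (chi x - chi y)"
      by (simp add: \<psi>_def algebra_simps)
    then have "\<bar>\<psi> x - \<psi> y\<bar> \<le> \<bar>chi x\<bar> * \<bar>\<theta> x - \<theta> y\<bar> + \<bar>\<theta> y\<bar> * \<bar>chi x - chi y\<bar>"
      by (metis abs_mult abs_triangle_ineq)
    also have "\<dots> \<le> K3 * (K2 * \<bar>x - y\<bar>) + K1 * (2 * B * \<bar>x - y\<bar>)"
      using K3[OF that] \<theta>_lip K1 chi_diff[of x y] K0
      by (intro add_mono mult_mono) (auto intro: order_trans[OF abs_ge_zero])
    finally show ?thesis by (simp add: algebra_simps)
  qed
  have lip: "\<bar>\<psi> x - \<psi> y\<bar> \<le> (K3 * K2 + K1 * (2 * B)) * \<bar>x - y\<bar>" for x y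
  proof -
    consider "x \<in> {p..q}" | "y \<in> {p..q}" | "x \<notin> {p..q}" "y \<notin> {p..q}" by blast
    then show ?thesis
    proof cases
      case 3
      have "0 \<le> K3" using B_nonneg by (simp add: K3_def)
      then show ?thesis using 3 z K0 B_nonneg by (simp add: \<psi>_def)
    qed (use lip1[of x y] lip1[of y x] in \<open>simp_all add: abs_minus_commute\<close>)
  qed
  \<comment> \<open>\<open>chi_derivative\<close> covers \<open>x > 0\<close> only; elsewhere
    \<theta> vanishes near \<open>x\<close>, as its support lies in \<open>]0, T[\<close>.\<close>
  have d: "(\<psi> has_real_derivative \<psi>' x) (at x)" if x: "x \<notin> jumps" for x
  proof (cases "0 < x")
    case True
    have "((\<lambda>x. chi x * \<theta> x) has_real_derivative \<psi>' x) (at x)"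
      unfolding \<psi>'_def using DERIV_mult[OF chi_derivative[OF True x], of \<theta> "\<theta>' x"] der
      by (simp add: algebra_simps)
    then show ?thesis by (simp add: \<psi>_def[abs_def])
  next
    case False
    then have x: "x \<notin> {p..q}" using pq by auto
    have "open (- {p..q})" by (simp add: open_Compl)
    then have "(\<psi> has_real_derivative 0) (at x)"
      by (rule has_field_derivative_transform_within_open[OF DERIV_const[of 0]]) (use z x in \<open>simp_all add: \<psi>_def\<close>)
    then show ?thesis using z[OF x] z'[OF x] by (simp add: \<psi>'_def)
  qed
  have [measurable]: "\<psi>' \<in> borel_measurable borel" unfolding \<psi>'_def[abs_def] by measurable
  have zero: "integral\<^sup>L lborel \<psi>' = 0"
    by (rule lipschitz_compact_support_integral_deriv[where p = p and q = q, OF lip _ countable_jumps d])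
      (use z in \<open>auto simp: \<psi>_def\<close>)
  have V\<theta>: "\<bar>V x * \<theta> x\<bar> \<le> 2 * B * K1" "x \<notin> {p..q} \<Longrightarrow> V x * \<theta> x = 0" for x
    unfolding abs_mult using z K1 V_bound B_nonneg by (auto intro!: mult_mono)
  have m: "(\<lambda>x. V x * \<theta> x) \<in> borel_measurable borel" "(\<lambda>x. chi x * \<theta>' x) \<in> borel_measurable borel"
    by measurable
  note I1 = compact_support_integral[OF m(1) V\<theta> pq]
  have \<chi>\<theta>: "x \<in> {p..q} \<Longrightarrow> \<bar>chi x * \<theta>' x\<bar> \<le> K3 * K2" "x \<notin> {p..q} \<Longrightarrow> chi x * \<theta>' x = 0" for x
    unfolding abs_mult using z' K2 K3 K0 by (auto intro!: mult_mono intro: order_trans[OF abs_ge_zero])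
  note I2 = compact_support_integral[OF m(2) \<chi>\<theta> pq]
  have "integral\<^sup>L lborel \<psi>' = (LINT x|lborel. V x * \<theta> x) + (LINT x|lborel. chi x * \<theta>' x)"
    unfolding \<psi>'_def using I1(1) I2(1) by (rule Bochner_Integration.integral_add)
  moreover have "(LINT x:{0<..<T}|lebesgue. V x * \<theta> x) = (LINT x|lborel. V x * \<theta> x)" by (rule I1(2))
  moreover have "(LINT x:{0<..<T}|lebesgue. chi x * \<theta>' x) = (LINT x|lborel. chi x * \<theta>' x)" by (rule I2(2))
  ultimately show "(LINT x:{0<..<T}|lebesgue. chi x * \<theta>' x) = - (LINT x:{0<..<T}|lebesgue. V x * \<theta> x)"
    using zero by linarith
qed

lemma chi_W1inf: "chi \<in> W1inf_loc"
proof -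
  have "chi \<in> Linf {0<..<T}" for T
  proof (rule Linf_bounded[where K = "2 * B * T"])
    show "\<bar>chi x\<bar> \<le> 2 * B * T" if "x \<in> {0<..<T}" for x
    proof -
      have "2 * B * \<bar>x\<bar> \<le> 2 * B * T" using that B_nonneg by (intro mult_left_mono) auto
      then show ?thesis using chi_bound[of x] by linarith
    qed
  qed simp
  moreover have "V \<in> Linf {0<..<T}" for T
    by (rule Linf_bounded[where K = "2 * B"]) (auto simp: V_bound)
  ultimately show ?thesis
    unfolding W1inf_loc_def using chi_continuous chi_weak_derivative by blast
qed

text \<open>For every \<open>t \<le> T\<close> the error is at most the \<open>L^1\<close> distance
  of the speeds on \<open>[0, T]\<close>, whence the uniformity in \<open>t\<close>. This distance
  tends to 0 by dominated convergence, \<open>jumps\<close> being a null set.\<close>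

lemma time_step_integral_converges:
  assumes \<tau>: "\<And>j. 0 < \<tau> j" and K: "\<And>j n. \<bar>v j n\<bar> \<le> K"
    and lim: "\<And>x. x \<notin> jumps \<Longrightarrow> (\<lambda>j. time_step (\<tau> j) (v j) x) \<longlonglongrightarrow> V x"
  shows "\<exists>d. d \<longlonglongrightarrow> 0 \<and> (\<forall>j. \<forall>t\<in>{0..T}. \<bar>chi t - integral {0..t} (time_step (\<tau> j) (v j))\<bar> \<le> d j)"
proof -
  define D where "D j x = indicator {0..T} x * \<bar>V x - time_step (\<tau> j) (v j) x\<bar>" for j x
  have [measurable]: "D j \<in> borel_measurable borel" for j unfolding D_def[abs_def] by measurable
  have K0: "\<bar>time_step (\<tau> j) (v j) x\<bar> \<le> K" for j x using K by (simp add: time_step_def)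
  have Db: "\<bar>V x - time_step (\<tau> j) (v j) x\<bar> \<le> 2 * B + K" for j x
    using V_bound[of x] K0[of j x] by linarith
  have w: "integrable lborel (\<lambda>x. (2 * B + K) * indicator {0..T} x)"
    by (intro integrable_mult_right integrable_real_indicator) (auto simp: emeasure_lborel_Icc_eq)
  have nD: "norm (D j x) \<le> (2 * B + K) * indicator {0..T} x" for j x
    using Db[of x j] by (auto simp: D_def indicator_def)
  have iD: "integrable lborel (D j)" for j
    by (rule Bochner_Integration.integrable_bound[OF w])
      (simp, rule AE_I2, rule order_trans[OF nD], simp only: real_norm_def abs_ge_self)
  have "(\<lambda>j. LINT x|lborel. D j x) \<longlonglongrightarrow> integral\<^sup>L lborel (\<lambda>_::real. 0::real)"
  proof (rule integral_dominated_convergence[where w = "\<lambda>x. (2 * B + K) * indicator {0..T} x"])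
    show "AE x in lborel. (\<lambda>j. D j x) \<longlonglongrightarrow> 0"
    proof (rule AE_I')
      show "jumps \<in> null_sets lborel" using countable_jumps by (rule countable_imp_null_set_lborel)
      have "(\<lambda>j. D j x) \<longlonglongrightarrow> 0" if "x \<notin> jumps" for x
      proof -
        have "(\<lambda>j. indicator {0..T} x * \<bar>V x - time_step (\<tau> j) (v j) x\<bar>) \<longlonglongrightarrow> indicator {0..T} x * \<bar>V x - V x\<bar>"
          by (intro tendsto_intros lim[OF that])
        then show ?thesis by (simp add: D_def)
      qed
      then show "{x \<in> space lborel. \<not> (\<lambda>j. D j x) \<longlonglongrightarrow> 0} \<subseteq> jumps" by auto
    qed
  qed (use nD w in simp_all)
  moreover have "\<bar>chi t - integral {0..t} (time_step (\<tau> j) (v j))\<bar> \<le> integral\<^sup>L lborel (D j)" if t: "t \<in> {0..T}" for j t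
  proof -
    have ts: "time_step (\<tau> j) (v j) integrable_on {0..t}"
      using time_step_has_integral[OF \<tau>, of t _ j "v j"] t by (auto simp: integrable_on_def)
    have si: "set_integrable lborel {0..t} (\<lambda>x. V x - time_step (\<tau> j) (v j) x)"
      unfolding set_integrable_def
    proof (rule Bochner_Integration.integrable_bound[OF w])
      show "AE x in lborel. norm (indicator {0..t} x *\<^sub>R (V x - time_step (\<tau> j) (v j) x))
          \<le> norm ((2 * B + K) * indicator {0..T} x)"
        using t Db[of _ j] by (intro AE_I2) (auto simp: indicator_def intro: order_trans[OF _ abs_ge_self])
    qed simp
    have "chi t - integral {0..t} (time_step (\<tau> j) (v j)) = integral {0..t} (\<lambda>x. V x - time_step (\<tau> j) (v j) x)"
      unfolding chi_def by (rule Henstock_Kurzweil_Integration.integral_diff[symmetric, OF V_integrable ts])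
    also have "\<dots> = (LBINT x:{0..t}. V x - time_step (\<tau> j) (v j) x)"
      using set_borel_integral_eq_integral(2)[OF si] by simp
    also have "\<bar>\<dots>\<bar> \<le> integral\<^sup>L lborel (D j)"
      unfolding set_lebesgue_integral_def
    proof (rule order_trans[OF integral_abs_bound])
      show "(LBINT x. \<bar>indicator {0..t} x *\<^sub>R (V x - time_step (\<tau> j) (v j) x)\<bar>) \<le> integral\<^sup>L lborel (D j)"
        using si[unfolded set_integrable_def] iD t
        by (intro integral_mono integrable_abs) (auto simp: D_def indicator_def)
    qed
    finally show ?thesis .
  qed
  ultimately show ?thesis by (intro exI[of _ "\<lambda>j. integral\<^sup>L lborel (D j)"]) auto
qed

end

section \<open>Convergence\<close>

lemma tendsto_zero_ennrealI:
  fixes f :: "nat \<Rightarrow> ennreal"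
  assumes "\<And>\<epsilon>. 0 < \<epsilon> \<Longrightarrow> \<forall>\<^sub>F j in sequentially. f j \<le> ennreal \<epsilon>"
  shows "f \<longlonglongrightarrow> 0"
proof (rule order_tendstoI)
  fix c :: ennreal assume "0 < c"
  then obtain d where d: "0 < d" "d < c" using dense by blast
  then have "d < top" by (meson less_le_trans top_greatest)
  then obtain r where r: "d = ennreal r" "0 \<le> r" by (cases d) auto
  have "0 < r" using d(1) r by simp
  from assms[OF this] show "\<forall>\<^sub>F j in sequentially. f j < c"
    by eventually_elim (use d r in auto)
qed simp

text \<open>The sampled boundary position differs from the integral of its speed by the discrepancy of the
  sampling sequence.\<close>

lemma walk_follows_speed:
  fixes p :: "nat \<Rightarrow> nat \<Rightarrow> int" and V :: "nat \<Rightarrow> nat \<Rightarrow> real"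
  assumes A: "equidistributed A" and \<rho>: "0 < \<rho>" and mesh: "\<And>j. 0 < \<tau> j" "\<And>j. 0 < h j" "\<And>j. h j / \<tau> j = \<rho>"
    and h0: "h \<longlonglongrightarrow> 0" and p0: "\<And>j. p j 0 = 0"
    and pS: "\<And>j n. p j (Suc n) = p j n + (if A (Suc n) * h j / \<tau> j \<le> V j n then 1 else - 1)"
    and Vb: "\<And>j n. \<bar>V j n\<bar> \<le> \<rho>" and Vv: "\<And>j n. (\<Sum>k<n. \<bar>V j (Suc k) - V j k\<bar>) \<le> B"
    and \<epsilon>: "0 < \<epsilon>" and T: "0 < T"
  shows "\<forall>\<^sub>F j in sequentially. \<forall>n. real n * \<tau> j \<le> T \<longrightarrow>
    \<bar>of_int (p j n) * h j - \<tau> j * (\<Sum>k<n. V j k)\<bar> \<le> \<epsilon>"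
proof -
  \<comment> \<open>The speed in mesh widths per time step, hence a number in
    \<open>[-1, 1]\<close>.\<close>
  define \<theta> where "\<theta> j k = V j k / \<rho>" for j k
  have h\<tau>: "h j = \<rho> * \<tau> j" for j using mesh(3)[of j] mesh(1)[of j] by (simp add: field_simps)
  have B: "0 \<le> B" using Vv[of 0 0] by simp
  have walk: "of_int (p j n) * h j - \<tau> j * (\<Sum>k<n. V j k) = h j * (\<Sum>k<n. bias A k (\<theta> j k))" for j n
  proof (induction n)
    case (Suc n)
    have "A (Suc n) * h j / \<tau> j \<le> V j n \<longleftrightarrow> A (Suc n) \<le> \<theta> j n"
      using \<rho> mesh(1)[of j] by (simp add: h\<tau> \<theta>_def pos_le_divide_eq)
    moreover have "h j * \<theta> j n = \<tau> j * V j n" using \<rho> by (simp add: h\<tau> \<theta>_def)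
    ultimately have "of_int (p j (Suc n)) * h j - \<tau> j * (\<Sum>k<Suc n. V j k)
       = (of_int (p j n) * h j - \<tau> j * (\<Sum>k<n. V j k)) + h j * bias A n (\<theta> j n)"
      by (simp add: pS bias_def algebra_simps)
    then show ?case unfolding Suc by (simp add: algebra_simps)
  qed (simp add: p0)
  have \<theta>: "\<theta> j k \<in> {-1..1}" for j k
    using Vb[of j k] \<rho> by (auto simp: \<theta>_def abs_le_iff divide_le_eq le_divide_eq)
  have \<theta>v: "(\<Sum>k<n. \<bar>\<theta> j (Suc k) - \<theta> j k\<bar>) \<le> B / \<rho>" for j n
  proof -
    have "(\<Sum>k<n. \<bar>\<theta> j (Suc k) - \<theta> j k\<bar>) = (\<Sum>k<n. \<bar>V j (Suc k) - V j k\<bar>) / \<rho>"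
      using \<rho> by (simp add: \<theta>_def diff_divide_distrib[symmetric] abs_divide sum_divide_distrib)
    then show ?thesis using Vv[of j n] \<rho> by (simp add: divide_right_mono)
  qed
  define e where "e = \<epsilon> / (T * \<rho> + 1)"
  have e: "0 < e" using \<epsilon> T \<rho> by (auto simp: e_def intro!: divide_pos_pos add_pos_pos)
  have "0 \<le> B / \<rho>" using B \<rho> by simp
  from equidistributed_walk[OF A this e] obtain N0 where N0: "\<forall>N\<ge>N0. \<forall>\<theta>. (\<forall>k. \<theta> k \<in> {-1..1}) \<longrightarrow>
      (\<forall>n. (\<Sum>k<n. \<bar>\<theta> (Suc k) - \<theta> k\<bar>) \<le> B / \<rho>) \<longrightarrow> (\<forall>n\<le>N. \<bar>\<Sum>k<n. bias A k (\<theta> k)\<bar> \<le> e * real N)"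
    by (rule exE)
  \<comment> \<open>The second bound makes the number \<open>N\<close> of steps up to time
    \<open>T\<close> at least \<open>N0\<close>; the first gives
    \<open>N * h \<le> T * \<rho> + 1\<close>, the denominator in \<open>e\<close>.\<close>
  define c where "c = min 1 (T * \<rho> / (real N0 + 1))"
  have c: "0 < c" using T \<rho> by (auto simp: c_def)
  have "\<forall>\<^sub>F j in sequentially. h j < c" using order_tendstoD(2)[OF h0 c] .
  then show ?thesis
  proof eventually_elim
    fix j assume hc: "h j < c"
    define N where "N = nat \<lceil>T / \<tau> j\<rceil>"
    have "0 \<le> T / \<tau> j" using T mesh(1)[of j] by simp
    then have N: "T / \<tau> j \<le> real N" "real N < T / \<tau> j + 1" unfolding N_def by linarith+
    have "h j * (real N0 + 1) < T * \<rho>" using hc by (simp add: c_def pos_less_divide_eq)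
    then have "(\<tau> j * (real N0 + 1)) * \<rho> < T * \<rho>" by (simp add: h\<tau> mult_ac)
    then have "\<tau> j * (real N0 + 1) < T" using \<rho> by simp
    then have "real N0 + 1 < T / \<tau> j" using mesh(1)[of j] by (simp add: pos_less_divide_eq mult.commute)
    then have NN: "N0 \<le> N" using N by linarith
    have Nh: "real N * h j \<le> T * \<rho> + 1"
    proof -
      have "real N * h j \<le> (T / \<tau> j + 1) * h j" using N mesh(2)[of j] by (intro mult_right_mono) auto
      also have "\<dots> = T * \<rho> + h j" using mesh(1)[of j] by (simp add: h\<tau> distrib_right)
      finally show ?thesis using hc by (simp add: c_def)
    qed
    show "\<forall>n. real n * \<tau> j \<le> T \<longrightarrow> \<bar>of_int (p j n) * h j - \<tau> j * (\<Sum>k<n. V j k)\<bar> \<le> \<epsilon>"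
    proof (intro allI impI)
      fix n assume "real n * \<tau> j \<le> T"
      then have "real n \<le> T / \<tau> j" using mesh(1)[of j] by (simp add: pos_le_divide_eq)
      then have nN: "n \<le> N" using N by linarith
      have b: "\<bar>\<Sum>k<n. bias A k (\<theta> j k)\<bar> \<le> e * real N"
        by (rule N0[rule_format, OF NN, of "\<theta> j" n, OF \<theta> \<theta>v nN])
      have "\<bar>of_int (p j n) * h j - \<tau> j * (\<Sum>k<n. V j k)\<bar> = h j * \<bar>\<Sum>k<n. bias A k (\<theta> j k)\<bar>"
        unfolding walk abs_mult using mesh(2)[of j] by simp
      also have "\<dots> \<le> h j * (e * real N)" using b mesh(2)[of j] by (intro mult_left_mono) auto
      also have "\<dots> = e * (real N * h j)" by simp
      also have "\<dots> \<le> e * (T * \<rho> + 1)" using Nh e by (intro mult_left_mono) auto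
      also have "\<dots> = \<epsilon>" using T \<rho> by (simp add: e_def add_pos_pos order_less_imp_not_eq2)
      finally show "\<bar>of_int (p j n) * h j - \<tau> j * (\<Sum>k<n. V j k)\<bar> \<le> \<epsilon>" .
    qed
  qed
qed

text \<open>The approximate boundary is compared with the integral of its own speed by
  \<open>walk_follows_speed\<close>, and that integral with \<open>chi\<close> by dominated
  convergence, each within \<open>\<epsilon> / 2\<close>.\<close>

lemma sampled_paths_converge:
  fixes p :: "nat \<Rightarrow> nat \<Rightarrow> int" and V :: "nat \<Rightarrow> nat \<Rightarrow> real" and X :: "nat \<Rightarrow> real \<Rightarrow> real"
  assumes A: "equidistributed A" and \<rho>: "0 < \<rho>" and mesh: "\<And>j. 0 < \<tau> j" "\<And>j. 0 < h j" "\<And>j. h j / \<tau> j = \<rho>"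
    and h0: "h \<longlonglongrightarrow> 0" and p0: "\<And>j. p j 0 = 0"
    and pS: "\<And>j n. p j (Suc n) = p j n + (if A (Suc n) * h j / \<tau> j \<le> V j n then 1 else - 1)"
    and Vb: "\<And>j n. \<bar>V j n\<bar> \<le> \<rho>" and Vv: "\<And>j n. (\<Sum>k<n. \<bar>V j (Suc k) - V j k\<bar>) \<le> B"
    and X: "\<And>j t n. 0 \<le> t \<Longrightarrow> n = nat \<lfloor>t / \<tau> j\<rfloor> \<Longrightarrow> X j t = of_int (p j n) * h j + V j n * (t - real n * \<tau> j)"
  shows "\<exists>(r :: nat \<Rightarrow> nat) (chi :: real \<Rightarrow> real) (E :: real set).
       strict_mono r \<and> chi \<in> W1inf_loc \<and>
       (\<forall>T>0. (\<lambda>j. Linf_norm {0<..<T} (\<lambda>t. chi t - X (r j) t)) \<longlonglongrightarrow> 0) \<and>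
       E \<subseteq> {0..} \<and> countable E \<and>
       (\<forall>t\<in>{0..} - E. \<exists>D. (chi has_real_derivative D) (at t within {0..}) \<and>
          (\<lambda>j. right_deriv (X (r j)) t) \<longlonglongrightarrow> D)"
proof -
  obtain r F G where r: "strict_mono (r :: nat \<Rightarrow> nat)" and FG: "mono F" "mono G"
    "\<And>x. \<bar>F x\<bar> \<le> \<rho> + B" "\<And>x. \<bar>G x\<bar> \<le> \<rho> + B"
    and lim: "\<And>x. isCont F x \<Longrightarrow> isCont G x \<Longrightarrow> (\<lambda>j. time_step (\<tau> (r j)) (V (r j)) x) \<longlonglongrightarrow> F x - G x"
    using helly_time_steps[of \<tau> V \<rho> B, OF mesh(1) Vb Vv] by blast
  interpret lim: bounded_monotone_difference F G "\<rho> + B" by unfold_locales (rule FG)+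
  \<comment> \<open>Exhibits the path as a Borel function of \<open>t\<close>, for the measurability
    required by \<open>Linf_norm_le\<close>.\<close>
  have X_eq: "X j t = time_step (\<tau> j) (\<lambda>n. of_int (p j n) * h j - V j n * (real n * \<tau> j)) t
      + time_step (\<tau> j) (V j) t * t" if "0 \<le> t" for j t
    using X[OF that refl, of j] by (simp add: time_step_def algebra_simps)
  have "(\<lambda>j. Linf_norm {0<..<T} (\<lambda>t. lim.chi t - X (r j) t)) \<longlonglongrightarrow> 0" if T: "0 < T" for T
  proof (rule tendsto_zero_ennrealI)
    fix \<epsilon> :: real assume \<epsilon>: "0 < \<epsilon>"
    obtain d where d: "d \<longlonglongrightarrow> 0"
      "\<And>j t. t \<in> {0..T} \<Longrightarrow> \<bar>lim.chi t - integral {0..t} (time_step (\<tau> (r j)) (V (r j)))\<bar> \<le> d j"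
      using lim.time_step_integral_converges[of "\<lambda>j. \<tau> (r j)" "\<lambda>j. V (r j)" \<rho> T] mesh(1) Vb lim
      by (auto simp: lim.jumps_def lim.V_def)
    have "\<forall>\<^sub>F j in sequentially. d j < \<epsilon> / 2" using order_tendstoD(2)[OF d(1), of "\<epsilon> / 2"] \<epsilon> by simp
    moreover have "\<forall>\<^sub>F j in sequentially. \<forall>n. real n * \<tau> (r j) \<le> T \<longrightarrow>
        \<bar>of_int (p (r j) n) * h (r j) - \<tau> (r j) * (\<Sum>k<n. V (r j) k)\<bar> \<le> \<epsilon> / 2"
      using walk_follows_speed[of A \<rho> "\<lambda>j. \<tau> (r j)" "\<lambda>j. h (r j)" "\<lambda>j. p (r j)" "\<lambda>j. V (r j)" B "\<epsilon> / 2" T]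
        A \<rho> mesh LIMSEQ_subseq_LIMSEQ[OF h0 r] p0 pS Vb Vv \<epsilon> T by (simp add: comp_def)
    ultimately show "\<forall>\<^sub>F j in sequentially. Linf_norm {0<..<T} (\<lambda>t. lim.chi t - X (r j) t) \<le> ennreal \<epsilon>"
    proof eventually_elim
      fix j assume dj: "d j < \<epsilon> / 2" and w: "\<forall>n. real n * \<tau> (r j) \<le> T \<longrightarrow>
        \<bar>of_int (p (r j) n) * h (r j) - \<tau> (r j) * (\<Sum>k<n. V (r j) k)\<bar> \<le> \<epsilon> / 2"
      show "Linf_norm {0<..<T} (\<lambda>t. lim.chi t - X (r j) t) \<le> ennreal \<epsilon>"
      proof (rule Linf_norm_le)
        have "(\<lambda>t. lim.chi t - (time_step (\<tau> (r j)) (\<lambda>n. of_int (p (r j) n) * h (r j) - V (r j) n * (real n * \<tau> (r j))) t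
            + time_step (\<tau> (r j)) (V (r j)) t * t)) \<in> borel_measurable (lebesgue_on {0<..<T})"
          by (rule borel_measurable_lebesgue_onI) measurable
        then show "(\<lambda>t. lim.chi t - X (r j) t) \<in> borel_measurable (lebesgue_on {0<..<T})"
          by (rule iffD1[OF measurable_cong, rotated]) (simp add: X_eq)
        fix t assume t: "t \<in> {0<..<T}"
        define n where "n = nat \<lfloor>t / \<tau> (r j)\<rfloor>"
        have "0 \<le> t / \<tau> (r j)" using t mesh(1)[of "r j"] by simp
        then have "real n \<le> t / \<tau> (r j)" unfolding n_def by linarith
        then have "real n * \<tau> (r j) \<le> T" using mesh(1)[of "r j"] t by (simp add: pos_le_divide_eq)
        then have "\<bar>of_int (p (r j) n) * h (r j) - \<tau> (r j) * (\<Sum>k<n. V (r j) k)\<bar> \<le> \<epsilon> / 2" using w by blast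
        moreover have "integral {0..t} (time_step (\<tau> (r j)) (V (r j)))
            = \<tau> (r j) * (\<Sum>k<n. V (r j) k) + V (r j) n * (t - real n * \<tau> (r j))"
          using time_step_has_integral[OF mesh(1), of t n] t n_def by (intro integral_unique) auto
        moreover have "X (r j) t = of_int (p (r j) n) * h (r j) + V (r j) n * (t - real n * \<tau> (r j))"
          using X[of t n "r j"] t n_def by simp
        moreover have "\<bar>lim.chi t - integral {0..t} (time_step (\<tau> (r j)) (V (r j)))\<bar> \<le> d j"
          using d(2)[of t j] t by simp
        ultimately show "\<bar>lim.chi t - X (r j) t\<bar> \<le> \<epsilon>" using dj by linarith
      qed
    qed
  qed
  \<comment> \<open>The time 0 joins the exceptional set, because \<open>chi_derivative\<close> is
    two-sided and holds at positive times.\<close>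
  moreover have "\<exists>D. (lim.chi has_real_derivative D) (at t within {0..}) \<and> (\<lambda>j. right_deriv (X (r j)) t) \<longlonglongrightarrow> D"
    if t: "t \<in> {0..} - insert 0 (lim.jumps \<inter> {0..})" for t
  proof (intro exI conjI)
    show "(lim.chi has_real_derivative lim.V t) (at t within {0..})"
      using lim.chi_derivative[of t] t by (auto intro: has_field_derivative_at_within)
    have "right_deriv (X j) t = time_step (\<tau> j) (V j) t" for j
    proof -
      define n where "n = \<lfloor>t / \<tau> j\<rfloor>"
      have t0: "0 \<le> t / \<tau> j" using t mesh(1)[of j] by simp
      have n: "0 \<le> n" "of_int n \<le> t / \<tau> j" "t / \<tau> j < of_int n + 1" using t0 by (auto simp: n_def)
      have tn: "t < (of_int n + 1) * \<tau> j" using n(3) mesh(1)[of j] by (simp add: pos_divide_less_eq)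
      have "X j s = (of_int (p j (nat n)) * h j - V j (nat n) * (real (nat n) * \<tau> j)) + V j (nat n) * s"
        if s: "t \<le> s" "s < (of_int n + 1) * \<tau> j" for s
      proof -
        have "of_int n \<le> s / \<tau> j" using n(2) s mesh(1)[of j] by (simp add: pos_le_divide_eq)
        moreover have "s / \<tau> j < of_int n + 1" using s mesh(1)[of j] by (simp add: pos_divide_less_eq)
        ultimately have "\<lfloor>s / \<tau> j\<rfloor> = n" by (simp add: floor_unique)
        then show ?thesis using X[of s "nat n" j] s t by (simp add: algebra_simps)
      qed
      from right_deriv_affine[OF tn this] show ?thesis by (simp add: time_step_def n_def)
    qed
    moreover have "(\<lambda>j. time_step (\<tau> (r j)) (V (r j)) t) \<longlonglongrightarrow> lim.V t"
      using lim[of t] t by (auto simp: lim.jumps_def lim.V_def)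
    ultimately show "(\<lambda>j. right_deriv (X (r j)) t) \<longlonglongrightarrow> lim.V t" by simp
  qed
  moreover have "countable (insert 0 (lim.jumps \<inter> {0..}))" using lim.countable_jumps by auto
  ultimately show ?thesis
    using r lim.chi_W1inf
    by (intro exI[of _ r] exI[of _ lim.chi] exI[of _ "insert 0 (lim.jumps \<inter> {0..})"]) auto
qed

theorem theorem4p1:
  fixes M :: material and uLs uRs :: state and Vs :: real
  assumes "trilinear M" and "admissible_phi M"
    and "single_phase_boundary M uLs uRs Vs"
    and "Vs = c3 M \<Longrightarrow>
      snd uLs = 0 \<and> snd uRs = sqrt (deriv_in (phi_dom M) (phi M) (c3 M) / c3 M)"
  shows "\<exists>\<delta>>0. \<forall>(uL0 :: real \<Rightarrow> state) (uR0 :: real \<Rightarrow> state) (u0 :: real \<Rightarrow> state)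
      (a :: nat \<Rightarrow> real) (\<rho> :: real) (\<tau> :: nat \<Rightarrow> real) (h :: nat \<Rightarrow> real).
    uL0 \<in> BV_loc {..<0} (H1 M) \<longrightarrow> uR0 \<in> BV_loc {0<..} (H3 M) \<longrightarrow>
    BV_norm {..<0} (\<lambda>x. uL0 x - uLs) + BV_norm {0<..} (\<lambda>x. uR0 x - uRs) < ennreal \<delta> \<longrightarrow>
    (\<forall>x<0. u0 x = uL0 x) \<longrightarrow> (\<forall>x>0. u0 x = uR0 x) \<longrightarrow>
    equidistributed a \<longrightarrow>
    (\<forall>j. \<tau> j > 0 \<and> h j > 0 \<and> h j / \<tau> j = \<rho> \<and> \<tau> j * c1 M < h j) \<longrightarrow> h \<longlonglongrightarrow> 0 \<longrightarrow>
    (snd uLs = wM M \<longrightarrow>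
      (\<forall>j. no_new_phase (H1 M) (c1 M) (glimm_state M (\<tau> j) (h j) a u0))) \<longrightarrow>
    (snd uRs = wm M \<longrightarrow>
      (\<forall>j. no_new_phase (H3 M) (c3 M) (glimm_state M (\<tau> j) (h j) a u0))) \<longrightarrow>
    (let chih = (\<lambda>j. phase_boundary M (glimm M (\<tau> j) (h j) a u0)) in
     \<exists>(r :: nat \<Rightarrow> nat) (chi :: real \<Rightarrow> real) (E :: real set).
       strict_mono r \<and> chi \<in> W1inf_loc \<and>
       (\<forall>T>0. (\<lambda>j. Linf_norm {0<..<T} (\<lambda>t. chi t - chih (r j) t)) \<longlonglongrightarrow> 0) \<and>
       E \<subseteq> {0..} \<and> countable E \<and>
       (\<forall>t\<in>{0..} - E. \<exists>D. (chi has_real_derivative D) (at t within {0..}) \<and>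
          (\<lambda>j. right_deriv (chih (r j)) t) \<longlonglongrightarrow> D))"
proof -
  interpret admissible_material M using assms(1,2) by unfold_locales
  note D = single_phase_boundaryD[OF assms(3)]
  define Hs where "Hs = h_two_phase M uLs uRs"
  obtain \<eta> C Wx where bm: "boundary_modulus Hs (snd uRs) \<eta> C Wx"
    using boundary_modulus_exists[OF assms(3)] assms(4) unfolding Hs_def by blast
  have pos: "0 < \<eta>" "0 \<le> C" using bm by (auto simp: boundary_modulus_def)
  have wr: "wm M \<le> snd uRs" using D(2) by (auto simp: H3_def)
  \<comment> \<open>The constant of \<open>lstrain_close\<close>; \<open>D(4)\<close> identifies the
    strain at the reference point with that of \<open>uLs\<close>.\<close>
  define K where "K = 1 + (\<bar>Hs\<bar> + \<eta>) / (c1 M - c3 M) * (C + C * (\<bar>Hs\<bar> + \<eta>))"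
  have K: "0 \<le> K" unfolding K_def using pos speeds by (intro add_nonneg_nonneg mult_nonneg_nonneg divide_nonneg_nonneg) auto
  have close: "\<bar>lstrain H w - snd uLs\<bar> \<le> K * (\<bar>H - Hs\<bar> + \<bar>w - snd uRs\<bar>)"
    if "\<bar>H - Hs\<bar> \<le> \<eta>" "wm M \<le> w" for H w
    using lstrain_close[OF bm wr that(2,1)] D(4) by (simp add: K_def Hs_def)
  \<comment> \<open>Chosen from the material and the reference states alone, before the data, the
    sampling sequence and the mesh.\<close>
  obtain \<delta> where \<delta>: "0 < \<delta>" "2 * ((1 + c1 M) * \<delta>) / (c1 M + c3 M) \<le> \<eta>"
      "strain_gain K C * ((1 + c1 M) * \<delta>) < 1 + snd uLs"
      "(1 + left_gain K C) * ((1 + c1 M) * \<delta>) / (2 * c1 M) < 1 + snd uLs" "\<delta> < 1 + snd uLs"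
      "snd uLs = wM M \<or> snd uLs + (1 + left_gain K C) * ((1 + c1 M) * \<delta>) / (2 * c1 M) \<le> wM M"
      "snd uRs = wm M \<or> wm M \<le> snd uRs - (1 + right_gain C) * ((1 + c1 M) * \<delta>) / (2 * c3 M)"
    using admissible_delta_exists[OF D(1,2) pos(1), of K C] by blast
  show ?thesis
  proof (intro exI[of _ \<delta>] conjI allI impI)
    fix uL0 uR0 u0 :: "real \<Rightarrow> state" and A :: "nat \<Rightarrow> real" and \<rho> :: real and \<tau> h :: "nat \<Rightarrow> real"
    assume uL0: "uL0 \<in> BV_loc {..<0} (H1 M)" and uR0: "uR0 \<in> BV_loc {0<..} (H3 M)"
      and bv: "BV_norm {..<0} (\<lambda>x. uL0 x - uLs) + BV_norm {0<..} (\<lambda>x. uR0 x - uRs) < ennreal \<delta>"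
      and u0: "\<forall>x<0. u0 x = uL0 x" "\<forall>x>0. u0 x = uR0 x" and A: "equidistributed A"
      and mesh: "\<forall>j. \<tau> j > 0 \<and> h j > 0 \<and> h j / \<tau> j = \<rho> \<and> \<tau> j * c1 M < h j" and h0: "h \<longlonglongrightarrow> 0"
      and nL: "snd uLs = wM M \<longrightarrow> (\<forall>j. no_new_phase (H1 M) (c1 M) (glimm_state M (\<tau> j) (h j) A u0))"
      and nR: "snd uRs = wm M \<longrightarrow> (\<forall>j. no_new_phase (H3 M) (c3 M) (glimm_state M (\<tau> j) (h j) A u0))"
    have mesh': "0 < \<tau> j" "0 < h j" "h j / \<tau> j = \<rho>" "\<tau> j * c1 M < h j" for j using mesh by auto
    define B where "B = variation_bound C (\<bar>Hs\<bar> + \<eta>) ((1 + c1 M) * \<delta>) (2 * ((1 + c1 M) * \<delta>))"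
    define X where "X j = phase_boundary M (glimm M (\<tau> j) (h j) A u0)" for j
    define Q where "Q j p V \<longleftrightarrow> p 0 = (0::int) \<and>
        (\<forall>n. p (Suc n) = p n + (if A (Suc n) * h j / \<tau> j \<le> V n then 1 else - 1)) \<and>
        (\<forall>n. \<bar>V n\<bar> \<le> c1 M) \<and> (\<forall>n. (\<Sum>k<n. \<bar>V (Suc k) - V k\<bar>) \<le> B) \<and>
        (\<forall>t\<ge>0. \<forall>n. n = nat \<lfloor>t / \<tau> j\<rfloor> \<longrightarrow> X j t = of_int (p n) * h j + V n * (t - real n * \<tau> j))"
      for j p V
    have "\<exists>p V. Q j p V" for j
      unfolding Q_def B_def X_def Hs_def
      by (rule glimm_boundary_run[OF D(1,2,4) bm[unfolded Hs_def] K close[unfolded Hs_def] \<delta> uL0 uR0 bv])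
        (use u0 mesh' nL nR in auto)
    then obtain p V where Q: "\<And>j. Q j (p j) (V j)" by metis
    have pV: "\<And>j. p j 0 = (0::int)"
      "\<And>j n. p j (Suc n) = p j n + (if A (Suc n) * h j / \<tau> j \<le> V j n then 1 else - 1)"
      "\<And>j n. \<bar>V j n\<bar> \<le> c1 M" "\<And>j n. (\<Sum>k<n. \<bar>V j (Suc k) - V j k\<bar>) \<le> B"
      "\<And>j t n. 0 \<le> t \<Longrightarrow> n = nat \<lfloor>t / \<tau> j\<rfloor> \<Longrightarrow> X j t = of_int (p j n) * h j + V j n * (t - real n * \<tau> j)"
      using Q unfolding Q_def by blast+
    \<comment> \<open>The mesh ratio exceeds the largest wave speed, so speeds divided by \<rho> lie
      in \<open>[-1, 1]\<close>, the range of the sampling thresholds.\<close>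
    have "c1 M * \<tau> 0 < h 0" using mesh'(4)[of 0] by (simp only: mult.commute)
    then have "c1 M < h 0 / \<tau> 0" by (simp only: pos_less_divide_eq[OF mesh'(1)])
    then have \<rho>: "c1 M < \<rho>" by (simp only: mesh'(3))
    have V\<rho>: "\<And>j n. \<bar>V j n\<bar> \<le> \<rho>" using pV(3) \<rho> by (meson less_imp_le order_trans)
    have \<rho>0: "0 < \<rho>" using \<rho> speeds by linarith
    show "let chih = (\<lambda>j. phase_boundary M (glimm M (\<tau> j) (h j) A u0)) in
     \<exists>(r :: nat \<Rightarrow> nat) (chi :: real \<Rightarrow> real) (E :: real set).
       strict_mono r \<and> chi \<in> W1inf_loc \<and>
       (\<forall>T>0. (\<lambda>j. Linf_norm {0<..<T} (\<lambda>t. chi t - chih (r j) t)) \<longlonglongrightarrow> 0) \<and>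
       E \<subseteq> {0..} \<and> countable E \<and>
       (\<forall>t\<in>{0..} - E. \<exists>D. (chi has_real_derivative D) (at t within {0..}) \<and>
          (\<lambda>j. right_deriv (chih (r j)) t) \<longlonglongrightarrow> D)"
      unfolding Let_def X_def[symmetric]
      by (rule sampled_paths_converge[OF A \<rho>0 mesh'(1,2,3) h0 pV(1,2) V\<rho> pV(4,5)])
  qed (rule \<delta>(1))
qed

end
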